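(* As rings of holomorphic functions on the upper half plane, $$\mathcal M(\Gamma(4))_{\frac12\mathbb M}=\mathbb C\big[\theta(\tau/4),\theta(\tau)\big]=\mathbb C\big[\eta^{\flat}(\tau/2),\eta^{\sharp}(2\tau)\big],$$ $$\mathcal S(\Gamma(4))_{\frac12\mathbb M}=\mathcal M(\Gamma(4))_{\frac12\mathbb M}\,\eta^6.$$
   Context: $\mathbb M=\{0,1,2,\dots\}$, $\frac12\mathbb M=\{k/2: k\in\mathbb M\}$; $\mathcal H$ is the upper half plane, $q^r=e^{2\pi i r\tau}$ for $\tau\in\mathcal H$. $\Gamma(4)$ is the principal congruence subgroup of level 4. For $\gamma=\begin{pmatrix}a&b\\c&d\end{pmatrix}\in\mathrm{SL}_2(\mathbb Z)$ put $J_{k/2}(\gamma,\tau)=\left(\frac cd\right)^k\big(\sqrt{c\tau+d}\,\big)^k$ for $k\in\mathbb M$, where $\sqrt{\cdot}$ is the square root with argument in $(-\frac\pi2,\frac\pi2]$ and $\left(\frac nm\right)$ is the Kronecker symbol: multiplicative in $m$, the Legendre symbol for $m$ an odd prime, $\left(\frac n2\right)=1,-1,0$ according as $n\equiv\pm1\ (8)$, $n\equiv\pm3\ (8)$, $n$ even, $\left(\frac n1\right)=1$, $\left(\frac n{-1}\right)=1$ if $n\ge0$ and $-1$ otherwise, $\left(\frac n0\right)=1$ if $n=\pm1$ and $-1$ otherwise (so for even $k$ this is $(c\tau+d)^{k/2}$). Put $(f|_{k/2}\gamma)(\tau)=f(\gamma\tau)/J_{k/2}(\gamma,\tau)$. For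 a congruence subgroup $\varGamma$, $\mathcal M(\varGamma)_{k/2}$ is the space of holomorphic $f$ on $\mathcal H$ with $f|_{k/2}\gamma=f$ for all $\gamma\in\varGamma$ and $f|_{k/2}\alpha$ bounded as $\operatorname{Im}\tau\to\infty$ for all $\alpha\in\mathrm{SL}_2(\mathbb Z)$; $\mathcal S(\varGamma)_{k/2}$ is the subspace where $f|_{k/2}\alpha\to0$ as $\operatorname{Im}\tau\to\infty$ for all $\alpha\in\mathrm{SL}_2(\mathbb Z)$. $\mathcal M(\varGamma)_{\frac12\mathbb M}=\bigoplus_{k\in\mathbb M}\mathcal M(\varGamma)_{k/2}$, and similarly for $\mathcal S$. $\mathbb C[f,g]$ denotes the $\mathbb C$-subalgebra generated by $f,g$. $\theta(\tau)=\sum_{n\in\mathbb Z}q^{n^2}$; $\eta(\tau)=q^{1/24}\prod_{n\ge1}(1-q^n)$; $\eta^{\flat}(\tau)=\eta(\tau/2)^2/\eta(\tau)$, $\eta^{\sharp}(\tau)=\eta(2\tau)^2/\eta(\tau)$. *)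

theory Defs
  imports "HOL-Analysis.Analysis" "HOL-Number_Theory.Residues"
begin

definition upper_half_plane :: "complex set" where
  "upper_half_plane = {\<tau>. Im \<tau> > 0}"

(* Functions on the upper half plane are the elements of extensional upper_half_plane,
   so that equality of such functions is equality of their values there. *)

definition q_pow :: "real \<Rightarrow> complex \<Rightarrow> complex" where
  "q_pow r \<tau> = exp (2 * of_real pi * \<i> * of_real r * \<tau>)"


definition SL2Z :: "(int^2^2) set" where
  "SL2Z = {\<gamma>. det \<gamma> = 1}"

definition principal_congruence_subgroup :: "nat \<Rightarrow> (int^2^2) set" where
  "principal_congruence_subgroup N =
     {\<gamma> \<in> SL2Z. \<forall>i j. [\<gamma> $ i $ j = mat 1 $ i $ j] (mod int N)}"

definition act :: "int^2^2 \<Rightarrow> complex \<Rightarrow> complex" where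
  "act \<gamma> \<tau> =
     moebius (of_int (\<gamma>$1$1)) (of_int (\<gamma>$1$2)) (of_int (\<gamma>$2$1)) (of_int (\<gamma>$2$2)) \<tau>"


definition kronecker_at_prime :: "int \<Rightarrow> nat \<Rightarrow> int" where
  "kronecker_at_prime n p =
     (if p = 2 then
        (if [n = 1] (mod 8) \<or> [n = -1] (mod 8) then 1
         else if [n = 3] (mod 8) \<or> [n = -3] (mod 8) then -1 else 0)
      else Legendre n (int p))"

(* The value at m = 0 is +1 for n = 1, -1 and -1 (rather than the more common 0) otherwise. *)
definition kronecker :: "int \<Rightarrow> int \<Rightarrow> int" where
  "kronecker n m =
     (if m = 0 then (if n = 1 \<or> n = -1 then 1 else -1)
      else (if m < 0 \<and> n < 0 then -1 else 1) *
           (\<Prod>p\<in>#prime_factorization (nat \<bar>m\<bar>). kronecker_at_prime n p))"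

lemma kronecker_1: "kronecker n 1 = 1"
  by (simp add: kronecker_def)

lemma kronecker_minus_1: "kronecker n (-1) = (if n \<ge> 0 then 1 else -1)"
  by (simp add: kronecker_def)

lemma kronecker_prime: "prime p \<Longrightarrow> kronecker n (int p) = kronecker_at_prime n p"
  by (auto simp: kronecker_def prime_factorization_prime dest: prime_gt_0_nat)

lemma kronecker_mult:
  assumes "m \<noteq> 0" "m' \<noteq> 0"
  shows "kronecker n (m * m') = kronecker n m * kronecker n m'"
proof -
  have "prime_factorization (nat \<bar>m * m'\<bar>) =
          prime_factorization (nat \<bar>m\<bar>) + prime_factorization (nat \<bar>m'\<bar>)"
    using assms by (simp add: abs_mult nat_mult_distrib prime_factorization_mult)
  then show ?thesis
    using assms by (auto simp: kronecker_def mult_less_0_iff)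
qed


(* Weights k/2 are indexed by k. The library's csqrt takes the argument in (-pi/2, pi/2]. *)
definition automorphy_factor :: "nat \<Rightarrow> int^2^2 \<Rightarrow> complex \<Rightarrow> complex" where
  "automorphy_factor k \<gamma> \<tau> =
     of_int (kronecker (\<gamma>$2$1) (\<gamma>$2$2)) ^ k * csqrt (of_int (\<gamma>$2$1) * \<tau> + of_int (\<gamma>$2$2)) ^ k"

definition slash :: "nat \<Rightarrow> (complex \<Rightarrow> complex) \<Rightarrow> int^2^2 \<Rightarrow> complex \<Rightarrow> complex" where
  "slash k f \<gamma> \<tau> = f (act \<gamma> \<tau>) / automorphy_factor k \<gamma> \<tau>"

abbreviation at_i_infinity :: "complex filter" where
  "at_i_infinity \<equiv> filtercomap Im at_top"

definition modular_forms :: "(int^2^2) set \<Rightarrow> nat \<Rightarrow> (complex \<Rightarrow> complex) set" where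
  "modular_forms \<Gamma> k =
     {f \<in> extensional upper_half_plane.
        f holomorphic_on upper_half_plane \<and>
        (\<forall>\<gamma>\<in>\<Gamma>. \<forall>\<tau>\<in>upper_half_plane. slash k f \<gamma> \<tau> = f \<tau>) \<and>
        (\<forall>\<alpha>\<in>SL2Z. Bfun (slash k f \<alpha>) at_i_infinity)}"

definition cusp_forms :: "(int^2^2) set \<Rightarrow> nat \<Rightarrow> (complex \<Rightarrow> complex) set" where
  "cusp_forms \<Gamma> k =
     {f \<in> modular_forms \<Gamma> k. \<forall>\<alpha>\<in>SL2Z. (slash k f \<alpha> \<longlongrightarrow> 0) at_i_infinity}"

(* The direct sum over all weights, formed inside the functions on the upper half plane.
   Lemma modular_forms_independent shows that for the groups in question the sum is direct. *)
definition sum_of_weights :: "(nat \<Rightarrow> (complex \<Rightarrow> complex) set) \<Rightarrow> (complex \<Rightarrow> complex) set" where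
  "sum_of_weights V =
     {\<lambda>\<tau>\<in>upper_half_plane. \<Sum>k\<in>K. F k \<tau> | K F. finite K \<and> (\<forall>k\<in>K. F k \<in> V k)}"

lemma modular_forms_independent:
  assumes N: "N > 0" and K: "finite K"
    and F: "\<And>k. k \<in> K \<Longrightarrow> F k \<in> modular_forms (principal_congruence_subgroup N) k"
    and sum0: "\<And>\<tau>. \<tau> \<in> upper_half_plane \<Longrightarrow> (\<Sum>k\<in>K. F k \<tau>) = 0"
    and k: "k \<in> K" and \<tau>: "\<tau> \<in> upper_half_plane"
  shows "F k \<tau> = 0"
proof -
  define g :: "nat \<Rightarrow> int^2^2" where
    "g n = (\<chi> i j. if i = j then 1 else if i = 2 then int (N * n) else 0)" for n
  define w where "w n = csqrt (of_nat (N * n) * \<tau> + 1)" for n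
  have g: "g n $ 1 $ 1 = 1" "g n $ 1 $ 2 = 0" "g n $ 2 $ 1 = int (N * n)" "g n $ 2 $ 2 = 1" for n
    by (auto simp: g_def)
  have g_mem: "g n \<in> principal_congruence_subgroup N" for n
    by (auto simp: principal_congruence_subgroup_def SL2Z_def det_2 g forall_2 mat_def cong_def)
  have Im: "Im \<tau> > 0" using \<tau> by (simp add: upper_half_plane_def)
  have nz: "of_nat (N * n) * \<tau> + 1 \<noteq> 0" for n
  proof
    assume "of_nat (N * n) * \<tau> + 1 = 0"
    then have "Im (of_nat (N * n) * \<tau> + 1) = 0" "Re (of_nat (N * n) * \<tau> + 1) = 0" by simp_all
    then show False using Im N by auto
  qed
  have w0: "w n \<noteq> 0" for n using nz[of n] by (simp add: w_def)
  have J: "automorphy_factor j (g n) \<tau> = w n ^ j" for j n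
    by (simp add: automorphy_factor_def g w_def kronecker_1)
  have mo: "act (g n) \<tau> \<in> upper_half_plane" for n
  proof -
    have "act (g n) \<tau> = \<tau> / (of_nat (N * n) * \<tau> + 1)" by (simp add: act_def moebius_def g)
    moreover have "Im (\<tau> / (of_nat (N * n) * \<tau> + 1)) = Im \<tau> / (cmod (of_nat (N * n) * \<tau> + 1))\<^sup>2"
      by (simp add: Im_divide cmod_power2) (simp add: field_simps)
    ultimately show ?thesis using Im nz[of n] by (simp add: upper_half_plane_def)
  qed
  have tr: "F j (act (g n) \<tau>) = w n ^ j * F j \<tau>" if "j \<in> K" for j n
  proof -
    have "slash j (F j) (g n) \<tau> = F j \<tau>"
      using F[OF that] g_mem[of n] \<tau> by (auto simp: modular_forms_def)
    then show ?thesis using w0[of n] by (simp add: slash_def J field_simps)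
  qed
  define p where "p = (\<Sum>j\<in>K. Polynomial.monom (F j \<tau>) j)"
  have "poly p (w n) = 0" for n
  proof -
    have "poly p (w n) = (\<Sum>j\<in>K. F j (act (g n) \<tau>))"
      by (simp add: p_def poly_sum poly_monom tr mult.commute)
    then show ?thesis using sum0[OF mo] by simp
  qed
  moreover have "inj w"
  proof (rule injI)
    fix m n assume "w m = w n"
    then have "(w m)\<^sup>2 = (w n)\<^sup>2" by simp
    then have "of_nat (N * m) * \<tau> = of_nat (N * n) * \<tau>" by (simp add: w_def)
    moreover have "\<tau> \<noteq> 0" using Im by auto
    ultimately show "m = n" using N by simp
  qed
  ultimately have "infinite {x. poly p x = 0}"
    by (metis (mono_tags, lifting) finite_subset image_subsetI mem_Collect_eq range_inj_infinite)
  then have "p = 0" using poly_roots_finite by blast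
  moreover have "Polynomial.coeff p k = F k \<tau>" using K k by (simp add: p_def coeff_sum)
  ultimately show ?thesis by simp
qed

inductive_set generated_algebra :: "(complex \<Rightarrow> complex) set \<Rightarrow> (complex \<Rightarrow> complex) set"
  for G :: "(complex \<Rightarrow> complex) set" where
  const: "(\<lambda>\<tau>\<in>upper_half_plane. c) \<in> generated_algebra G"
| gen: "f \<in> G \<Longrightarrow> f \<in> generated_algebra G"
| add: "f \<in> generated_algebra G \<Longrightarrow> g \<in> generated_algebra G \<Longrightarrow>
          (\<lambda>\<tau>\<in>upper_half_plane. f \<tau> + g \<tau>) \<in> generated_algebra G"
| mult: "f \<in> generated_algebra G \<Longrightarrow> g \<in> generated_algebra G \<Longrightarrow>
          (\<lambda>\<tau>\<in>upper_half_plane. f \<tau> * g \<tau>) \<in> generated_algebra G"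


definition theta :: "complex \<Rightarrow> complex" where
  "theta \<tau> = (\<Sum>\<^sub>\<infinity>n::int. q_pow (of_int (n\<^sup>2)) \<tau>)"

definition dedekind_eta :: "complex \<Rightarrow> complex" where
  "dedekind_eta \<tau> = q_pow (1/24) \<tau> * (\<Prod>n. 1 - q_pow (of_nat (Suc n)) \<tau>)"

definition eta_flat :: "complex \<Rightarrow> complex" where
  "eta_flat \<tau> = dedekind_eta (\<tau> / 2) ^ 2 / dedekind_eta \<tau>"

definition eta_sharp :: "complex \<Rightarrow> complex" where
  "eta_sharp \<tau> = dedekind_eta (2 * \<tau>) ^ 2 / dedekind_eta \<tau>"

end

theory Submission
  imports Defs "HOL-Complex_Analysis.Complex_Analysis" "HOL-Number_Theory.Quadratic_Reciprocity" "HOL-Real_Asymp.Real_Asymp"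
begin

text \<open>
  Weights are half-integers \<open>k/2\<close>, and \<open>k\<close> is the index used below. Let \<open>x = q^(1/4)\<close>,
  \<open>A(\<tau>) = \<theta>(\<tau>)\<close> and \<open>B(\<tau>) = \<theta>(\<tau>/4) - \<theta>(\<tau>)\<close>, that is, \<open>A\<close> and \<open>B\<close> are the sums of
  \<open>x^(n^2)\<close> over the even and over the odd integers. So \<open>A \<rightarrow> 1\<close> and \<open>B/x \<rightarrow> 2\<close> at infinity, and the
  algebras generated by the two given theta functions and by \<open>A, B\<close> coincide.

  Why every form is a polynomial in \<open>A\<close> and \<open>B\<close>: both have weight \<open>1/2\<close>, and \<open>B\<close> has no zero in the
  upper half plane; it vanishes at a cusp only if that cusp is equivalent to infinity under
  \<open>\<Gamma>(4)\<close>, and there to first order in \<open>x\<close>. Let \<open>F\<close> be a form of index \<open>k + 1\<close> with constant term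
  \<open>c\<close>. Then \<open>F - c A^(k+1)\<close> vanishes at infinity, hence is divisible by \<open>B\<close>, with a quotient of index \<open>k\<close>
  (\<open>form_divide_theta_odd\<close>). The descent ends at weight \<open>0\<close>, where the maximum principle leaves
  only the constants (\<open>form_0_constant\<close>).

  Eta quotients: two identities of Gauss, both special cases of Jacobi's triple product, give
  \<open>\<eta>\<flat>(\<tau>/2) = A - B\<close> and \<open>\<eta>\<sharp>(2\<tau>) = B/2\<close>. They also give \<open>2 \<eta>^6 = A B (A^4 - B^4)\<close>, whose six
  linear factors correspond to the six cusps. The absolute value of \<open>\<eta>^6\<close> transforms with weight \<open>3\<close>
  under all of \<open>SL(2,Z)\<close>, so that \<open>\<eta>^6\<close> vanishes to first order at every cusp and nowhere else.
  A cusp form vanishes at least to this order, and its quotient by \<open>\<eta>^6\<close> is a form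
  (\<open>form_divide_eta\<close>); for \<open>k < 6\<close> this forces it to be zero (\<open>cuspidal_small_weight\<close>).

  Transformation laws: the inversion formula for \<open>\<theta>\<close> is obtained by Polya's method. Summing powers of
  the cosine over roots of unity filters binomial coefficients, and the de Moivre-Laplace limit of
  this finite identity is the inversion formula on the imaginary axis. Translation and inversion
  then act linearly on the pair \<open>(A, B)\<close> up to a common factor, which yields the behaviour at
  all cusps (\<open>theta_pair_SL2Z\<close>). The exact multiplier on \<open>\<Gamma>(4)\<close> comes from the generation of
  \<open>\<Gamma>\<^sub>1(4)\<close> by \<open>\<tau> + 1\<close> and \<open>\<tau>/(4\<tau> + 1)\<close> (\<open>theta_Gamma1_4\<close>): along the first generator the
  Kronecker symbol is constant by quadratic reciprocity (\<open>kronecker_add_period\<close>), along the second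
  one its changes of sign are those of the principal square root (\<open>kronecker_csqrt_cocycle\<close>).
\<close>

section \<open>Jacobi symbols and the periodicity of the Kronecker symbol\<close>

lemma Legendre_cong: "[a = b] (mod p) \<Longrightarrow> Legendre a p = Legendre b p"
  unfolding Legendre_def QuadRes_def cong_def by simp

lemma Legendre_values: "Legendre a p \<in> {-1, 0, 1}"
  by (simp add: Legendre_def)

lemma unit_or_zero_diff: "x \<in> {-1,0,1} \<Longrightarrow> y \<in> {-1,0,1} \<Longrightarrow> \<bar>x - y\<bar> \<le> (2::int)"
  by auto

lemma unit_or_zero_mult: "x \<in> {-1,0,1} \<Longrightarrow> y \<in> {-1,0,1} \<Longrightarrow> x * y \<in> {-1,0,1::int}"
  by auto

text \<open>Both sides lie in \<open>{-1, 0, 1}\<close> and agree modulo \<open>p\<close> by Euler's criterion; as \<open>p > 2\<close>, they are equal.\<close>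
lemma Legendre_mult:
  assumes "prime (p::nat)" "2 < p"
  shows "Legendre (a * b) p = Legendre a p * Legendre b p"
proof -
  have "[Legendre (a * b) p = (a * b) ^ ((p - 1) div 2)] (mod p)"
    using assms by (rule euler_criterion)
  moreover have "[Legendre a p * Legendre b p = a ^ ((p - 1) div 2) * b ^ ((p - 1) div 2)] (mod p)"
    using assms by (intro cong_mult euler_criterion)
  ultimately have "[Legendre (a * b) p = Legendre a p * Legendre b p] (mod p)"
    by (metis cong_sym cong_trans power_mult_distrib)
  then have "int p dvd Legendre (a * b) p - Legendre a p * Legendre b p"
    by (simp add: cong_iff_dvd_diff)
  moreover have "\<bar>Legendre (a * b) p - Legendre a p * Legendre b p\<bar> < int p"
    using unit_or_zero_diff[OF Legendre_values[of "a * b" p]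
        unit_or_zero_mult[OF Legendre_values[of a p] Legendre_values[of b p]]] assms(2)
    by linarith
  ultimately show ?thesis
    by (metis abs_of_nat dvd_imp_le_int eq_iff_diff_eq_0 linorder_not_less)
qed

text \<open>The Jacobi symbol; as a product over prime factors it is only meaningful for odd \<open>m\<close>.\<close>
definition jacobi :: "int \<Rightarrow> nat \<Rightarrow> int" where
  "jacobi a m = (\<Prod>p\<in>#prime_factorization m. Legendre a (int p))"

lemma odd_nat_induct [consumes 1, case_names one prime_mult]:
  assumes "odd (m::nat)" and "P 1"
    and "\<And>p m. prime p \<Longrightarrow> 2 < p \<Longrightarrow> odd m \<Longrightarrow> P m \<Longrightarrow> P (p * m)"
  shows "P m"
  using assms(1)
proof (induction m rule: prime_divisors_induct)
  case (factor p m)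
  then have "2 < p" using prime_ge_2_nat[of p] by (metis even_mult_iff le_neq_implies_less even_numeral)
  with factor assms(3) show ?case by simp
qed (use assms(2) in auto)

lemma jacobi_1 [simp]: "jacobi a 1 = 1" "jacobi a (Suc 0) = 1"
  by (simp_all add: jacobi_def)

lemma jacobi_mult_right: "m \<noteq> 0 \<Longrightarrow> n \<noteq> 0 \<Longrightarrow> jacobi a (m * n) = jacobi a m * jacobi a n"
  by (simp add: jacobi_def prime_factorization_mult)

lemma jacobi_prime: "prime p \<Longrightarrow> jacobi a p = Legendre a (int p)"
  by (simp add: jacobi_def prime_factorization_prime)

lemma jacobi_prime_mult:
  "prime p \<Longrightarrow> odd m \<Longrightarrow> jacobi a (p * m) = Legendre a (int p) * jacobi a m"
  by (subst jacobi_mult_right) (auto simp: jacobi_prime odd_pos intro: Nat.gr0I)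

lemma jacobi_mult_left: "odd m \<Longrightarrow> jacobi (a * b) m = jacobi a m * jacobi b m"
proof (induction m rule: odd_nat_induct)
  case (prime_mult p m)
  then show ?case by (simp add: jacobi_prime_mult Legendre_mult)
qed auto

lemma jacobi_power_left: "odd m \<Longrightarrow> jacobi (a ^ k) m = jacobi a m ^ k"
proof (induction k)
  case 0
  show ?case using \<open>odd m\<close>
  proof (induction m rule: odd_nat_induct)
    case (prime_mult p m)
    have "Legendre 1 p = 1"
      using prime_mult.hyps by (auto simp: Legendre_def QuadRes_def cong_def intro!: exI[of _ 1])
    with prime_mult show ?case by (simp add: jacobi_prime_mult)
  qed auto
qed (simp add: jacobi_mult_left)

lemma jacobi_cong:
  assumes "odd m" "[a = b] (mod int m)"
  shows "jacobi a m = jacobi b m"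
  using assms
proof (induction m rule: odd_nat_induct)
  case (prime_mult p m)
  then have "[a = b] (mod int p)" "[a = b] (mod int m)"
    by (simp_all add: cong_modulus_mult cong_modulus_mult[of a b "int m" "int p"] mult.commute)
  with prime_mult show ?case by (simp add: jacobi_prime_mult Legendre_cong[of a b])
qed auto

lemma jacobi_sign:
  assumes "odd m" "coprime a (int m)"
  shows "jacobi a m = 1 \<or> jacobi a m = -1"
  using assms
proof (induction m rule: odd_nat_induct)
  case (prime_mult p m)
  then have co: "coprime a (int p)" "coprime a (int m)" by auto
  have "\<not> [a = 0] (mod int p)"
    using co prime_mult.hyps
    by (metis cong_0_iff coprime_absorb_left coprime_commute not_prime_unit prime_nat_int_transfer)
  then have "Legendre a (int p) = 1 \<or> Legendre a (int p) = -1" by (auto simp: Legendre_def)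
  with prime_mult co show ?case by (auto simp: jacobi_prime_mult)
qed auto

lemma odd_mod_4: "odd (m::nat) \<Longrightarrow> m mod 4 = 1 \<or> m mod 4 = 3" by presburger

lemma odd_mult_mod_4:
  assumes "odd (p::nat)" "odd (m::nat)"
  shows "(p * m) mod 4 = (if p mod 4 = m mod 4 then 1 else 3)"
proof -
  have "(p * m) mod 4 = ((p mod 4) * (m mod 4)) mod 4" by (simp add: mod_mult_eq)
  then show ?thesis using odd_mod_4[OF assms(1)] odd_mod_4[OF assms(2)] by auto
qed

lemma neg_one_power_half:
  assumes "odd (p::nat)"
  shows "(-1::int) ^ ((p - Suc 0) div 2) = (if p mod 4 = 3 then -1 else 1)"
proof (cases "p mod 4 = 3")
  case True
  then have "odd ((p - 1) div 2)" by presburger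
  then show ?thesis using True by simp
next
  case False
  then have "even ((p - 1) div 2)" using assms by presburger
  then show ?thesis using False by simp
qed

lemma jacobi_minus_one:
  "odd m \<Longrightarrow> jacobi (-1) m = (if m mod 4 = 3 then -1 else 1)"
proof (induction m rule: odd_nat_induct)
  case (prime_mult p m)
  then have "odd p" by (metis prime_odd_nat)
  have "[Legendre (-1) p = (-1) ^ ((p - 1) div 2)] (mod p)"
    using prime_mult.hyps by (intro euler_criterion)
  then have "int p dvd Legendre (-1) p - (-1) ^ ((p - 1) div 2)" by (simp add: cong_iff_dvd_diff)
  moreover have "\<bar>Legendre (-1) p - (-1) ^ ((p - 1) div 2)\<bar> < int p"
    using unit_or_zero_diff[OF Legendre_values[of "-1" p], of "(-1) ^ ((p - 1) div 2)"]
      prime_mult.hyps(2) neg_one_power_half[OF \<open>odd p\<close>] by (auto split: if_splits)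
  ultimately have "Legendre (-1) p = (-1) ^ ((p - 1) div 2)"
    by (metis abs_of_nat dvd_imp_le_int eq_iff_diff_eq_0 linorder_not_less)
  then show ?case
    using prime_mult \<open>odd p\<close> odd_mult_mod_4[of p m] odd_mod_4[of p] odd_mod_4[of m]
    by (auto simp: jacobi_prime_mult neg_one_power_half)
qed auto

text \<open>The sign of quadratic reciprocity, in the form that makes its multiplicativity a matter of residues modulo 4.\<close>
definition recip_sign :: "nat \<Rightarrow> nat \<Rightarrow> int" where
  "recip_sign m n = (if m mod 4 = 3 \<and> n mod 4 = 3 then -1 else 1)"

lemma recip_sign_mult:
  "odd p \<Longrightarrow> odd m \<Longrightarrow> recip_sign (p * m) n = recip_sign p n * recip_sign m n"
  using odd_mult_mod_4[of p m] odd_mod_4[of p] odd_mod_4[of m] by (auto simp: recip_sign_def)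

lemma recip_sign_commute: "recip_sign m n = recip_sign n m"
  by (auto simp: recip_sign_def)

lemma Legendre_reciprocity:
  assumes "prime p" "2 < p" "prime q" "2 < q" "p \<noteq> q"
  shows "Legendre (int p) (int q) * Legendre (int q) (int p) = recip_sign p q"
proof -
  have "odd p" "odd q" using assms by (metis prime_odd_nat)+
  then show ?thesis
    using Quadratic_Reciprocity[OF assms]
    by (auto simp: power_mult neg_one_power_half recip_sign_def)
qed

lemma jacobi_reciprocity_prime:
  assumes "prime p" "2 < p" "odd n" "coprime p n"
  shows "jacobi (int p) n * Legendre (int n) (int p) = recip_sign p n"
  using assms(3,4)
proof (induction n rule: odd_nat_induct)
  case one
  have "Legendre 1 p = 1"
    using assms by (auto simp: Legendre_def QuadRes_def cong_def intro!: exI[of _ 1])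
  then show ?case by (simp add: recip_sign_def)
next
  case (prime_mult q m)
  then have "coprime p m" "coprime p q" by auto
  then have "p \<noteq> q" using assms(1) by auto
  have "odd q" using prime_mult.hyps by (metis prime_odd_nat)
  have "jacobi (int p) (q * m) * Legendre (int (q * m)) (int p) =
     (Legendre (int p) (int q) * Legendre (int q) (int p)) * (jacobi (int p) m * Legendre (int m) (int p))"
    using prime_mult assms by (simp add: jacobi_prime_mult Legendre_mult)
  then show ?case
    using prime_mult \<open>coprime p m\<close> \<open>p \<noteq> q\<close> \<open>odd q\<close> assms(1,2)
    by (simp add: Legendre_reciprocity recip_sign_mult recip_sign_commute[of p])
qed

text \<open>Both sides are multiplicative in each argument, so that the law for primes suffices; the two arguments are decomposed one after the other.\<close>
lemma jacobi_reciprocity: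
  assumes "odd m" "odd n" "coprime m n"
  shows "jacobi (int m) n * jacobi (int n) m = recip_sign m n"
  using assms(1,3)
proof (induction m rule: odd_nat_induct)
  case one
  have "jacobi 1 n = 1" using jacobi_power_left[OF assms(2), of 1 0] by simp
  then show ?case by (simp add: recip_sign_def)
next
  case (prime_mult p m)
  then have "coprime m n" "coprime p n" by auto
  have "odd p" using prime_mult.hyps by (metis prime_odd_nat)
  have "jacobi (int (p * m)) n * jacobi (int n) (p * m) =
     (jacobi (int p) n * Legendre (int n) (int p)) * (jacobi (int m) n * jacobi (int n) m)"
    using prime_mult assms(2) by (simp add: jacobi_prime_mult jacobi_mult_left)
  then show ?case
    using prime_mult \<open>coprime m n\<close> \<open>coprime p n\<close> assms(2) \<open>odd p\<close>
    by (simp add: jacobi_reciprocity_prime recip_sign_mult)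
qed

text \<open>The second supplement is a consequence of reciprocity: \<open>2\<close> is congruent to \<open>-(m - 2)\<close> modulo \<open>m\<close>
  and \<open>m\<close> to \<open>2\<close> modulo \<open>m - 2\<close>, and \<open>m\<close>, \<open>m - 2\<close> are never both \<open>3\<close> modulo \<open>4\<close>. Therefore
  \<open>(2/m) = (-1/m) (2/(m - 2))\<close>, and one descends to \<open>m = 1\<close>.\<close>
lemma jacobi_two:
  "odd m \<Longrightarrow> jacobi 2 m = (if m mod 8 = 1 \<or> m mod 8 = 7 then 1 else -1)"
proof (induction m rule: less_induct)
  case (less m)
  show ?case
  proof (cases "m = 1")
    case False
    have "m \<noteq> 0" using less.prems by (intro notI) simp
    with False have "2 \<le> m" by linarith
    then obtain k where "m = 2 + k" by (rule le_Suc_ex [elim_format]) blast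
    with less.prems have k: "m = k + 2" "odd k" by simp_all
    have "coprime k (k + 2)"
    proof -
      have "coprime k 2" using \<open>odd k\<close> by (simp only: coprime_right_2_iff_odd not_False_eq_True)
      then show ?thesis unfolding coprime_iff_gcd_eq_1 gcd_add2 .
    qed
    have "jacobi 2 m = jacobi (-1) m * jacobi (int k) m"
    proof -
      have "[2 = (-1) * int k] (mod int m)"
        unfolding cong_iff_dvd_diff by (simp add: k(1))
      then show ?thesis
        using jacobi_cong[OF less.prems] by (simp only: jacobi_mult_left[OF less.prems, symmetric])
    qed
    moreover have "jacobi (int k) m = jacobi (int m) k"
    proof -
      have "\<not> (k mod 4 = 3 \<and> (k + 2) mod 4 = 3)" by presburger
      then have "jacobi (int k) m * jacobi (int m) k = 1"
        using jacobi_reciprocity[of k m] less.prems k(2) \<open>coprime k (k + 2)\<close>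
        unfolding k(1) recip_sign_def by metis
      then show ?thesis by (auto simp: zmult_eq_1_iff)
    qed
    moreover have "jacobi (int m) k = jacobi 2 k"
      by (rule jacobi_cong[OF k(2)]) (simp add: cong_iff_dvd_diff k(1))
    moreover have "jacobi 2 k = (if k mod 8 = 1 \<or> k mod 8 = 7 then 1 else -1)"
      using k by (intro less.IH) simp_all
    ultimately have "jacobi 2 m = (if m mod 4 = 3 then -1 else 1) *
        (if k mod 8 = 1 \<or> k mod 8 = 7 then 1 else -1)"
      using jacobi_minus_one[OF less.prems] by (simp only:)
    moreover have "m mod 8 = (k mod 8 + 2) mod 8" unfolding k(1) by (rule mod_add_left_eq [symmetric])
    moreover have "m mod 4 = m mod 8 mod 4" by (rule mod_mod_cancel [symmetric]) simp
    moreover have "k mod 8 = 1 \<or> k mod 8 = 3 \<or> k mod 8 = 5 \<or> k mod 8 = 7"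
      using k(2) by presburger
    ultimately show ?thesis by (elim disjE) simp_all
  qed simp
qed

lemma nat_abs_mod: "int (nat \<bar>d\<bar> mod n) = (if d < 0 then - d else d) mod int n"
  by (simp add: zmod_int)

lemma jacobi_two_abs:
  assumes "odd (d::int)"
  shows "jacobi 2 (nat \<bar>d\<bar>) = (if d mod 8 = 1 \<or> d mod 8 = 7 then 1 else -1)"
proof -
  define r where "r = nat \<bar>d\<bar> mod 8"
  have r: "int r = (if d < 0 then - d else d) mod 8" by (simp add: r_def nat_abs_mod)
  have "(- d) mod 8 = (if d mod 8 = 0 then 0 else 8 - d mod 8)" by (rule zmod_zminus1_eq_if)
  then have "(int r = 1 \<or> int r = 7) \<longleftrightarrow> (d mod 8 = 1 \<or> d mod 8 = 7)"
    unfolding r by (auto split: if_splits)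
  then have "(r = 1 \<or> r = 7) \<longleftrightarrow> (d mod 8 = 1 \<or> d mod 8 = 7)"
    by (metis of_nat_1 of_nat_eq_iff of_nat_numeral)
  then show ?thesis using assms jacobi_two[of "nat \<bar>d\<bar>"] by (simp add: even_nat_iff r_def)
qed

lemma kronecker_odd:
  assumes "odd d"
  shows "kronecker c d = (if d < 0 \<and> c < 0 then -1 else 1) * jacobi c (nat \<bar>d\<bar>)"
proof -
  have "kronecker_at_prime c p = Legendre c (int p)" if "p \<in># prime_factorization (nat \<bar>d\<bar>)" for p
    using that assms by (auto simp: kronecker_at_prime_def in_prime_factors_iff even_nat_iff)
  then have "(\<Prod>p\<in>#prime_factorization (nat \<bar>d\<bar>). kronecker_at_prime c p) = jacobi c (nat \<bar>d\<bar>)"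
    by (simp add: jacobi_def cong: image_mset_cong)
  moreover have "d \<noteq> 0" using assms by auto
  ultimately show ?thesis by (simp add: kronecker_def)
qed

text \<open>For \<open>d\<close> congruent to \<open>1\<close> modulo \<open>4\<close> all signs cancel: if \<open>d < 0\<close>, then \<open>\<bar>d\<bar>\<close> is \<open>3\<close> modulo \<open>4\<close>,
  the sign of \<open>c\<close> in the Kronecker symbol is compensated by \<open>(-1/\<bar>d\<bar>)\<close>, and the reciprocity sign by
  \<open>(-1/\<bar>c1\<bar>)\<close>. The point is that the right-hand side has \<open>d\<close> in the numerator.\<close>
lemma kronecker_reciprocity:
  assumes c: "c = 2 ^ e * c1" "odd c1" and d: "d mod 4 = 1" and co: "coprime c d"
  shows "kronecker c d = jacobi 2 (nat \<bar>d\<bar>) ^ e * jacobi d (nat \<bar>c1\<bar>)"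
proof -
  define D where "D = nat \<bar>d\<bar>"
  define C where "C = nat \<bar>c1\<bar>"
  have "odd d" using d by presburger
  have odd: "odd D" "odd C" using \<open>odd d\<close> c by (simp_all add: D_def C_def even_nat_iff)
  have "coprime c1 d" using co c by auto
  then have "coprime C D" unfolding C_def D_def
    by (metis abs_ge_zero coprime_abs_left_iff coprime_abs_right_iff coprime_int_iff int_nat_eq)
  have jc: "jacobi c D = jacobi 2 D ^ e * jacobi c1 D"
    using odd c by (simp add: jacobi_mult_left jacobi_power_left)
  have sgn_rule: "jacobi a m = (if a < 0 then jacobi (-1) m else 1) * jacobi (int (nat \<bar>a\<bar>)) m"
    if "odd m" for a m
    using jacobi_mult_left[OF that, of "-1" "-a"] by simp
  have cneg: "c < 0 \<longleftrightarrow> c1 < 0" using c by (auto simp: mult_less_0_iff zero_less_mult_iff)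
  have "(- d) mod 4 = 3" using d by (simp add: zmod_zminus1_eq_if)
  then have "int (D mod 4) = (if d < 0 then 3 else 1)"
    unfolding D_def nat_abs_mod using d by simp
  then have Dmod: "D mod 4 = (if d < 0 then 3 else 1)" by (simp split: if_splits)
  have "jacobi (int D) C = 1 \<or> jacobi (int D) C = -1"
    using \<open>coprime C D\<close> by (intro jacobi_sign odd) (simp add: coprime_commute)
  then have rec: "jacobi (int C) D = recip_sign C D * jacobi (int D) C"
    using jacobi_reciprocity[OF odd(2,1) \<open>coprime C D\<close>] by (elim disjE) simp_all
  have e1: "jacobi d C = (if d < 0 then jacobi (-1) C else 1) * jacobi (int D) C"
    unfolding D_def by (rule sgn_rule[OF odd(2)])
  have e2: "jacobi c1 D = (if c1 < 0 then jacobi (-1) D else 1) * jacobi (int C) D"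
    unfolding C_def by (rule sgn_rule[OF odd(1)])
  have "(if d < 0 \<and> c < 0 then -1 else 1) * jacobi c1 D = jacobi d C"
    unfolding e1 e2 rec cneg jacobi_minus_one[OF odd(1)] jacobi_minus_one[OF odd(2)] recip_sign_def Dmod
    by (cases "d < 0"; cases "c1 < 0"; cases "C mod 4 = 3") simp_all
  moreover have "kronecker c d = (if d < 0 \<and> c < 0 then -1 else 1) * jacobi c D"
    unfolding D_def by (rule kronecker_odd[OF \<open>odd d\<close>])
  ultimately show ?thesis
    unfolding jc D_def[symmetric] C_def[symmetric] by (metis mult.left_commute)
qed

text \<open>In the preceding formula \<open>(d/\<bar>c1\<bar>)\<close> depends on \<open>d\<close> modulo \<open>c1\<close> only. The power of \<open>(2/\<bar>d\<bar>)\<close> is trivial if \<open>e = 2\<close>, and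
  otherwise it depends on \<open>d\<close> modulo \<open>8\<close>, which then divides \<open>c\<close>.\<close>
theorem kronecker_add_period:
  assumes "4 dvd c" "d mod 4 = 1" "coprime c d"
  shows "kronecker c (d + c) = kronecker c d"
proof (cases "c = 0")
  case False
  obtain e c1 where e: "c = 2 ^ e * c1" "odd c1"
    using multiplicity_decompose'[of c "2 :: int"] False
    by (metis not_is_unit_0 odd_one dvd_refl even_numeral dvd_trans)
  have e2: "e \<ge> 2"
  proof (rule ccontr)
    assume "\<not> e \<ge> 2"
    then have "e = 0 \<or> e = 1" by auto
    then show False using e assms(1) by (elim disjE) (simp_all, presburger+)
  qed
  have d': "(d + c) mod 4 = 1" using assms by presburger
  have co': "coprime c (d + c)"
    using assms(3) unfolding coprime_iff_gcd_eq_1 add.commute[of d c] gcd_add2 .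
  have "odd d" "odd (d + c)" using assms(2) d' by presburger+
  have "jacobi (d + c) (nat \<bar>c1\<bar>) = jacobi d (nat \<bar>c1\<bar>)"
    using e by (intro jacobi_cong) (auto simp: even_nat_iff cong_iff_dvd_diff)
  moreover have "jacobi 2 (nat \<bar>d + c\<bar>) ^ e = jacobi 2 (nat \<bar>d\<bar>) ^ e"
  proof (cases "e = 2")
    case True
    then show ?thesis using \<open>odd d\<close> \<open>odd (d + c)\<close> by (simp add: jacobi_two_abs)
  next
    case False
    then have "3 \<le> e" using e2 by linarith
    then have "(2::int) ^ 3 dvd 2 ^ e" by (rule le_imp_power_dvd)
    then have "8 dvd c" using e by simp
    then have "(d + c) mod 8 = d mod 8"
      by (metis add.right_neutral dvd_imp_mod_0 mod_add_right_eq)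
    then show ?thesis using \<open>odd d\<close> \<open>odd (d + c)\<close> by (simp add: jacobi_two_abs)
  qed
  ultimately show ?thesis
    using kronecker_reciprocity[OF e d' co'] kronecker_reciprocity[OF e assms(2,3)] by simp
qed simp

text \<open>The numerator enters through its residue, except for its sign when \<open>d\<close> is negative.\<close>
lemma kronecker_add_numerator:
  assumes "odd d" "coprime c d" "coprime c' d" "[c' = c] (mod d)"
  shows "kronecker c' d = (if d < 0 \<and> (c < 0 \<longleftrightarrow> c' \<ge> 0) then -1 else 1) * kronecker c d"
proof -
  have "jacobi c' (nat \<bar>d\<bar>) = jacobi c (nat \<bar>d\<bar>)"
    using assms by (intro jacobi_cong) (auto simp: even_nat_iff cong_iff_dvd_diff)
  then show ?thesis using assms(1) by (auto simp: kronecker_odd)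
qed

lemma kronecker_4_mult:
  assumes "odd d"
  shows "kronecker (4 * c) d = kronecker c d"
proof -
  have "jacobi (2 ^ 2 * c) (nat \<bar>d\<bar>) = jacobi c (nat \<bar>d\<bar>)"
    using assms by (subst jacobi_mult_left, simp add: even_nat_iff)
       (subst jacobi_power_left, simp_all add: even_nat_iff jacobi_two_abs)
  then show ?thesis using assms by (auto simp: kronecker_odd)
qed

lemma Legendre_nonzero: 
  assumes "prime (p::nat)" "coprime a (int p)" shows "Legendre a (int p) \<noteq> 0"
proof -
  have "\<not> int p dvd a" using assms by (metis coprime_absorb_left coprime_commute not_prime_unit prime_nat_int_transfer)
  then show ?thesis by (auto simp: Legendre_def cong_0_iff)
qed

lemma abs_kronecker:
  assumes "coprime c d"
  shows "\<bar>kronecker c d\<bar> = 1"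
proof (cases "d = 0")
  case False
  have "\<bar>\<Prod>p\<in>#M. kronecker_at_prime c p\<bar> = 1"
    if "\<forall>p\<in>#M. \<bar>kronecker_at_prime c p\<bar> = 1" for M
    using that by (induction M) (auto simp: abs_mult)
  moreover have "\<bar>kronecker_at_prime c p\<bar> = 1" if "p \<in># prime_factorization (nat \<bar>d\<bar>)" for p
  proof -
    have p: "prime p" "int p dvd d" using that by (auto simp: in_prime_factors_iff int_dvd_int_iff[symmetric])
    then have co: "coprime c (int p)" using assms by (metis coprime_commute coprime_divisors dvd_refl)
    show ?thesis
    proof (cases "p = 2")
      case True
      with co have "odd c" by auto
      then have "c mod 8 = 1 \<or> c mod 8 = 3 \<or> c mod 8 = 5 \<or> c mod 8 = 7" by presburger
      then show ?thesis using True by (auto simp: kronecker_at_prime_def cong_def)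
    next
      case False
      then show ?thesis using Legendre_nonzero[OF p(1) co] Legendre_values[of c p] by (auto simp: kronecker_at_prime_def)
    qed
  qed
  ultimately show ?thesis using False by (simp add: kronecker_def abs_mult)
qed (use assms in \<open>auto simp: kronecker_def\<close>)

section \<open>The triple product and two identities of Gauss\<close>

text \<open>Euler's function: \<open>\<eta>(\<tau>)\<close> without its factor \<open>q^(1/24)\<close>, as a function of \<open>q\<close>.\<close>
definition euler_prod :: "complex \<Rightarrow> complex" where
  "euler_prod x = (\<Prod>n. 1 - x ^ Suc n)"

text \<open>The partial products of \<open>euler_prod\<close>.\<close>
definition qpoch :: "nat \<Rightarrow> complex \<Rightarrow> complex" where
  "qpoch n x = (\<Prod>k<n. 1 - x ^ Suc k)"

lemma qpoch_0 [simp]: "qpoch 0 x = 1" by (simp add: qpoch_def)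
lemma qpoch_Suc: "qpoch (Suc n) x = qpoch n x * (1 - x ^ Suc n)" by (simp add: qpoch_def)

lemma power_neq_1: "norm (x::complex) < 1 \<Longrightarrow> x ^ Suc k \<noteq> 1"
  by (metis norm_one norm_power power_less_one_iff norm_ge_zero zero_less_Suc less_irrefl)

lemma qpoch_nonzero: "norm x < 1 \<Longrightarrow> qpoch n x \<noteq> 0"
  using power_neq_1[of x] by (simp add: qpoch_def del: power_Suc)

lemma euler_prod_convergent:
  assumes "norm (x::complex) < 1"
  shows "convergent_prod (\<lambda>n. 1 - x ^ Suc n)"
proof -
  have "summable (\<lambda>n. norm x ^ Suc n)" using assms by (subst summable_Suc_iff) (simp add: summable_geometric)
  moreover have "norm ((1 - x ^ Suc n) - 1) = norm x ^ Suc n" for n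
    by (simp add: norm_power norm_mult)
  ultimately have "summable (\<lambda>n. norm ((1 - x ^ Suc n) - 1))" by (simp only:)
  then show ?thesis
    by (intro abs_convergent_prod_imp_convergent_prod summable_imp_abs_convergent_prod)
qed

lemma euler_prod_nonzero: "norm x < 1 \<Longrightarrow> euler_prod x \<noteq> 0"
  unfolding euler_prod_def
  by (rule prodinf_nonzero[OF euler_prod_convergent]) (use power_neq_1[of x] in auto)

lemma qpoch_LIMSEQ: "norm x < 1 \<Longrightarrow> (\<lambda>n. qpoch n x) \<longlonglongrightarrow> euler_prod x"
proof -
  assume "norm x < 1"
  then have "(\<lambda>n. \<Prod>k\<le>n. 1 - x ^ Suc k) \<longlonglongrightarrow> euler_prod x"
    unfolding euler_prod_def by (intro convergent_prod_LIMSEQ euler_prod_convergent)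
  then have "(\<lambda>n. qpoch (Suc n) x) \<longlonglongrightarrow> euler_prod x"
    by (simp only: qpoch_def lessThan_Suc_atMost)
  then show ?thesis by (rule LIMSEQ_imp_Suc)
qed

fun qbinomial :: "complex \<Rightarrow> nat \<Rightarrow> nat \<Rightarrow> complex" where
  "qbinomial y N 0 = 1"
| "qbinomial y 0 (Suc r) = 0"
| "qbinomial y (Suc N) (Suc r) = qbinomial y N r + y ^ Suc r * qbinomial y N (Suc r)"

lemma qbinomial_eq_0: "r > N \<Longrightarrow> qbinomial y N r = 0"
  by (induction y N r rule: qbinomial.induct) auto

text \<open>Splitting off the factor with \<open>k = 0\<close> replaces \<open>w\<close> by \<open>w y\<close> and reproduces the recursion of the Gaussian binomials.\<close>
lemma q_binomial_theorem:
  "(\<Prod>k<N. 1 + w * y ^ k) = (\<Sum>r\<le>N. y ^ (r choose 2) * qbinomial y N r * w ^ r)"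
proof (induction N arbitrary: w)
  case (Suc N)
  let ?a = "\<lambda>r. y ^ (r choose 2) * qbinomial y N r * (w * y) ^ r"
  have "(\<Sum>r\<le>N. ?a r) = (\<Sum>r\<le>Suc N. ?a r)"
    by (simp add: qbinomial_eq_0)
  also have "\<dots> = 1 + (\<Sum>r\<le>N. ?a (Suc r))"
    by (subst sum.atMost_Suc_shift) (simp add: binomial_eq_0)
  finally have shift: "(\<Sum>r\<le>N. ?a r) = 1 + (\<Sum>r\<le>N. ?a (Suc r))" .
  have "(\<Prod>k<Suc N. 1 + w * y ^ k) = (1 + w) * (\<Prod>k<N. 1 + (w * y) * y ^ k)"
    by (subst prod.lessThan_Suc_shift) (simp add: mult.assoc)
  also have "\<dots> = (1 + w) * (\<Sum>r\<le>N. ?a r)"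
    by (simp only: Suc.IH)
  also have "\<dots> = (1 + (\<Sum>r\<le>N. ?a (Suc r))) + w * (\<Sum>r\<le>N. ?a r)"
    unfolding shift[symmetric] by (simp only: distrib_right mult_1)
  also have "\<dots> = 1 + (\<Sum>r\<le>N. ?a (Suc r) + w * ?a r)"
    by (simp only: sum.distrib sum_distrib_left add.assoc)
  also have "(\<Sum>r\<le>N. ?a (Suc r) + w * ?a r) =
      (\<Sum>r\<le>N. y ^ (Suc r choose 2) * qbinomial y (Suc N) (Suc r) * w ^ Suc r)"
  proof (rule sum.cong[OF refl])
    fix r
    have "Suc r choose 2 = r + (r choose 2)" by (simp add: numeral_2_eq_2)
    then show "?a (Suc r) + w * ?a r = y ^ (Suc r choose 2) * qbinomial y (Suc N) (Suc r) * w ^ Suc r"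
      by (simp add: power_add power_mult_distrib algebra_simps)
  qed
  also have "1 + \<dots> = (\<Sum>r\<le>Suc N. y ^ (r choose 2) * qbinomial y (Suc N) r * w ^ r)"
    by (subst sum.atMost_Suc_shift) (simp add: binomial_eq_0)
  finally show ?case .
next
  case 0
  show ?case by (simp add: binomial_eq_0)
qed

lemma qbinomial_qpoch:
  "r \<le> N \<Longrightarrow> qbinomial y N r * (qpoch r y * qpoch (N - r) y) = qpoch N y"
proof (induction N arbitrary: r)
  case (Suc N r')
  show ?case
  proof (cases r')
    case (Suc r)
    show ?thesis
    proof (cases "r = N")
      case True
      then show ?thesis using Suc Suc.IH[of N] by (simp add: qbinomial_eq_0 qpoch_Suc mult.assoc[symmetric])
    next
      case False
      then obtain m where m: "N = Suc (r + m)" using Suc.prems Suc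
        by (metis Suc_le_mono le_neq_implies_less less_iff_Suc_add)
      have 1: "qbinomial y N r * (qpoch r y * qpoch (Suc m) y) = qpoch N y"
        using Suc.IH[of r] m by (simp add: Suc_diff_le)
      have 2: "qbinomial y N (Suc r) * (qpoch (Suc r) y * qpoch m y) = qpoch N y"
        using Suc.IH[of "Suc r"] m by simp
      have "qbinomial y (Suc N) (Suc r) * (qpoch (Suc r) y * qpoch (Suc m) y) =
          (qbinomial y N r * (qpoch r y * qpoch (Suc m) y)) * (1 - y ^ Suc r)
        + y ^ Suc r * (qbinomial y N (Suc r) * (qpoch (Suc r) y * qpoch m y)) * (1 - y ^ Suc m)"
        by (simp add: qpoch_Suc algebra_simps del: power_Suc)
      also have "\<dots> = qpoch N y * (1 - y ^ Suc r) + y ^ Suc r * qpoch N y * (1 - y ^ Suc m)"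
        unfolding 1 2 ..
      also have "\<dots> = qpoch N y * (1 - y ^ (Suc r + Suc m))"
        unfolding power_add by (simp add: algebra_simps del: power_Suc)
      also have "Suc r + Suc m = Suc N" using m by simp
      finally have "qbinomial y (Suc N) (Suc r) * (qpoch (Suc r) y * qpoch (Suc m) y) = qpoch (Suc N) y"
        by (simp only: qpoch_Suc[of N])
      moreover have "Suc N - r' = Suc m" using Suc m by simp
      ultimately show ?thesis by (simp only: Suc)
    qed
  qed simp
qed simp

lemma choose_2_twice: "2 * (r choose 2) + r = r ^ 2"
proof (induction r)
  case (Suc r)
  have "Suc r choose 2 = r + (r choose 2)" by (simp add: numeral_2_eq_2)
  with Suc show ?case by (simp add: power2_eq_square)
qed simp

text \<open>The Gaussian binomial coefficient at distance \<open>j\<close> from the centre of row \<open>2n\<close>.\<close>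
definition central_qbinomial :: "complex \<Rightarrow> nat \<Rightarrow> nat \<Rightarrow> complex" where
  "central_qbinomial y n j = qbinomial y (2 * n) (n + j)"

lemma central_qbinomial_qpoch:
  "j \<le> n \<Longrightarrow> central_qbinomial y n j * (qpoch (n + j) y * qpoch (n - j) y) = qpoch (2 * n) y"
  using qbinomial_qpoch[of "n + j" "2 * n" y] by (simp add: central_qbinomial_def mult_2)

lemma central_qbinomial_eq_0: "j > n \<Longrightarrow> central_qbinomial y n j = 0"
  by (simp add: central_qbinomial_def qbinomial_eq_0)

lemma qbinomial_below_centre:
  assumes "norm y < 1" "j \<le> n"
  shows "qbinomial y (2 * n) (n - j) = central_qbinomial y n j"
proof -
  have "qbinomial y (2 * n) (n - j) * (qpoch (n - j) y * qpoch (n + j) y) = qpoch (2 * n) y"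
    using qbinomial_qpoch[of "n - j" "2 * n" y] assms(2) by (simp add: mult_2)
  also have "\<dots> = central_qbinomial y n j * (qpoch (n - j) y * qpoch (n + j) y)"
    using central_qbinomial_qpoch[OF assms(2)] by (simp add: mult.commute)
  finally show ?thesis using assms(1) qpoch_nonzero by simp
qed

lemma sum_around_centre:
  fixes f :: "nat \<Rightarrow> complex"
  shows "(\<Sum>r\<le>2*n. f r) = (\<Sum>j\<le>n. f (n + j)) + (\<Sum>j<n. f (n - Suc j))"
proof -
  have "{..2*n} = {..<n} \<union> {n..2*n}" by auto
  then have "(\<Sum>r\<le>2*n. f r) = (\<Sum>r<n. f r) + (\<Sum>r=n..2*n. f r)"
    by (simp only:) (rule sum.union_disjoint, auto)
  also have "(\<Sum>r=n..2*n. f r) = (\<Sum>j\<le>n. f (n + j))"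
    by (rule sum.reindex_bij_witness[of _ "\<lambda>j. n + j" "\<lambda>r. r - n"]) auto
  also have "(\<Sum>r<n. f r) = (\<Sum>j<n. f (n - Suc j))"
    by (rule sum.nat_diff_reindex[symmetric])
  finally show ?thesis by simp
qed

lemma prod_around_centre:
  fixes f :: "nat \<Rightarrow> complex"
  shows "(\<Prod>k<2*n. f k) = (\<Prod>k<n. f (n - Suc k)) * (\<Prod>k<n. f (n + k))"
proof -
  have "(\<Prod>k<2*n. f k) = (\<Prod>k<n. f k) * (\<Prod>k=n..<2*n. f k)"
    unfolding lessThan_atLeast0 by (rule prod.atLeastLessThan_concat [symmetric]) simp_all
  also have "(\<Prod>k=n..<2*n. f k) = (\<Prod>k<n. f (n + k))"
    by (rule prod.reindex_bij_witness[of _ "\<lambda>j. n + j" "\<lambda>r. r - n"]) auto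
  finally show ?thesis by (simp only: prod.nat_diff_reindex)
qed

text \<open>The \<open>q\<close>-binomial theorem for \<open>2n\<close> factors and base \<open>x^2\<close>, with \<open>w\<close> chosen so that the exponents of \<open>x\<close> are
  symmetric about zero. Inverting the \<open>n\<close> factors with negative exponents produces the constant \<open>c\<close>.\<close>
lemma finite_triple_product:
  fixes x z :: complex
  assumes x: "x \<noteq> 0" "norm x < 1" and z: "z \<noteq> 0"
  shows "(\<Prod>k<n. (1 + z * x ^ (2 * k + 1)) * (1 + x ^ (2 * k + 1) / z)) =
    (\<Sum>j\<le>n. central_qbinomial (x\<^sup>2) n j * (z ^ j * x ^ (j\<^sup>2))) +
    (\<Sum>j<n. central_qbinomial (x\<^sup>2) n (Suc j) * (inverse z ^ Suc j * x ^ ((Suc j)\<^sup>2)))"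
proof -
  \<comment> \<open>\<open>w = z x^(1 - 2n)\<close>, so that \<open>w (x^2)^k = z x^(2k + 1 - 2n)\<close>\<close>
  define w where "w = z * x / x ^ (2 * n)"
  define c where "c = z ^ n / x ^ (n\<^sup>2)"
  have c0: "c \<noteq> 0" using x z by (simp add: c_def)
  have "norm (x\<^sup>2) < 1" using x(2) by (simp add: norm_power power_less_one_iff)
  have trm: "(x\<^sup>2) ^ (r choose 2) * w ^ r = z ^ r * x ^ (r\<^sup>2) / x ^ (2 * n * r)" for r
  proof -
    have "(x\<^sup>2) ^ (r choose 2) * x ^ r = x ^ (r\<^sup>2)"
      by (simp add: power_mult[symmetric] power_add[symmetric] choose_2_twice)
    then show ?thesis
      by (simp add: w_def power_divide power_mult_distrib power_mult[symmetric] algebra_simps)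
  qed
  have up: "z ^ (n + j) * x ^ ((n + j)\<^sup>2) / x ^ (2 * n * (n + j)) = c * (z ^ j * x ^ (j\<^sup>2))" for j
  proof -
    have "x ^ ((n + j)\<^sup>2) * x ^ (n\<^sup>2) = x ^ (2 * n * (n + j)) * x ^ (j\<^sup>2)"
      unfolding power_add[symmetric] by (rule arg_cong[of _ _ "power x"]) (simp add: power2_eq_square algebra_simps)
    then show ?thesis using x by (simp add: c_def field_simps power_add)
  qed
  have down: "z ^ (n - j) * x ^ ((n - j)\<^sup>2) / x ^ (2 * n * (n - j)) = c * (inverse z ^ j * x ^ (j\<^sup>2))"
    if "j \<le> n" for j
  proof -
    obtain r where r: "n = r + j" using \<open>j \<le> n\<close> by (metis le_add_diff_inverse2)
    have "x ^ (r\<^sup>2) * x ^ (n\<^sup>2) = x ^ (2 * n * r) * x ^ (j\<^sup>2)"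
      unfolding power_add[symmetric] by (rule arg_cong[of _ _ "power x"]) (simp add: r power2_eq_square algebra_simps)
    then have "z ^ r * x ^ (r\<^sup>2) / x ^ (2 * n * r) = (z ^ r * z ^ j / x ^ (n\<^sup>2)) * (inverse z ^ j * x ^ (j\<^sup>2))"
      using x z by (simp add: field_simps power_inverse)
    moreover have "n - j = r" using r by simp
    ultimately show ?thesis using r by (simp only: c_def power_add)
  qed
  have "(\<Prod>k<2*n. 1 + w * (x\<^sup>2) ^ k) =
      (\<Sum>r\<le>2*n. qbinomial (x\<^sup>2) (2*n) r * (z ^ r * x ^ (r\<^sup>2) / x ^ (2 * n * r)))"
    unfolding q_binomial_theorem trm[symmetric] by (simp add: algebra_simps)
  also have "\<dots> = (\<Sum>j\<le>n. central_qbinomial (x\<^sup>2) n j * (c * (z ^ j * x ^ (j\<^sup>2)))) +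
     (\<Sum>j<n. central_qbinomial (x\<^sup>2) n (Suc j) * (c * (inverse z ^ Suc j * x ^ ((Suc j)\<^sup>2))))"
    unfolding sum_around_centre
    by (intro arg_cong2[of _ _ _ _ "(+)"] sum.cong refl)
       (simp_all only: up down central_qbinomial_def[symmetric] qbinomial_below_centre[OF \<open>norm (x\<^sup>2) < 1\<close>]
         Suc_leI lessThan_iff)
  also have "\<dots> = c * ((\<Sum>j\<le>n. central_qbinomial (x\<^sup>2) n j * (z ^ j * x ^ (j\<^sup>2))) +
     (\<Sum>j<n. central_qbinomial (x\<^sup>2) n (Suc j) * (inverse z ^ Suc j * x ^ ((Suc j)\<^sup>2))))"
    unfolding distrib_left sum_distrib_left by (simp only: mult.left_commute)
  finally have R: "(\<Prod>k<2*n. 1 + w * (x\<^sup>2) ^ k) = \<dots>" .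
  have "(\<Prod>k<2*n. 1 + w * (x\<^sup>2) ^ k) = (\<Prod>k<n. 1 + w * (x\<^sup>2) ^ (n - Suc k)) * (\<Prod>k<n. 1 + w * (x\<^sup>2) ^ (n + k))"
    by (rule prod_around_centre)
  also have "(\<Prod>k<n. 1 + w * (x\<^sup>2) ^ (n + k)) = (\<Prod>k<n. 1 + z * x ^ (2 * k + 1))"
    using x by (intro prod.cong refl) (simp add: w_def power_add power_mult[symmetric])
  also have "(\<Prod>k<n. 1 + w * (x\<^sup>2) ^ (n - Suc k)) = (\<Prod>k<n. z / x ^ (2 * k + 1) * (1 + x ^ (2 * k + 1) / z))"
  proof (intro prod.cong refl)
    fix k assume "k \<in> {..<n}"
    then obtain m where m: "n = m + Suc k" by (metis lessThan_iff Suc_leI le_add_diff_inverse2)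
    have "w * (x\<^sup>2) ^ (n - Suc k) = z / x ^ (2 * k + 1)"
      using x unfolding w_def m by (simp add: power_add power_mult[symmetric] field_simps)
    then show "1 + w * (x\<^sup>2) ^ (n - Suc k) = z / x ^ (2 * k + 1) * (1 + x ^ (2 * k + 1) / z)"
      using x z by (simp add: distrib_left)
  qed
  also have "\<dots> = (\<Prod>k<n. z / x ^ (2 * k + 1)) * (\<Prod>k<n. 1 + x ^ (2 * k + 1) / z)"
    by (rule prod.distrib)
  also have "(\<Prod>k<n. z / x ^ (2 * k + 1)) = c"
  proof -
    have "(\<Prod>k<n. x ^ (2 * k + 1)) = x ^ (n\<^sup>2)"
    proof (induction n)
      case (Suc n)
      have "(Suc n)\<^sup>2 = n\<^sup>2 + (2 * n + 1)" by (simp add: power2_eq_square)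
      with Suc show ?case by (simp only: prod.lessThan_Suc power_add)
    qed simp
    then show ?thesis by (simp add: c_def prod_dividef)
  qed
  finally show ?thesis using c0 R
    by (simp add: prod.distrib mult.assoc mult.commute mult.left_commute)
qed

lemma summable_theta_terms:
  fixes x z :: complex
  assumes "norm x < 1"
  shows "summable (\<lambda>j. norm (z ^ j * x ^ (j\<^sup>2)))"
proof (rule summable_comparison_test_ev)
  have "(\<lambda>j. z * x ^ j) \<longlonglongrightarrow> z * 0"
    by (intro tendsto_intros LIMSEQ_power_zero assms)
  then have "(\<lambda>j. norm (z * x ^ j)) \<longlonglongrightarrow> 0" using tendsto_norm_zero by force
  then have "\<forall>\<^sub>F j in sequentially. norm (z * x ^ j) < 1/2"
    by (rule order_tendstoD) simp
  then show "\<forall>\<^sub>F j in sequentially. norm (norm (z ^ j * x ^ (j\<^sup>2))) \<le> (1/2) ^ j"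
  proof eventually_elim
    case (elim j)
    have "norm (z ^ j * x ^ (j\<^sup>2)) = norm (z * x ^ j) ^ j"
      by (simp add: norm_mult norm_power power_mult_distrib power2_eq_square power_mult)
    also have "\<dots> \<le> (1/2) ^ j" using elim by (intro power_mono) auto
    finally show ?case by simp
  qed
  show "summable (\<lambda>j. (1/2 :: real) ^ j)" by (simp add: summable_geometric)
qed

text \<open>Numerator and denominators of the quotient formula converge to a nonzero limit; so the coefficients are bounded, uniformly in both indices.\<close>
lemma central_qbinomial_bounded:
  assumes "norm y < 1"
  obtains C where "\<And>n j. norm (central_qbinomial y n j) \<le> C"
proof -
  have "Bseq (\<lambda>n. qpoch n y)"
    using qpoch_LIMSEQ[OF assms] by (intro convergent_imp_Bseq convergentI)
  then obtain K where K: "\<And>n. norm (qpoch n y) \<le> K" by (auto simp: Bseq_def)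
  have "Bseq (\<lambda>n. inverse (qpoch n y))"
    using tendsto_inverse[OF qpoch_LIMSEQ[OF assms] euler_prod_nonzero[OF assms]]
    by (intro convergent_imp_Bseq convergentI)
  then obtain L where L: "\<And>n. norm (inverse (qpoch n y)) \<le> L" by (auto simp: Bseq_def)
  have nn: "K \<ge> 0" "L \<ge> 0" using K[of 0] L[of 0] by auto
  have "norm (central_qbinomial y n j) \<le> K * (L * L)" for n j
  proof (cases "j \<le> n")
    case True
    have "central_qbinomial y n j = qpoch (2*n) y * (inverse (qpoch (n + j) y) * inverse (qpoch (n - j) y))"
      using central_qbinomial_qpoch[OF True, of y] qpoch_nonzero[OF assms] by (simp add: field_simps)
    then show ?thesis using K L nn
      by (simp only: norm_mult) (intro mult_mono mult_nonneg_nonneg norm_ge_zero)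
  qed (use nn in \<open>simp add: central_qbinomial_eq_0\<close>)
  then show ?thesis using that by blast
qed

lemma central_qbinomial_LIMSEQ:
  assumes "norm y < 1"
  shows "(\<lambda>n. central_qbinomial y n j) \<longlonglongrightarrow> inverse (euler_prod y)"
proof -
  note lim = qpoch_LIMSEQ[OF assms]
  have s1: "filterlim (\<lambda>n::nat. 2 * n) sequentially sequentially"
    by (rule filterlim_subseq) (auto simp: strict_mono_def)
  have s2: "filterlim (\<lambda>n::nat. n + j) sequentially sequentially"
    by (rule filterlim_subseq) (auto simp: strict_mono_def)
  have s3: "filterlim (\<lambda>n::nat. n - j) sequentially sequentially"
    by (rule filterlim_minus_const_nat_at_top)
  have "(\<lambda>n. qpoch (2*n) y / (qpoch (n + j) y * qpoch (n - j) y)) \<longlonglongrightarrow>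
      euler_prod y / (euler_prod y * euler_prod y)"
    using euler_prod_nonzero[OF assms]
    by (intro tendsto_intros filterlim_compose[OF lim] s1 s2 s3) auto
  moreover have "\<forall>\<^sub>F n in sequentially. qpoch (2*n) y / (qpoch (n + j) y * qpoch (n - j) y) = central_qbinomial y n j"
    using eventually_ge_at_top[of j]
  proof eventually_elim
    case (elim n)
    then show ?case using central_qbinomial_qpoch[OF elim, of y] qpoch_nonzero[OF assms]
      by (simp add: field_simps)
  qed
  ultimately have "(\<lambda>n. central_qbinomial y n j) \<longlonglongrightarrow> euler_prod y / (euler_prod y * euler_prod y)"
    by (rule Lim_transform_eventually)
  then show ?thesis using euler_prod_nonzero[OF assms] by (simp add: field_simps)
qed

text \<open>The shift \<open>s\<close> allows for the two halves of the bilateral sum, which start at \<open>j = 0\<close> and at \<open>j = 1\<close>.\<close>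
lemma central_qbinomial_sum_LIMSEQ:
  fixes f :: "nat \<Rightarrow> complex"
  assumes y: "norm y < 1" and f: "summable (\<lambda>j. norm (f j))"
  shows "(\<lambda>n. \<Sum>j. central_qbinomial y n (s j) * f j) \<longlonglongrightarrow> inverse (euler_prod y) * (\<Sum>j. f j)"
proof -
  obtain C where C: "\<And>n j. norm (central_qbinomial y n j) \<le> C"
    using central_qbinomial_bounded[OF y] by blast
  have "(\<lambda>n. \<Sum>j. central_qbinomial y n (s j) * f j) \<longlonglongrightarrow> (\<Sum>j. inverse (euler_prod y) * f j)"
  proof (rule tannerys_theorem[THEN conjunct2, THEN conjunct2])
    show "((\<lambda>n. central_qbinomial y n (s k) * f k) \<longlonglongrightarrow> inverse (euler_prod y) * f k)" for k
      by (intro tendsto_intros central_qbinomial_LIMSEQ y)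
    show "\<forall>\<^sub>F (k, n) in sequentially \<times>\<^sub>F sequentially. norm (central_qbinomial y n (s k) * f k) \<le> C * norm (f k)"
      by (intro always_eventually) (auto simp: norm_mult intro!: mult_right_mono C)
    show "summable (\<lambda>k. C * norm (f k))" by (intro summable_mult f)
  qed auto
  then show ?thesis by (simp add: suminf_mult summable_norm_cancel[OF f])
qed

text \<open>The finite identity in the limit \<open>n \<rightarrow> \<infinity>\<close>, by Tannery's theorem. The product side stays a limit of finite products, which
  is the form in which its special cases are recognised.\<close>
theorem jacobi_triple_product:
  fixes x z :: complex
  assumes x: "x \<noteq> 0" "norm x < 1" and z: "z \<noteq> 0"
  shows "(\<lambda>n. \<Prod>k<n. (1 + z * x ^ (2 * k + 1)) * (1 + x ^ (2 * k + 1) / z)) \<longlonglongrightarrow>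
    ((\<Sum>j. z ^ j * x ^ (j\<^sup>2)) + (\<Sum>j. inverse z ^ Suc j * x ^ ((Suc j)\<^sup>2))) / euler_prod (x\<^sup>2)"
proof -
  have y: "norm (x\<^sup>2) < 1" using x(2) by (simp add: norm_power power_less_one_iff)
  let ?f = "\<lambda>j. z ^ j * x ^ (j\<^sup>2)" and ?g = "\<lambda>j. inverse z ^ Suc j * x ^ ((Suc j)\<^sup>2)"
  have f: "summable (\<lambda>j. norm (?f j))" by (rule summable_theta_terms[OF x(2)])
  have g: "summable (\<lambda>j. norm (?g j))"
    using summable_theta_terms[OF x(2), of "inverse z"]
    by (subst summable_Suc_iff[of "\<lambda>j. norm (inverse z ^ j * x ^ (j\<^sup>2))"])
  have "(\<lambda>n. (\<Sum>j. central_qbinomial (x\<^sup>2) n j * ?f j) + (\<Sum>j. central_qbinomial (x\<^sup>2) n (Suc j) * ?g j)) \<longlonglongrightarrow>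
     inverse (euler_prod (x\<^sup>2)) * (\<Sum>j. ?f j) + inverse (euler_prod (x\<^sup>2)) * (\<Sum>j. ?g j)"
    by (intro tendsto_add central_qbinomial_sum_LIMSEQ y f g)
  moreover have "(\<Sum>j. central_qbinomial (x\<^sup>2) n j * ?f j) + (\<Sum>j. central_qbinomial (x\<^sup>2) n (Suc j) * ?g j) =
     (\<Prod>k<n. (1 + z * x ^ (2 * k + 1)) * (1 + x ^ (2 * k + 1) / z))" for n
  proof -
    have "(\<Sum>j. central_qbinomial (x\<^sup>2) n j * ?f j) = (\<Sum>j\<le>n. central_qbinomial (x\<^sup>2) n j * ?f j)"
      by (rule suminf_finite) (auto simp: central_qbinomial_eq_0)
    moreover have "(\<Sum>j. central_qbinomial (x\<^sup>2) n (Suc j) * ?g j) = (\<Sum>j<n. central_qbinomial (x\<^sup>2) n (Suc j) * ?g j)"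
      by (rule suminf_finite) (auto simp: central_qbinomial_eq_0)
    ultimately show ?thesis by (simp only: finite_triple_product[OF x z])
  qed
  ultimately show ?thesis
    by (simp only: distrib_left[symmetric] divide_inverse mult.commute)
qed

lemma theta_terms_sign: "(- x) ^ (j\<^sup>2) = (-1) ^ j * (x::complex) ^ (j\<^sup>2)"
  by (subst power_minus) (simp add: minus_one_power_iff)

text \<open>\<open>\<theta>\<close> as a function of \<open>q\<close>.\<close>
definition theta_series :: "complex \<Rightarrow> complex" where
  "theta_series x = 1 + 2 * (\<Sum>j. x ^ ((Suc j)\<^sup>2))"

text \<open>The case \<open>z = -1\<close>: the factors \<open>1 - x^n\<close> with odd \<open>n \<le> 2N\<close> are those of \<open>euler_prod x\<close> that are missing in \<open>euler_prod (x^2)\<close>.\<close>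
theorem gauss_theta_product:
  assumes "norm x < 1"
  shows "theta_series (- x) = euler_prod x ^ 2 / euler_prod (x\<^sup>2)"
proof (cases "x = 0")
  case True
  then show ?thesis by (simp add: theta_series_def euler_prod_def zero_power)
next
  case False
  have y: "norm (x\<^sup>2) < 1" using assms by (simp add: norm_power power_less_one_iff)
  have fin: "(\<Prod>k<n. 1 - x ^ (2 * k + 1)) * qpoch n (x\<^sup>2) = qpoch (2 * n) x" for n
  proof (induction n)
    case (Suc n)
    have "(x\<^sup>2) ^ Suc n = x ^ Suc (2 * n + 1)" unfolding power_mult[symmetric] by simp
    then have "qpoch (2 * Suc n) x = qpoch (2 * n) x * ((1 - x ^ (2 * n + 1)) * (1 - (x\<^sup>2) ^ Suc n))"
      by (simp add: qpoch_Suc mult.assoc)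
    moreover have "(\<Prod>k<Suc n. 1 - x ^ (2 * k + 1)) * qpoch (Suc n) (x\<^sup>2) =
        ((\<Prod>k<n. 1 - x ^ (2 * k + 1)) * qpoch n (x\<^sup>2)) * ((1 - x ^ (2 * n + 1)) * (1 - (x\<^sup>2) ^ Suc n))"
      by (simp only: prod.lessThan_Suc qpoch_Suc mult_ac)
    ultimately show ?case by (simp only: Suc.IH)
  qed simp
  have s1: "filterlim (\<lambda>n::nat. 2 * n) sequentially sequentially"
    by (rule filterlim_subseq) (auto simp: strict_mono_def)
  have "(\<lambda>n. (qpoch (2*n) x / qpoch n (x\<^sup>2)) ^ 2) \<longlonglongrightarrow> (euler_prod x / euler_prod (x\<^sup>2)) ^ 2"
    by (intro tendsto_intros filterlim_compose[OF qpoch_LIMSEQ[OF assms] s1] qpoch_LIMSEQ y euler_prod_nonzero)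
  moreover have "(\<Prod>k<n. (1 + (-1) * x ^ (2 * k + 1)) * (1 + x ^ (2 * k + 1) / (-1))) = (qpoch (2*n) x / qpoch n (x\<^sup>2)) ^ 2" for n
    using qpoch_nonzero[OF y, of n]
    by (simp add: fin[symmetric] prod.distrib power2_eq_square)
  ultimately have "(\<lambda>n. \<Prod>k<n. (1 + (-1) * x ^ (2 * k + 1)) * (1 + x ^ (2 * k + 1) / (-1))) \<longlonglongrightarrow> (euler_prod x / euler_prod (x\<^sup>2)) ^ 2"
    by (simp only:)
  from LIMSEQ_unique[OF this jacobi_triple_product[OF False assms, of "-1"]]
  have eq: "(euler_prod x / euler_prod (x\<^sup>2)) ^ 2 * euler_prod (x\<^sup>2) =
     (\<Sum>j. (-1) ^ j * x ^ (j\<^sup>2)) + (\<Sum>j. inverse (-1) ^ Suc j * x ^ ((Suc j)\<^sup>2))"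
    using euler_prod_nonzero[OF y] by (simp add: field_simps)
  have "summable (\<lambda>j. (-1) ^ j * x ^ (j\<^sup>2))"
    by (rule summable_norm_cancel[OF summable_theta_terms[OF assms]])
  from suminf_split_head[OF this] have "(\<Sum>j. (-1) ^ j * x ^ (j\<^sup>2)) = 1 + (\<Sum>j. (-1) ^ Suc j * x ^ ((Suc j)\<^sup>2))"
    by simp
  with eq have "(euler_prod x / euler_prod (x\<^sup>2)) ^ 2 * euler_prod (x\<^sup>2) = theta_series (- x)"
    unfolding theta_series_def theta_terms_sign by simp
  then show ?thesis using euler_prod_nonzero[OF y] by (simp add: power2_eq_square)
qed

text \<open>The case \<open>z = x\<close>: the two halves of the bilateral series coincide, and the factor \<open>1 + x^0 = 2\<close> of the second
  product accounts for the doubling.\<close>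
theorem gauss_triangular_product:
  assumes "norm x < 1" "x \<noteq> 0"
  shows "(\<Sum>j. x ^ (j\<^sup>2 + j)) = euler_prod (x ^ 4) ^ 2 / euler_prod (x\<^sup>2)"
proof -
  have y: "norm (x\<^sup>2) < 1" "norm (x ^ 4) < 1" using assms by (simp_all add: norm_power power_less_one_iff)
  have fin: "(\<Prod>k<n. 1 + (x\<^sup>2) ^ Suc k) * qpoch n (x\<^sup>2) = qpoch n (x ^ 4)" for n
  proof (induction n)
    case (Suc n)
    have "(1 + (x\<^sup>2) ^ Suc n) * (1 - (x\<^sup>2) ^ Suc n) = 1 - (x ^ 4) ^ Suc n"
    proof -
      have "(x ^ 4) ^ Suc n = ((x\<^sup>2) ^ Suc n) ^ 2"
        unfolding power_mult[symmetric] by (rule arg_cong[of _ _ "power x"]) simp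
      moreover have "(1 + u) * (1 - u) = 1 - u\<^sup>2" for u :: complex
        by (simp add: algebra_simps power2_eq_square)
      ultimately show ?thesis by (simp only:)
    qed
    moreover have "(\<Prod>k<Suc n. 1 + (x\<^sup>2) ^ Suc k) * qpoch (Suc n) (x\<^sup>2) =
        ((\<Prod>k<n. 1 + (x\<^sup>2) ^ Suc k) * qpoch n (x\<^sup>2)) * ((1 + (x\<^sup>2) ^ Suc n) * (1 - (x\<^sup>2) ^ Suc n))"
      by (simp only: prod.lessThan_Suc qpoch_Suc mult_ac)
    ultimately show ?case by (simp only: Suc.IH qpoch_Suc)
  qed simp
  have L: "(\<lambda>n. \<Prod>k<n. 1 + (x\<^sup>2) ^ Suc k) \<longlonglongrightarrow> euler_prod (x ^ 4) / euler_prod (x\<^sup>2)"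
  proof -
    have "(\<lambda>n. qpoch n (x ^ 4) / qpoch n (x\<^sup>2)) \<longlonglongrightarrow> euler_prod (x ^ 4) / euler_prod (x\<^sup>2)"
      by (intro tendsto_intros qpoch_LIMSEQ y euler_prod_nonzero)
    moreover have "qpoch n (x ^ 4) / qpoch n (x\<^sup>2) = (\<Prod>k<n. 1 + (x\<^sup>2) ^ Suc k)" for n
      unfolding fin[symmetric] using qpoch_nonzero[OF y(1), of n] by simp
    ultimately show ?thesis by (simp only:)
  qed
  have "(\<lambda>n. (\<Prod>k<n. 1 + (x\<^sup>2) ^ Suc k) * (\<Prod>k<Suc n. 1 + (x\<^sup>2) ^ k)) \<longlonglongrightarrow>
     euler_prod (x ^ 4) / euler_prod (x\<^sup>2) * (2 * (euler_prod (x ^ 4) / euler_prod (x\<^sup>2)))"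
  proof -
    have "(\<Prod>k<Suc n. 1 + (x\<^sup>2) ^ k) = 2 * (\<Prod>k<n. 1 + (x\<^sup>2) ^ Suc k)" for n
      by (subst prod.lessThan_Suc_shift) simp
    then show ?thesis by (simp only:) (intro tendsto_mult tendsto_const L)
  qed
  moreover have "(\<lambda>n. 1 + (x\<^sup>2) ^ n) \<longlonglongrightarrow> 1 + 0"
    by (intro tendsto_intros LIMSEQ_power_zero y)
  ultimately have "(\<lambda>n. (\<Prod>k<n. 1 + (x\<^sup>2) ^ Suc k) * (\<Prod>k<Suc n. 1 + (x\<^sup>2) ^ k) / (1 + (x\<^sup>2) ^ n)) \<longlonglongrightarrow>
     euler_prod (x ^ 4) / euler_prod (x\<^sup>2) * (2 * (euler_prod (x ^ 4) / euler_prod (x\<^sup>2))) / (1 + 0)"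
    by (intro tendsto_divide) simp_all
  moreover have "(\<Prod>k<n. 1 + (x\<^sup>2) ^ Suc k) * (\<Prod>k<Suc n. 1 + (x\<^sup>2) ^ k) / (1 + (x\<^sup>2) ^ n) =
     (\<Prod>k<n. (1 + x * x ^ (2 * k + 1)) * (1 + x ^ (2 * k + 1) / x))" for n
  proof -
    have "1 + (x\<^sup>2) ^ n \<noteq> 0"
    proof
      assume "1 + (x\<^sup>2) ^ n = 0"
      then have n: "(x\<^sup>2) ^ n = -1" by (metis add.commute add_eq_0_iff)
      then have "norm (x\<^sup>2) ^ n = 1" by (metis norm_minus_cancel norm_one norm_power)
      then have "n = 0" using y(1) by (metis norm_ge_zero not_gr_zero order_less_irrefl power_less_one_iff)
      with n show False by simp
    qed
    then have "(\<Prod>k<n. 1 + (x\<^sup>2) ^ Suc k) * (\<Prod>k<Suc n. 1 + (x\<^sup>2) ^ k) / (1 + (x\<^sup>2) ^ n) =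
       (\<Prod>k<n. (1 + (x\<^sup>2) ^ Suc k) * (1 + (x\<^sup>2) ^ k))"
      by (simp add: prod.distrib)
    also have "\<dots> = (\<Prod>k<n. (1 + x * x ^ (2 * k + 1)) * (1 + x ^ (2 * k + 1) / x))"
    proof (intro prod.cong refl)
      fix k
      have "x * x ^ (2 * k + 1) = (x\<^sup>2) ^ Suc k" "x ^ (2 * k + 1) / x = (x\<^sup>2) ^ k"
        unfolding power_mult[symmetric] using assms(2) by simp_all
      then show "(1 + (x\<^sup>2) ^ Suc k) * (1 + (x\<^sup>2) ^ k) = (1 + x * x ^ (2 * k + 1)) * (1 + x ^ (2 * k + 1) / x)"
        by (simp only:)
    qed
    finally show ?thesis .
  qed
  ultimately have "(\<lambda>n. \<Prod>k<n. (1 + x * x ^ (2 * k + 1)) * (1 + x ^ (2 * k + 1) / x)) \<longlonglongrightarrow>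
     2 * (euler_prod (x ^ 4) / euler_prod (x\<^sup>2)) ^ 2"
    by (simp add: power2_eq_square mult_ac)
  from LIMSEQ_unique[OF this jacobi_triple_product[OF assms(2,1,2)]]
  have eq: "2 * (euler_prod (x ^ 4) / euler_prod (x\<^sup>2)) ^ 2 * euler_prod (x\<^sup>2) =
     (\<Sum>j. x ^ j * x ^ (j\<^sup>2)) + (\<Sum>j. inverse x ^ Suc j * x ^ ((Suc j)\<^sup>2))"
    using euler_prod_nonzero[OF y(1)] by (simp add: field_simps)
  have "inverse x ^ Suc j * x ^ ((Suc j)\<^sup>2) = x ^ (j\<^sup>2 + j)" for j
  proof -
    have "(Suc j)\<^sup>2 = (j\<^sup>2 + j) + Suc j" by (simp add: power2_eq_square)
    then have "x ^ ((Suc j)\<^sup>2) = x ^ (j\<^sup>2 + j) * x ^ Suc j" by (simp only: power_add)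
    then show ?thesis using assms(2) by (simp add: power_inverse field_simps del: power_Suc)
  qed
  moreover have "x ^ j * x ^ (j\<^sup>2) = x ^ (j\<^sup>2 + j)" for j by (simp add: power_add)
  ultimately have "(euler_prod (x ^ 4) / euler_prod (x\<^sup>2)) ^ 2 * euler_prod (x\<^sup>2) = (\<Sum>j. x ^ (j\<^sup>2 + j))"
    using eq by (simp only:) simp
  then show ?thesis using euler_prod_nonzero[OF y(1)] by (simp add: power2_eq_square)
qed

text \<open>\<open>euler_prod (-y)\<close> has \<open>1 + y^n\<close> in place of \<open>1 - y^n\<close> for odd \<open>n\<close>; multiplied together, these are the factors
  \<open>1 - y^(2n)\<close> with odd \<open>n\<close>, that is \<open>euler_prod (y^2) / euler_prod (y^4)\<close>.\<close>
lemma euler_prod_minus: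
  assumes "norm y < 1"
  shows "euler_prod y * euler_prod (- y) * euler_prod (y ^ 4) = euler_prod (y\<^sup>2) ^ 3"
proof -
  have n: "norm (- y) < 1" "norm (y\<^sup>2) < 1" "norm (y ^ 4) < 1"
    using assms by (simp_all add: norm_power power_less_one_iff)
  have fin: "qpoch (2 * n) y * qpoch (2 * n) (- y) * qpoch n (y ^ 4) = qpoch n (y\<^sup>2) ^ 2 * qpoch (2 * n) (y\<^sup>2)" for n
  proof (induction n)
    case (Suc n)
    have fac: "(1 - y ^ (2*n+1)) * (1 - y ^ (2*n+2)) * ((1 - (-y) ^ (2*n+1)) * (1 - (-y) ^ (2*n+2))) * (1 - (y ^ 4) ^ Suc n)
       = (1 - (y\<^sup>2) ^ Suc n)\<^sup>2 * ((1 - (y\<^sup>2) ^ (2*n+1)) * (1 - (y\<^sup>2) ^ (2*n+2)))"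
    proof -
      define u where "u = y ^ n"
      have minus: "(- y) ^ (2 * n) = u\<^sup>2"
        by (simp only: u_def power_mult[of "- y" 2 n] power2_minus power_mult[symmetric] mult.commute[of n])
      have even: "y ^ (2 * n) = u\<^sup>2" by (simp only: u_def power_even_eq)
      have fourth: "(y\<^sup>2) ^ (2 * n) = u ^ 4"
        unfolding u_def power_mult[symmetric] by (rule arg_cong[of _ _ "power y"]) simp
      have y4: "(y\<^sup>2)\<^sup>2 = y ^ 4" by simp
      have u4: "(u\<^sup>2)\<^sup>2 = u ^ 4" by simp
      have p1: "y ^ (2*n+1) = u\<^sup>2 * y" by (simp only: power_add power_one_right even)
      have p2: "y ^ (2*n+2) = u\<^sup>2 * y\<^sup>2" by (simp only: power_add even)
      have p3: "(- y) ^ (2*n+1) = - (u\<^sup>2 * y)" by (simp only: power_add power_one_right minus mult_minus_right)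
      have p4: "(- y) ^ (2*n+2) = u\<^sup>2 * y\<^sup>2" by (simp only: power_add minus power2_minus)
      have p5: "(y ^ 4) ^ Suc n = u ^ 4 * y ^ 4"
        by (simp only: u_def power_Suc2 power_mult[symmetric] mult.commute[of 4])
      have p6: "(y\<^sup>2) ^ Suc n = u\<^sup>2 * y\<^sup>2"
        by (simp only: u_def power_Suc2 power_mult[symmetric] mult.commute[of 2])
      have p7: "(y\<^sup>2) ^ (2*n+1) = (u\<^sup>2 * y)\<^sup>2"
        by (simp only: power_add power_one_right fourth power_mult_distrib u4)
      have p8: "(y\<^sup>2) ^ (2*n+2) = u ^ 4 * y ^ 4" by (simp only: power_add fourth y4)
      have "(1 - a) * b * ((1 - - a) * b) * c = b\<^sup>2 * ((1 - a\<^sup>2) * c)" for a b c :: complex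
        by (simp add: power2_eq_square algebra_simps)
      then show ?thesis by (simp only: p1 p2 p3 p4 p5 p6 p7 p8)
    qed
    have two: "qpoch (2 * Suc n) x = qpoch (2 * n) x * ((1 - x ^ (2*n+1)) * (1 - x ^ (2*n+2)))" for x
      by (simp add: qpoch_Suc mult.assoc)
    have "qpoch (2 * Suc n) y * qpoch (2 * Suc n) (- y) * qpoch (Suc n) (y ^ 4) =
      (qpoch (2 * n) y * qpoch (2 * n) (- y) * qpoch n (y ^ 4)) *
      ((1 - y ^ (2*n+1)) * (1 - y ^ (2*n+2)) * ((1 - (-y) ^ (2*n+1)) * (1 - (-y) ^ (2*n+2))) * (1 - (y ^ 4) ^ Suc n))"
      unfolding two qpoch_Suc[of n] by (simp only: mult_ac)
    also have "\<dots> = (qpoch n (y\<^sup>2) ^ 2 * qpoch (2 * n) (y\<^sup>2)) *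
       ((1 - (y\<^sup>2) ^ Suc n)\<^sup>2 * ((1 - (y\<^sup>2) ^ (2*n+1)) * (1 - (y\<^sup>2) ^ (2*n+2))))"
      unfolding fac Suc.IH ..
    also have "\<dots> = qpoch (Suc n) (y\<^sup>2) ^ 2 * qpoch (2 * Suc n) (y\<^sup>2)"
      unfolding two qpoch_Suc[of n] power_mult_distrib by (simp only: mult_ac)
    finally show ?case .
  qed simp
  have s1: "filterlim (\<lambda>n::nat. 2 * n) sequentially sequentially"
    by (rule filterlim_subseq) (auto simp: strict_mono_def)
  note lim = filterlim_compose[OF qpoch_LIMSEQ[OF assms] s1] filterlim_compose[OF qpoch_LIMSEQ[OF n(1)] s1]
    filterlim_compose[OF qpoch_LIMSEQ[OF n(2)] s1] qpoch_LIMSEQ[OF n(2)] qpoch_LIMSEQ[OF n(3)]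
  have L: "(\<lambda>n. qpoch (2 * n) y * qpoch (2 * n) (- y) * qpoch n (y ^ 4)) \<longlonglongrightarrow>
     euler_prod y * euler_prod (- y) * euler_prod (y ^ 4)"
    by (rule tendsto_mult[OF tendsto_mult[OF lim(1,2)] lim(5)])
  have R: "(\<lambda>n. qpoch n (y\<^sup>2) ^ 2 * qpoch (2 * n) (y\<^sup>2)) \<longlonglongrightarrow> euler_prod (y\<^sup>2) ^ 2 * euler_prod (y\<^sup>2)"
    by (rule tendsto_mult[OF tendsto_power[OF lim(4)] lim(3)])
  from LIMSEQ_unique[OF L[unfolded fin] R] show ?thesis
    by (simp only: power3_eq_cube power2_eq_square)
qed

section \<open>Inversion of Gaussian sums by Polya's method\<close>

lemma sum_roots_of_unity:
  fixes r :: int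
  assumes "l > 0"
  shows "(\<Sum>j<l. cis (2 * pi * real j * of_int r / real l)) = (if int l dvd r then of_nat l else 0)"
proof -
  define w where "w = cis (2 * pi * of_int r / real l)"
  have pow: "cis (2 * pi * real j * of_int r / real l) = w ^ j" for j
    unfolding w_def Complex.DeMoivre by (rule arg_cong[of _ _ cis]) simp
  have "w ^ l = 1"
  proof -
    have "2 * pi * real l * of_int r / real l = 2 * pi * of_int r" using assms by simp
    then show ?thesis unfolding pow[symmetric] by (simp only: cis_multiple_2pi Ints_of_int)
  qed
  have iff: "w = 1 \<longleftrightarrow> int l dvd r"
  proof
    assume "w = 1"
    then have "cos (2 * pi * of_int r / real l) = 1" by (simp add: w_def complex_eq_iff)
    then obtain n :: int where "2 * pi * of_int r / real l = of_int n * 2 * pi"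
      using cos_one_2pi_int by blast
    then have "of_int r = (of_int n * real l :: real)" using assms by (simp add: field_simps)
    then have "r = n * int l" by (metis of_int_eq_iff of_int_mult of_int_of_nat_eq)
    then show "int l dvd r" by simp
  next
    assume "int l dvd r"
    then obtain n where "r = int l * n" by (rule dvdE)
    then have "2 * pi * of_int r / real l = 2 * pi * of_int n" using assms by simp
    then show "w = 1" unfolding w_def by (simp add: cis_multiple_2pi)
  qed
  show ?thesis
  proof (cases "w = 1")
    case True
    with iff show ?thesis by (simp add: pow)
  next
    case False
    then have "(\<Sum>j<l. w ^ j) = (w ^ l - 1) / (w - 1)" by (rule geometric_sum)
    with False iff \<open>w ^ l = 1\<close> show ?thesis by (simp add: pow)
  qed
qed

lemma cos_power_expand:
  "complex_of_real ((2 * cos \<theta>) ^ (2 * m)) =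
     (\<Sum>k\<le>2*m. of_nat ((2 * m) choose k) * cis (2 * \<theta> * of_int (int k - int m)))"
proof -
  have "complex_of_real (2 * cos \<theta>) = cis \<theta> + cis (- \<theta>)"
    by (simp add: complex_eq_iff)
  then have "complex_of_real ((2 * cos \<theta>) ^ (2 * m)) = (cis \<theta> + cis (- \<theta>)) ^ (2 * m)"
    by (simp only: of_real_power)
  also have "\<dots> = (\<Sum>k\<le>2*m. of_nat ((2 * m) choose k) * cis \<theta> ^ k * cis (- \<theta>) ^ (2 * m - k))"
    by (rule binomial_ring)
  also have "\<dots> = (\<Sum>k\<le>2*m. of_nat ((2 * m) choose k) * cis (2 * \<theta> * of_int (int k - int m)))"
  proof (rule sum.cong[OF refl])
    fix k assume "k \<in> {..2*m}"
    then have "real k * \<theta> + real (2 * m - k) * (- \<theta>) = 2 * \<theta> * of_int (int k - int m)"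
      by (simp add: of_nat_diff algebra_simps)
    then show "of_nat ((2 * m) choose k) * cis \<theta> ^ k * cis (- \<theta>) ^ (2 * m - k) =
        of_nat ((2 * m) choose k) * cis (2 * \<theta> * of_int (int k - int m))"
      unfolding Complex.DeMoivre mult.assoc cis_mult by (simp only:)
  qed
  finally show ?thesis .
qed

lemma sum_odd_symmetric:
  fixes f :: "nat \<Rightarrow> real"
  assumes "\<And>j. j \<le> 2 * h \<Longrightarrow> f (2 * h + 1 - j) = f j"
  shows "(\<Sum>j<2*h+1. f j) = f 0 + 2 * (\<Sum>j<h. f (Suc j))"
proof -
  have "(\<Sum>j<2*h+1. f j) = f 0 + (\<Sum>j<2*h. f (Suc j))"
    by (simp add: sum.lessThan_Suc_shift del: sum.lessThan_Suc)
  also have "(\<Sum>j<2*h. f (Suc j)) = (\<Sum>j<h. f (Suc j)) + (\<Sum>j=h..<2*h. f (Suc j))"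
    unfolding lessThan_atLeast0 by (rule sum.atLeastLessThan_concat [symmetric]) simp_all
  also have "(\<Sum>j=h..<2*h. f (Suc j)) = (\<Sum>j<h. f (Suc j))"
  proof (rule sum.reindex_bij_witness[of _ "\<lambda>j. 2 * h - Suc j" "\<lambda>j. 2 * h - Suc j"])
    fix j assume j: "j \<in> {h..<2*h}"
    show "f (Suc (2 * h - Suc j)) = f (Suc j)"
    proof -
      have "Suc (2 * h - Suc j) = 2 * h + 1 - Suc j" "Suc j \<le> 2 * h" using j by auto
      then show ?thesis by (simp only: assms)
    qed
  qed auto
  finally show ?thesis by simp
qed

text \<open>The binomial coefficients whose index is congruent to \<open>m\<close> modulo \<open>l\<close>, folded about the centre. Those with \<open>m + l (j + 1) > 2m\<close> are zero, so the range of \<open>j\<close> can be generous.\<close>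
lemma sum_binomial_filter:
  fixes l m :: nat
  assumes "l > 0"
  shows "(\<Sum>k\<le>2*m. if int l dvd (int k - int m) then real ((2*m) choose k) else 0) =
    real ((2*m) choose m) + 2 * (\<Sum>j<m. real ((2*m) choose (m + l * Suc j)))"
proof -
  let ?f = "\<lambda>k. if int l dvd (int k - int m) then real ((2*m) choose k) else 0"
  have "(\<Sum>k\<le>2*m. ?f k) = (\<Sum>k<m. ?f k) + (\<Sum>k=m..<2*m+1. ?f k)"
    unfolding lessThan_atLeast0 atMost_atLeast0 atLeastLessThanSuc_atLeastAtMost[symmetric]
    by (subst sum.atLeastLessThan_concat) simp_all
  also have "(\<Sum>k=m..<2*m+1. ?f k) = ?f m + (\<Sum>k=Suc m..<2*m+1. ?f k)"
    by (rule sum.atLeast_Suc_lessThan) simp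
  also have "(\<Sum>k=Suc m..<2*m+1. ?f k) = (\<Sum>i<m. ?f (m + Suc i))"
    by (rule sum.reindex_bij_witness[of _ "\<lambda>i. m + Suc i" "\<lambda>k. k - Suc m"]) auto
  also have "(\<Sum>k<m. ?f k) = (\<Sum>i<m. ?f (m - Suc i))"
    by (rule sum.nat_diff_reindex[symmetric])
  also have "\<dots> = (\<Sum>i<m. ?f (m + Suc i))"
  proof (rule sum.cong[OF refl])
    fix i assume "i \<in> {..<m}"
    then have i: "Suc i \<le> m" by simp
    have "(2*m) choose (m - Suc i) = (2*m) choose (m + Suc i)"
      using binomial_symmetric[of "m - Suc i" "2*m"] i by (simp add: mult_2)
    moreover have "int (m - Suc i) - int m = - int (Suc i)" "int (m + Suc i) - int m = int (Suc i)"
      using i by (simp_all add: of_nat_diff)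
    ultimately show "?f (m - Suc i) = ?f (m + Suc i)" by (simp only: dvd_minus_iff)
  qed
  also have "(\<Sum>i<m. ?f (m + Suc i)) = (\<Sum>i\<in>{i\<in>{..<m}. l dvd Suc i}. real ((2*m) choose (m + Suc i)))"
  proof -
    have "int (m + Suc i) - int m = int (Suc i)" for i by simp
    then have "?f (m + Suc i) = (if l dvd Suc i then real ((2*m) choose (m + Suc i)) else 0)" for i
      by (simp only: int_dvd_int_iff)
    then show ?thesis by (simp only: sum.inter_filter[OF finite_lessThan])
  qed
  also have "\<dots> = (\<Sum>j\<in>{j\<in>{..<m}. l * Suc j \<le> m}. real ((2*m) choose (m + l * Suc j)))"
  proof (rule sum.reindex_bij_witness[of _ "\<lambda>j. l * Suc j - 1" "\<lambda>i. Suc i div l - 1"])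
    fix i assume i: "i \<in> {i\<in>{..<m}. l dvd Suc i}"
    then obtain j where j: "Suc i = l * j" by auto
    then have "j > 0" by (cases j) auto
    then obtain j' where j': "j = Suc j'" by (cases j) auto
    have div: "Suc i div l - 1 = j'" using j j' assms by (simp del: mult_Suc_right)
    show "l * Suc (Suc i div l - 1) - 1 = i" unfolding div using j j' by simp
    have "j' < m" 
    proof -
      have "Suc j' \<le> l * Suc j'" using assms by (simp del: mult_Suc_right)
      also have "\<dots> \<le> m" using i j j' by simp
      finally show ?thesis by simp
    qed
    then show "Suc i div l - 1 \<in> {j\<in>{..<m}. l * Suc j \<le> m}" unfolding div using i j j' by simp
    show "real (2 * m choose (m + l * Suc (Suc i div l - 1))) = real (2 * m choose (m + Suc i))"
      unfolding div using j j' by simp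
  next
    fix j assume j: "j \<in> {j\<in>{..<m}. l * Suc j \<le> m}"
    have S: "Suc (l * Suc j - 1) = l * Suc j" using assms by simp
    show "Suc (l * Suc j - 1) div l - 1 = j" unfolding S using assms by (simp del: mult_Suc_right)
    show "l * Suc j - 1 \<in> {i\<in>{..<m}. l dvd Suc i}" using S j by (auto simp del: mult_Suc_right)
  qed
  also have "\<dots> = (\<Sum>j<m. real ((2*m) choose (m + l * Suc j)))"
    by (rule sum.mono_neutral_left) auto
  finally show ?thesis by simp
qed

text \<open>The finite form of the inversion formula: expand \<open>(2 cos \<theta>)^(2m)\<close> binomially and sum over the angles
  \<open>\<pi> j / l\<close>; the roots of unity retain every \<open>l\<close>-th coefficient. The modulus \<open>l\<close> is odd so that the angles pair up around \<open>0\<close>.\<close>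
lemma cos_power_sum:
  fixes h m :: nat
  defines "l \<equiv> 2 * h + 1"
  shows "1 + 2 * (\<Sum>j<h. cos (pi * real (Suc j) / real l) ^ (2 * m)) =
    real l / 4 ^ m * (real ((2*m) choose m) + 2 * (\<Sum>j<m. real ((2*m) choose (m + l * Suc j))))"
proof -
  have l0: "l > 0" by (simp add: l_def)
  let ?f = "\<lambda>j. (2 * cos (pi * real j / real l)) ^ (2 * m)"
  have "complex_of_real (\<Sum>j<l. ?f j) =
     (\<Sum>j<l. \<Sum>k\<le>2*m. of_nat ((2*m) choose k) * cis (2 * (pi * real j / real l) * of_int (int k - int m)))"
    unfolding of_real_sum cos_power_expand ..
  also have "\<dots> = (\<Sum>k\<le>2*m. \<Sum>j<l. of_nat ((2*m) choose k) * cis (2 * pi * real j * of_int (int k - int m) / real l))"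
    by (subst sum.swap) (simp add: mult.assoc)
  also have "\<dots> = (\<Sum>k\<le>2*m. of_nat ((2*m) choose k) * (if int l dvd (int k - int m) then of_nat l else 0))"
    unfolding sum_distrib_left[symmetric] sum_roots_of_unity[OF l0] ..
  also have "\<dots> = (\<Sum>k\<le>2*m. complex_of_real (real l * (if int l dvd (int k - int m) then real ((2*m) choose k) else 0)))"
    by (rule sum.cong[OF refl]) simp
  also have "\<dots> = complex_of_real (real l * (\<Sum>k\<le>2*m. if int l dvd (int k - int m) then real ((2*m) choose k) else 0))"
    unfolding of_real_sum sum_distrib_left ..
  finally have "(\<Sum>j<l. ?f j) = real l * (\<Sum>k\<le>2*m. if int l dvd (int k - int m) then real ((2*m) choose k) else 0)"
    by (simp only: of_real_eq_iff)
  also have "\<dots> = real l * (real ((2*m) choose m) + 2 * (\<Sum>j<m. real ((2*m) choose (m + l * Suc j))))"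
    unfolding sum_binomial_filter[OF l0] ..
  also have "(\<Sum>j<l. ?f j) = ?f 0 + 2 * (\<Sum>j<h. ?f (Suc j))"
    unfolding l_def
  proof (rule sum_odd_symmetric)
    fix j assume "j \<le> 2 * h"
    then have "pi * real (2 * h + 1 - j) / real (2 * h + 1) = pi - pi * real j / real (2 * h + 1)"
      by (simp add: of_nat_diff field_simps)
    then show "(2 * cos (pi * real (2 * h + 1 - j) / real (2 * h + 1))) ^ (2 * m) =
       (2 * cos (pi * real j / real (2 * h + 1))) ^ (2 * m)"
      by (simp add: power_mult)
  qed
  also have "\<dots> = 4 ^ m * (1 + 2 * (\<Sum>j<h. cos (pi * real (Suc j) / real l) ^ (2 * m)))"
    by (simp add: power_mult_distrib power_mult sum_distrib_left distrib_left mult.left_commute)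
  finally show ?thesis by (simp add: field_simps)
qed

text \<open>\<open>ln (cos u) + u^2/2\<close> decreases because \<open>tan u \<ge> u\<close>.\<close>
lemma cos_le_exp:
  assumes "0 \<le> u" "u \<le> pi / 2"
  shows "cos u \<le> exp (- (u\<^sup>2) / 2)"
proof -
  have tanx: "x \<le> tan x" if "0 \<le> x" "x < pi / 2" for x :: real
  proof -
    have "0 - tan 0 \<ge> x - tan x"
    proof (rule DERIV_nonpos_imp_nonincreasing[of 0 x "\<lambda>x. x - tan x"])
      fix y assume y: "0 \<le> y" "y \<le> x"
      then have c: "cos y \<noteq> 0" using that cos_gt_zero[of y] by (cases "y = 0") auto
      have "((\<lambda>x. x - tan x) has_real_derivative 1 - inverse ((cos y)\<^sup>2)) (at y)"
        by (intro derivative_intros DERIV_tan c)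
      moreover have "1 - inverse ((cos y)\<^sup>2) \<le> 0"
      proof -
        have "(cos y)\<^sup>2 \<le> 1" by (simp add: abs_square_le_1)
        then show ?thesis using c by (simp add: one_le_inverse)
      qed
      ultimately show "\<exists>d. ((\<lambda>x. x - tan x) has_real_derivative d) (at y) \<and> d \<le> 0" by blast
    qed (use that in simp)
    then show ?thesis by simp
  qed
  show ?thesis
  proof (cases "u = pi / 2")
    case False
    with assms have u: "u < pi / 2" by simp
    have "ln (cos u) + u\<^sup>2 / 2 \<le> ln (cos 0) + 0\<^sup>2 / 2"
    proof (rule DERIV_nonpos_imp_nonincreasing[of 0 u "\<lambda>x. ln (cos x) + x\<^sup>2 / 2"])
      fix y assume y: "0 \<le> y" "y \<le> u"
      then have c: "cos y > 0" using u cos_gt_zero[of y] by (cases "y = 0") auto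
      have "((\<lambda>x. ln (cos x) + x\<^sup>2 / 2) has_real_derivative - tan y + y) (at y)"
        using c by (auto intro!: derivative_eq_intros simp: tan_def)
      moreover have "- tan y + y \<le> 0" using tanx[of y] y u by simp
      ultimately show "\<exists>d. ((\<lambda>x. ln (cos x) + x\<^sup>2 / 2) has_real_derivative d) (at y) \<and> d \<le> 0" by blast
    qed (use assms in simp)
    then have "ln (cos u) \<le> - (u\<^sup>2) / 2" by simp
    moreover have "cos u > 0" using u assms cos_gt_zero[of u] by (cases "u = 0") auto
    ultimately show ?thesis by (metis exp_le_cancel_iff exp_ln)
  next
    case True
    show ?thesis unfolding True by (simp add: cos_pi_half)
  qed
qed

text \<open>The left-hand side is the reciprocal of the Wallis product.\<close>
lemma wallis_central_binomial:
  "(\<lambda>n. (real ((2*n) choose n) / 4 ^ n)\<^sup>2 * real (2 * n + 1)) \<longlonglongrightarrow> 2 / pi"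
proof -
  define c where "c n = real ((2*n) choose n) / 4 ^ n" for n
  have rec: "c (Suc n) = c n * real (2 * n + 1) / real (2 * n + 2)" for n
  proof -
    have b: "real ((2*k) choose k) = fact (2*k) / (fact k * fact k)" for k
      using binomial_fact[of k "2*k", where 'a = real] by simp
    have "2 * Suc n = Suc (Suc (2 * n))" by simp
    then have 1: "fact (2 * Suc n) = (2 * real (Suc n) * (real (2 * n + 1) * fact (2 * n)) :: real)"
      by (simp add: algebra_simps)
    have 2: "real (2 * n + 2) = 2 * real (Suc n)" by simp
    have 3: "fact (Suc n) = real (Suc n) * (fact n :: real)" by simp
    have "2 * x * (y * F) / ((x * G) * (x * G)) / (4 * P) = F / (G * G) / P * y / (2 * x)"
      if "x > 0" "G > 0" "P > 0" for x y F G P :: real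
      using that by (simp add: field_simps)
    from this[of "real (Suc n)" "fact n" "4 ^ n"] show ?thesis
      unfolding c_def b 1 2 3 power_Suc by simp
  qed
  have "(c n)\<^sup>2 * real (2 * n + 1) = inverse (\<Prod>k=1..n. (4 * real k ^ 2) / (4 * real k ^ 2 - 1))" for n
  proof (induction n)
    case 0
    show ?case by (simp add: c_def)
  next
    case (Suc n)
    have e: "4 * real (Suc n) ^ 2 - 1 = real (2 * n + 1) * real (2 * Suc n + 1)"
      by (simp add: power2_eq_square algebra_simps)
    have e2: "4 * real (Suc n) ^ 2 = real (2 * n + 2) ^ 2"
      by (simp add: power2_eq_square algebra_simps)
    have "(c (Suc n))\<^sup>2 * real (2 * Suc n + 1) =
       ((c n)\<^sup>2 * real (2 * n + 1)) * (real (2 * n + 1) * real (2 * Suc n + 1) / real (2 * n + 2) ^ 2)"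
      unfolding rec power_mult_distrib power_divide by (simp add: power2_eq_square)
    also have "\<dots> = inverse ((\<Prod>k=1..n. (4 * real k ^ 2) / (4 * real k ^ 2 - 1)) * ((4 * real (Suc n) ^ 2) / (4 * real (Suc n) ^ 2 - 1)))"
      unfolding Suc.IH e unfolding e2 inverse_mult_distrib inverse_divide ..
    finally show ?case by simp
  qed
  moreover have "(\<lambda>n. inverse (\<Prod>k=1..n. (4 * real k ^ 2) / (4 * real k ^ 2 - 1))) \<longlonglongrightarrow> inverse (pi / 2)"
    by (intro tendsto_inverse wallis) simp
  ultimately show ?thesis by (simp add: c_def)
qed

lemma binomial_ratio_rec:
  "real ((2*m) choose (m + Suc r)) * (real m + real r + 1) = real ((2*m) choose (m + r)) * (real m - real r)"
  if "r < m"
proof -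
  have "Suc (m + r) * ((2*m) choose Suc (m + r)) = (2*m - (m + r)) * ((2*m) choose (m + r))"
    by (metis binomial_absorb_comp binomial_absorption)
  then have "real (Suc (m + r)) * real ((2*m) choose Suc (m + r)) = real (2*m - (m + r)) * real ((2*m) choose (m + r))"
    by (metis of_nat_mult)
  moreover have "real (2*m - (m + r)) = real m - real r" using that by simp
  ultimately show ?thesis by (simp add: algebra_simps)
qed

text \<open>Moving from \<open>m + i\<close> to \<open>m + i + 1\<close> multiplies the coefficient by \<open>1 - (2i + 1)/(m + i + 1)\<close>, and the numbers \<open>2i + 1\<close>
  with \<open>i < r\<close> add up to \<open>r^2\<close>.\<close>
lemma binomial_upper:
  assumes "r \<le> m"
  shows "real ((2*m) choose (m + r)) \<le> real ((2*m) choose m) * exp (- (real r)\<^sup>2 / (real m + real r))"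
proof -
  have "real ((2*m) choose (m + i)) \<le> real ((2*m) choose m) * exp (- (real i)\<^sup>2 / (real m + real r))"
    if "i \<le> r" for i
    using that
  proof (induction i)
    case (Suc i)
    then have i: "i < m" "i < r" using assms by auto
    define B where "B = real ((2*m) choose (m + i))"
    have d: "real m + real i + 1 > 0" "real m + real r > 0" using i by linarith+
    have "(real m - real i) / (real m + real i + 1) = 1 + - ((2 * real i + 1) / (real m + real i + 1))"
      using d by (simp add: field_simps)
    also have "\<dots> \<le> exp (- ((2 * real i + 1) / (real m + real i + 1)))" by (rule exp_ge_add_one_self)
    also have "\<dots> \<le> exp (- ((2 * real i + 1) / (real m + real r)))"
      using i d by (simp add: frac_le)
    finally have fac: "(real m - real i) / (real m + real i + 1) \<le> exp (- ((2 * real i + 1) / (real m + real r)))" .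
    have "real ((2*m) choose (m + Suc i)) = B * ((real m - real i) / (real m + real i + 1))"
      using binomial_ratio_rec[OF i(1)] d by (simp add: field_simps B_def)
    also have "\<dots> \<le> (real ((2*m) choose m) * exp (- (real i)\<^sup>2 / (real m + real r))) *
        exp (- ((2 * real i + 1) / (real m + real r)))"
      using Suc.IH i fac by (intro mult_mono) (auto simp: B_def)
    also have "\<dots> = real ((2*m) choose m) * exp (- (real (Suc i))\<^sup>2 / (real m + real r))"
    proof -
      have "(real (Suc i))\<^sup>2 = (real i)\<^sup>2 + (2 * real i + 1)" by (simp add: power2_eq_square algebra_simps)
      then show ?thesis unfolding mult.assoc exp_add[symmetric] by (simp only:) (simp add: add_divide_distrib diff_divide_distrib)
    qed
    finally show ?case .
  qed simp
  then show ?thesis by simp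
qed

text \<open>The companion estimate, from \<open>1 + (2i + 1)/(m - i) \<le> exp ((2i + 1)/(m - i))\<close> for the inverse ratio.\<close>
lemma binomial_lower:
  assumes "r < m"
  shows "real ((2*m) choose (m + r)) \<ge> real ((2*m) choose m) * exp (- (real r)\<^sup>2 / (real m - real r))"
proof -
  have "real ((2*m) choose (m + i)) \<ge> real ((2*m) choose m) * exp (- (real i)\<^sup>2 / (real m - real r))"
    if "i \<le> r" for i
    using that
  proof (induction i)
    case (Suc i)
    then have i: "i < m" "i < r" using assms by auto
    define B where "B = real ((2*m) choose (m + i))"
    have d: "real m + real i + 1 > 0" "real m - real r > 0" "real m - real i > 0" using i assms by linarith+
    have "1 + (2 * real i + 1) / (real m - real i) \<le> exp ((2 * real i + 1) / (real m - real i))"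
      by (rule exp_ge_add_one_self)
    also have "\<dots> \<le> exp ((2 * real i + 1) / (real m - real r))"
      using i d by (simp add: frac_le)
    also have "1 + (2 * real i + 1) / (real m - real i) = (real m + real i + 1) / (real m - real i)"
      using d by (simp add: field_simps)
    finally have "inverse (exp ((2 * real i + 1) / (real m - real r))) \<le> inverse ((real m + real i + 1) / (real m - real i))"
      using d by (intro le_imp_inverse_le) simp_all
    then have fac: "exp (- ((2 * real i + 1) / (real m - real r))) \<le> (real m - real i) / (real m + real i + 1)"
      by (simp only: exp_minus inverse_divide)
    have "real ((2*m) choose m) * exp (- (real (Suc i))\<^sup>2 / (real m - real r)) =
       (real ((2*m) choose m) * exp (- (real i)\<^sup>2 / (real m - real r))) *
        exp (- ((2 * real i + 1) / (real m - real r)))"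
    proof -
      have "(real (Suc i))\<^sup>2 = (real i)\<^sup>2 + (2 * real i + 1)" by (simp add: power2_eq_square algebra_simps)
      then show ?thesis unfolding mult.assoc exp_add[symmetric] by (simp only:) (simp add: add_divide_distrib diff_divide_distrib)
    qed
    also have "\<dots> \<le> B * ((real m - real i) / (real m + real i + 1))"
      using Suc.IH i fac by (intro mult_mono) (auto simp: B_def)
    also have "\<dots> = real ((2*m) choose (m + Suc i))"
      using binomial_ratio_rec[OF i(1)] d by (simp add: field_simps B_def)
    finally show ?case .
  qed simp
  then show ?thesis by simp
qed

text \<open>Tannery's theorem with a bound that holds for all indices at once.\<close>
lemma tannery_real:
  fixes a :: "nat \<Rightarrow> nat \<Rightarrow> real"
  assumes lim: "\<And>k. (\<lambda>n. a k n) \<longlonglongrightarrow> b k"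
    and bound: "\<forall>\<^sub>F n in sequentially. \<forall>k. \<bar>a k n\<bar> \<le> M k" and M: "summable M"
  shows "(\<lambda>n. \<Sum>k. a k n) \<longlonglongrightarrow> (\<Sum>k. b k)"
proof (rule tannerys_theorem[THEN conjunct2, THEN conjunct2, OF lim _ M])
  show "\<forall>\<^sub>F (k, n) in sequentially \<times>\<^sub>F sequentially. norm (a k n) \<le> M k"
    unfolding eventually_prod_filter
    by (rule exI[of _ "\<lambda>_. True"], rule exI[of _ "\<lambda>n. \<forall>k. \<bar>a k n\<bar> \<le> M k"]) (simp add: bound)
qed simp

lemma summable_gaussian:
  assumes "c > 0"
  shows "summable (\<lambda>j. exp (- c * (real (Suc j))\<^sup>2))"
proof (rule summable_comparison_test)
  have "exp (- c * (real (Suc j))\<^sup>2) \<le> exp (- c) ^ j" for j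
  proof -
    have "real j \<le> (real (Suc j))\<^sup>2" by (simp add: power2_eq_square algebra_simps)
    then have "c * real j \<le> c * (real (Suc j))\<^sup>2" using assms by simp
    then show ?thesis by (simp add: exp_of_nat_mult[symmetric] mult.commute)
  qed
  then show "\<exists>N. \<forall>n\<ge>N. norm (exp (- c * (real (Suc n))\<^sup>2)) \<le> exp (- c) ^ n" by simp
  show "summable (\<lambda>n. exp (- c) ^ n)" using assms by (intro summable_geometric) simp
qed

text \<open>Let \<open>l = 2h + 1\<close> tend to infinity in \<open>cos_power_sum\<close>, with \<open>m\<close> about \<open>l^2/s\<close>. Then \<open>cos (\<pi> j/l)^(2m)\<close> tends to
  \<open>exp (- \<pi>^2 j^2/s)\<close>, and the binomial coefficient at distance \<open>l j\<close> from the centre, relative to the central one, to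
  \<open>exp (- s j^2)\<close>; the Wallis product supplies the factor. Both limits are taken termwise.\<close>
theorem gaussian_sum_inversion:
  assumes s: "s > 0"
  shows "1 + 2 * (\<Sum>j. exp (- (pi\<^sup>2 / s) * (real (Suc j))\<^sup>2)) =
     sqrt (s / pi) * (1 + 2 * (\<Sum>j. exp (- s * (real (Suc j))\<^sup>2)))"
proof -
  define l where "l h = 2 * h + 1" for h :: nat
  \<comment> \<open>Rounding up makes the Gaussian \<open>exp (- \<pi>^2 j^2/s)\<close> itself an upper bound for the powers of the cosine.\<close>
  define m where "m h = nat \<lceil>(real (l h))\<^sup>2 / s\<rceil>" for h
  have m_ge: "(real (l h))\<^sup>2 / s \<le> real (m h)" for h
    unfolding m_def by (rule real_nat_ceiling_ge)
  have m_lt: "real (m h) \<le> (real (l h))\<^sup>2 / s + 1" for h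
  proof -
    have "0 \<le> (real (l h))\<^sup>2 / s" using s by simp
    then have "0 \<le> \<lceil>(real (l h))\<^sup>2 / s\<rceil>" by simp
    then have "real (m h) = of_int \<lceil>(real (l h))\<^sup>2 / s\<rceil>" unfolding m_def by (rule of_nat_nat)
    then show ?thesis using of_int_ceiling_le_add_one[of "(real (l h))\<^sup>2 / s"] by (simp only:)
  qed
  have l_pos: "real (l h) > 0" for h by (simp add: l_def)
  have m_pos: "real (m h) > 0" for h
    using m_ge[of h] s l_pos[of h] by (smt (verit) divide_pos_pos zero_less_power)
  have l_top: "filterlim (\<lambda>h. real (l h)) at_top sequentially"
    unfolding l_def by real_asymp
  have inv_l: "(\<lambda>h. 1 / real (l h)) \<longlonglongrightarrow> 0"
    by (rule tendsto_divide_0[OF tendsto_const filterlim_at_top_imp_at_infinity[OF l_top]])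
  have ratio: "(\<lambda>h. real (m h) / (real (l h))\<^sup>2) \<longlonglongrightarrow> 1 / s"
  proof (rule tendsto_sandwich)
    show "\<forall>\<^sub>F h in sequentially. 1 / s \<le> real (m h) / (real (l h))\<^sup>2"
      using m_ge l_pos s by (intro always_eventually allI) (simp add: field_simps)
    show "\<forall>\<^sub>F h in sequentially. real (m h) / (real (l h))\<^sup>2 \<le> 1 / s + (1 / real (l h))\<^sup>2"
    proof (intro always_eventually allI)
      fix h
      have "real (m h) / (real (l h))\<^sup>2 \<le> ((real (l h))\<^sup>2 / s + 1) / (real (l h))\<^sup>2"
        by (intro divide_right_mono m_lt) simp
      also have "\<dots> = 1 / s + (1 / real (l h))\<^sup>2"
        using l_pos[of h] by (simp add: add_divide_distrib power_divide)
      finally show "real (m h) / (real (l h))\<^sup>2 \<le> 1 / s + (1 / real (l h))\<^sup>2" .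
    qed
    have "(\<lambda>h. 1 / s + (1 / real (l h))\<^sup>2) \<longlonglongrightarrow> 1 / s + 0\<^sup>2"
      by (intro tendsto_intros inv_l)
    then show "(\<lambda>h. 1 / s + (1 / real (l h))\<^sup>2) \<longlonglongrightarrow> 1 / s" by simp
  qed simp
  have ratio': "(\<lambda>h. (real (l h))\<^sup>2 / real (m h)) \<longlonglongrightarrow> s"
    using tendsto_inverse[OF ratio] s by (simp add: inverse_eq_divide)
  have l_over_m: "(\<lambda>h. real (l h) / real (m h)) \<longlonglongrightarrow> 0"
  proof -
    have "(\<lambda>h. (real (l h))\<^sup>2 / real (m h) * (1 / real (l h))) \<longlonglongrightarrow> s * 0"
      by (intro tendsto_intros ratio' inv_l)
    moreover have "(real (l h))\<^sup>2 / real (m h) * (1 / real (l h)) = real (l h) / real (m h)" for h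
      using l_pos[of h] by (simp add: power2_eq_square)
    ultimately show ?thesis by simp
  qed

  define L where "L j h = (if j < h then cos (pi * real (Suc j) / real (l h)) ^ (2 * m h) else 0)" for j h
  have "(\<lambda>h. \<Sum>j. L j h) \<longlonglongrightarrow> (\<Sum>j. exp (- (pi\<^sup>2 / s) * (real (Suc j))\<^sup>2))"
  proof (rule tannery_real)
    show "(\<lambda>h. L j h) \<longlonglongrightarrow> exp (- (pi\<^sup>2 / s) * (real (Suc j))\<^sup>2)" for j
    proof -
      define u where "u h = pi * real (Suc j) / real (l h)" for h
      have u_pos: "u h > 0" for h unfolding u_def using l_pos[of h] by simp
      have "(\<lambda>h. pi * real (Suc j) * (1 / real (l h))) \<longlonglongrightarrow> pi * real (Suc j) * 0"
        by (intro tendsto_intros inv_l)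
      then have u0: "u \<longlonglongrightarrow> 0" by (simp add: u_def[abs_def])
      then have u_right: "filterlim u (at_right 0) sequentially"
      proof -
        have "u h \<in> {0<..} \<and> u h \<noteq> 0" for h using u_pos[of h] by simp
        then show ?thesis unfolding filterlim_at using u0 by simp
      qed
      have "((\<lambda>x::real. ln (cos x) / x\<^sup>2) \<longlongrightarrow> - (1 / 2)) (at_right 0)" by real_asymp
      from filterlim_compose[OF this u_right]
      have lc: "(\<lambda>h. ln (cos (u h)) / (u h)\<^sup>2) \<longlonglongrightarrow> - (1 / 2)" .
      have "(\<lambda>h. 2 * (pi * real (Suc j))\<^sup>2 * (real (m h) / (real (l h))\<^sup>2) * (ln (cos (u h)) / (u h)\<^sup>2)) \<longlonglongrightarrow>
          2 * (pi * real (Suc j))\<^sup>2 * (1 / s) * - (1 / 2)"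
        by (intro tendsto_intros ratio lc)
      moreover have "2 * (pi * real (Suc j))\<^sup>2 * (real (m h) / (real (l h))\<^sup>2) * (ln (cos (u h)) / (u h)\<^sup>2) =
          real (2 * m h) * ln (cos (u h))" for h
      proof -
        have "(u h)\<^sup>2 = (pi * real (Suc j))\<^sup>2 / (real (l h))\<^sup>2" by (simp add: u_def power_divide)
        moreover have "(pi * real (Suc j))\<^sup>2 > 0" "(real (l h))\<^sup>2 > 0" using l_pos[of h] by simp_all
        moreover have "2 * P * (M / Q) * (C / (P / Q)) = 2 * M * C" if "P > 0" "Q > 0" for P Q M C :: real
          using that by (simp add: field_simps)
        ultimately show ?thesis by simp
      qed
      ultimately have "(\<lambda>h. exp (real (2 * m h) * ln (cos (u h)))) \<longlonglongrightarrow> exp (2 * (pi * real (Suc j))\<^sup>2 * (1 / s) * - (1 / 2))"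
        by (intro tendsto_exp) simp
      moreover have "\<forall>\<^sub>F h in sequentially. exp (real (2 * m h) * ln (cos (u h))) = L j h"
      proof -
        have "\<forall>\<^sub>F h in sequentially. u h < pi / 2" using order_tendstoD(2)[OF u0, of "pi/2"] by simp
        then show ?thesis using eventually_gt_at_top[of j]
        proof eventually_elim
          case (elim h)
          then have "cos (u h) > 0" using u_pos[of h] by (intro cos_gt_zero)
          then have "exp (real (2 * m h) * ln (cos (u h))) = cos (u h) ^ (2 * m h)"
            by (simp only: exp_of_nat_mult exp_ln)
          then show ?case using elim by (simp only: L_def u_def if_True)
        qed
      qed
      ultimately have "(\<lambda>h. L j h) \<longlonglongrightarrow> exp (2 * (pi * real (Suc j))\<^sup>2 * (1 / s) * - (1 / 2))"
        by (rule Lim_transform_eventually)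
      moreover have "2 * (pi * real (Suc j))\<^sup>2 * (1 / s) * - (1 / 2) = - (pi\<^sup>2 / s) * (real (Suc j))\<^sup>2"
        by (simp add: power_mult_distrib)
      ultimately show ?thesis by (simp only:)
    qed
    show "\<forall>\<^sub>F h in sequentially. \<forall>j. \<bar>L j h\<bar> \<le> exp (- (pi\<^sup>2 / s) * (real (Suc j))\<^sup>2)"
    proof (intro always_eventually allI)
      fix h j
      show "\<bar>L j h\<bar> \<le> exp (- (pi\<^sup>2 / s) * (real (Suc j))\<^sup>2)"
      proof (cases "j < h")
        case True
        define u where "u = pi * real (Suc j) / real (l h)"
        have "2 * real (Suc j) \<le> real (l h)" using True by (simp add: l_def)
        then have "pi * (2 * real (Suc j)) \<le> pi * real (l h)" by simp
        then have u: "0 \<le> u" "u \<le> pi / 2" using l_pos[of h] by (simp_all add: u_def field_simps)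
        have "0 \<le> cos u" using u by (intro cos_ge_zero) auto
        then have "cos u ^ (2 * m h) \<le> exp (- (u\<^sup>2) / 2) ^ (2 * m h)"
          by (intro power_mono cos_le_exp u)
        also have "\<dots> = exp (- (u\<^sup>2) * real (m h))" by (simp add: exp_of_nat_mult[symmetric])
        also have "\<dots> \<le> exp (- (pi\<^sup>2 / s) * (real (Suc j))\<^sup>2)"
        proof -
          have "u\<^sup>2 * ((real (l h))\<^sup>2 / s) \<le> u\<^sup>2 * real (m h)" by (intro mult_left_mono m_ge) simp
          moreover have "u\<^sup>2 * ((real (l h))\<^sup>2 / s) = (pi\<^sup>2 / s) * (real (Suc j))\<^sup>2"
            using l_pos[of h] by (simp add: u_def power_divide power_mult_distrib)
          ultimately have "(pi\<^sup>2 / s) * (real (Suc j))\<^sup>2 \<le> u\<^sup>2 * real (m h)" by (simp only:)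
          then show ?thesis by simp
        qed
        finally show ?thesis using True \<open>0 \<le> cos u\<close> by (simp add: L_def u_def)
      qed (simp add: L_def)
    qed
    show "summable (\<lambda>j. exp (- (pi\<^sup>2 / s) * (real (Suc j))\<^sup>2))"
      using s by (intro summable_gaussian) simp
  qed
  moreover have "(\<Sum>j. L j h) = (\<Sum>j<h. cos (pi * real (Suc j) / real (l h)) ^ (2 * m h))" for h
    by (subst suminf_finite[of "{..<h}"]) (auto simp: L_def)
  ultimately have left: "(\<lambda>h. 1 + 2 * (\<Sum>j<h. cos (pi * real (Suc j) / real (l h)) ^ (2 * m h))) \<longlonglongrightarrow>
      1 + 2 * (\<Sum>j. exp (- (pi\<^sup>2 / s) * (real (Suc j))\<^sup>2))"
    by (intro tendsto_intros) simp

  define R where "R j h = real ((2 * m h) choose (m h + l h * Suc j)) / real ((2 * m h) choose (m h))" for j h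
  have cpos: "real ((2 * n) choose n) > 0" for n by simp
  have R0: "R j h \<ge> 0" for j h by (simp add: R_def)
  have R_upper: "R j h \<le> exp (- (real (l h * Suc j))\<^sup>2 / (real (m h) + real (l h * Suc j)))"
    if "l h * Suc j \<le> m h" for j h
    using binomial_upper[OF that] cpos[of "m h"] by (simp add: R_def field_simps)
  have R_lower: "R j h \<ge> exp (- (real (l h * Suc j))\<^sup>2 / (real (m h) - real (l h * Suc j)))"
    if "l h * Suc j < m h" for j h
    using binomial_lower[OF that] cpos[of "m h"] by (simp add: R_def field_simps)
  have exponent: "(\<lambda>h. - (real (l h * Suc j))\<^sup>2 / (real (m h) + \<epsilon> * real (l h * Suc j))) \<longlonglongrightarrow> - s * (real (Suc j))\<^sup>2"
    for \<epsilon> :: real and j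
  proof -
    have "(\<lambda>h. - ((real (l h))\<^sup>2 / real (m h)) * (real (Suc j))\<^sup>2 / (1 + \<epsilon> * real (Suc j) * (real (l h) / real (m h)))) \<longlonglongrightarrow>
       - s * (real (Suc j))\<^sup>2 / (1 + \<epsilon> * real (Suc j) * 0)"
      by (intro tendsto_intros ratio' l_over_m) simp
    moreover have "- ((real (l h))\<^sup>2 / real (m h)) * (real (Suc j))\<^sup>2 / (1 + \<epsilon> * real (Suc j) * (real (l h) / real (m h))) =
       - (real (l h * Suc j))\<^sup>2 / (real (m h) + \<epsilon> * real (l h * Suc j))" for h
    proof -
      have "1 + \<epsilon> * J * (l / M) = (M + \<epsilon> * (l * J)) / M" if "M > 0" for J l M :: real
        using that by (simp add: field_simps)
      then have "1 + \<epsilon> * real (Suc j) * (real (l h) / real (m h)) = (real (m h) + \<epsilon> * (real (l h) * real (Suc j))) / real (m h)"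
        using m_pos by blast
      then show ?thesis using m_pos[of h] by (simp only: of_nat_mult power_mult_distrib) simp
    qed
    ultimately show ?thesis by (simp only: mult_zero_right add_0_right div_by_1)
  qed
  have small: "\<forall>\<^sub>F h in sequentially. l h * Suc j < m h" for j
  proof -
    have "(\<lambda>h. real (l h) / real (m h) * real (Suc j)) \<longlonglongrightarrow> 0 * real (Suc j)"
      by (intro tendsto_intros l_over_m)
    then have "\<forall>\<^sub>F h in sequentially. real (l h) / real (m h) * real (Suc j) < 1"
      by (rule order_tendstoD) simp
    then show ?thesis
    proof eventually_elim
      case (elim h)
      then have "real (l h) * real (Suc j) < real (m h)" using m_pos[of h] by (simp add: field_simps)
      then show ?case by (metis of_nat_less_iff of_nat_mult)
    qed
  qed
  have "(\<lambda>h. \<Sum>j. R j h) \<longlonglongrightarrow> (\<Sum>j. exp (- s * (real (Suc j))\<^sup>2))"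
  proof (rule tannery_real)
    show "(\<lambda>h. R j h) \<longlonglongrightarrow> exp (- s * (real (Suc j))\<^sup>2)" for j
    proof (rule tendsto_sandwich)
      show "\<forall>\<^sub>F h in sequentially. exp (- (real (l h * Suc j))\<^sup>2 / (real (m h) + (-1) * real (l h * Suc j))) \<le> R j h"
        using small[of j]
      proof eventually_elim
        case (elim h)
        show ?case using R_lower[OF elim] by (simp only: mult_minus1 add_uminus_conv_diff)
      qed
      show "\<forall>\<^sub>F h in sequentially. R j h \<le> exp (- (real (l h * Suc j))\<^sup>2 / (real (m h) + 1 * real (l h * Suc j)))"
        using small[of j]
      proof eventually_elim
        case (elim h)
        show ?case using R_upper[OF less_imp_le[OF elim]] by (simp only: mult_1)
      qed
    qed (intro tendsto_exp exponent)+
    have "\<forall>\<^sub>F h in sequentially. s / 2 < (real (l h))\<^sup>2 / real (m h)"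
      using s by (intro order_tendstoD(1)[OF ratio']) simp
    then show "\<forall>\<^sub>F h in sequentially. \<forall>j. \<bar>R j h\<bar> \<le> exp (- (s / 4) * (real (Suc j))\<^sup>2)"
    proof eventually_elim
      case (elim h)
      show ?case
      proof
        fix j
        show "\<bar>R j h\<bar> \<le> exp (- (s / 4) * (real (Suc j))\<^sup>2)"
        proof (cases "l h * Suc j \<le> m h")
          case True
          then have le: "real (l h * Suc j) \<le> real (m h)" by (simp only: of_nat_le_iff)
          have "(s / 4) * (real (Suc j))\<^sup>2 \<le> ((real (l h))\<^sup>2 / real (m h) / 2) * (real (Suc j))\<^sup>2"
          proof (rule mult_right_mono)
            have "s / 4 \<le> X / 2" if "s / 2 < X" for X using that by simp
            then show "s / 4 \<le> (real (l h))\<^sup>2 / real (m h) / 2" using elim .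
          qed simp
          also have "\<dots> = (real (l h * Suc j))\<^sup>2 / (real (m h) + real (m h))"
          proof -
            have "(X / M / 2) * J = (X * J) / (M + M)" for X M J :: real by simp
            then show ?thesis by (simp only: of_nat_mult power_mult_distrib)
          qed
          also have "\<dots> \<le> (real (l h * Suc j))\<^sup>2 / (real (m h) + real (l h * Suc j))"
            using le m_pos[of h] by (intro divide_left_mono mult_pos_pos add_pos_nonneg) simp_all
          finally have "- ((real (l h * Suc j))\<^sup>2 / (real (m h) + real (l h * Suc j))) \<le> - ((s / 4) * (real (Suc j))\<^sup>2)"
            by (simp only: neg_le_iff_le)
          then have "exp (- (real (l h * Suc j))\<^sup>2 / (real (m h) + real (l h * Suc j))) \<le> exp (- (s / 4) * (real (Suc j))\<^sup>2)"
            by (simp only: exp_le_cancel_iff minus_divide_left mult_minus_left)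
          with R_upper[OF True] show ?thesis unfolding abs_of_nonneg[OF R0] by (rule order_trans)
        next
          case False
          then have "(2 * m h) choose (m h + l h * Suc j) = 0" by (intro binomial_eq_0) simp
          then have "R j h = 0" by (simp only: R_def of_nat_0 div_0)
          then show ?thesis by simp
        qed
      qed
    qed
    show "summable (\<lambda>j. exp (- (s / 4) * (real (Suc j))\<^sup>2))" using s by (intro summable_gaussian) simp
  qed
  moreover have "(\<Sum>j. R j h) = (\<Sum>j<m h. R j h)" for h
  proof (rule suminf_finite)
    fix j assume "j \<notin> {..<m h}"
    then have "m h < l h * Suc j" by (simp add: l_def)
    then have "(2 * m h) choose (m h + l h * Suc j) = 0" by (intro binomial_eq_0) simp
    then show "R j h = 0" by (simp only: R_def of_nat_0 div_0)
  qed simp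
  ultimately have sumR: "(\<lambda>h. \<Sum>j<m h. R j h) \<longlonglongrightarrow> (\<Sum>j. exp (- s * (real (Suc j))\<^sup>2))" by (simp only:)
  have central: "(\<lambda>h. real (l h) / 4 ^ m h * real ((2 * m h) choose (m h))) \<longlonglongrightarrow> sqrt (s / pi)"
  proof -
    have "filterlim (\<lambda>h. real (m h)) at_top sequentially"
    proof (rule filterlim_at_top_mono)
      show "filterlim (\<lambda>h. (real (l h))\<^sup>2 / s) at_top sequentially" unfolding l_def using s by real_asymp
    qed (use m_ge in auto)
    then have m_top: "filterlim m at_top sequentially" using filterlim_real_sequentially filterlim_sequentially_iff_filterlim_real by blast
    have inv_m: "(\<lambda>h. 1 / real (m h)) \<longlonglongrightarrow> 0"
      by (rule tendsto_divide_0[OF tendsto_const filterlim_at_top_imp_at_infinity]) fact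
    have "(\<lambda>h. ((real ((2 * m h) choose m h) / 4 ^ m h)\<^sup>2 * real (2 * m h + 1)) *
        ((real (l h))\<^sup>2 / real (m h) / (2 + 1 / real (m h)))) \<longlonglongrightarrow> (2 / pi) * (s / (2 + 0))"
      by (intro tendsto_mult tendsto_divide tendsto_add tendsto_const ratio' inv_m filterlim_compose[OF wallis_central_binomial m_top]) simp
    moreover have "((real ((2 * m h) choose m h) / 4 ^ m h)\<^sup>2 * real (2 * m h + 1)) *
        ((real (l h))\<^sup>2 / real (m h) / (2 + 1 / real (m h))) = (real (l h) / 4 ^ m h * real ((2 * m h) choose (m h)))\<^sup>2" for h
    proof -
      have "((b / P)\<^sup>2 * (2 * M + 1)) * (l\<^sup>2 / M / (2 + 1 / M)) = (l / P * b)\<^sup>2" if "M > 0" "P > 0" for b P M l :: real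
      proof -
        have "2 + 1 / M = (2 * M + 1) / M" using that by (simp add: field_simps)
        moreover have "2 * M + 1 > 0" using that by simp
        ultimately show ?thesis using that by (simp add: power_divide power_mult_distrib)
      qed
      from this[OF m_pos[of h], of "4 ^ m h" "real ((2 * m h) choose m h)" "real (l h)"]
      have "(real ((2 * m h) choose m h) / 4 ^ m h)\<^sup>2 * (2 * real (m h) + 1) *
        ((real (l h))\<^sup>2 / real (m h) / (2 + 1 / real (m h))) = (real (l h) / 4 ^ m h * real ((2 * m h) choose (m h)))\<^sup>2"
        by simp
      moreover have "real (2 * m h + 1) = 2 * real (m h) + 1" by simp
      ultimately show ?thesis by (simp only:)
    qed
    moreover have "(2 / pi) * (s / (2 + 0)) = s / pi" by simp
    ultimately have "(\<lambda>h. (real (l h) / 4 ^ m h * real ((2 * m h) choose (m h)))\<^sup>2) \<longlonglongrightarrow> s / pi"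
      by (simp only:)
    from tendsto_real_sqrt[OF this] show ?thesis by simp
  qed
  have "(\<lambda>h. (real (l h) / 4 ^ m h * real ((2 * m h) choose (m h))) * (1 + 2 * (\<Sum>j<m h. R j h))) \<longlonglongrightarrow>
      sqrt (s / pi) * (1 + 2 * (\<Sum>j. exp (- s * (real (Suc j))\<^sup>2)))"
    by (intro tendsto_intros central sumR)
  moreover have "(real (l h) / 4 ^ m h * real ((2 * m h) choose (m h))) * (1 + 2 * (\<Sum>j<m h. R j h)) =
     1 + 2 * (\<Sum>j<h. cos (pi * real (Suc j) / real (l h)) ^ (2 * m h))" for h
  proof -
    have "real ((2 * m h) choose (m h)) * (1 + 2 * (\<Sum>j<m h. R j h)) =
       real ((2 * m h) choose (m h)) + 2 * (\<Sum>j<m h. real ((2 * m h) choose (m h + l h * Suc j)))"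
      using cpos[of "m h"] by (simp add: R_def distrib_left sum_distrib_left)
    then show ?thesis unfolding l_def cos_power_sum by (simp only: mult.assoc)
  qed
  ultimately have "(\<lambda>h. 1 + 2 * (\<Sum>j<h. cos (pi * real (Suc j) / real (l h)) ^ (2 * m h))) \<longlonglongrightarrow>
      sqrt (s / pi) * (1 + 2 * (\<Sum>j. exp (- s * (real (Suc j))\<^sup>2)))"
    by (simp only:)
  then show ?thesis using left LIMSEQ_unique by blast
qed

section \<open>Theta as a power series and its inversion formula\<close>

lemma gap_series_summable:
  fixes x :: complex
  assumes "norm x < 1" "\<And>k. k \<le> e k"
  shows "summable (\<lambda>k. norm (x ^ e k))"
proof (rule summable_comparison_test)
  show "\<exists>N. \<forall>n\<ge>N. norm (norm (x ^ e n)) \<le> norm x ^ n"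
    using assms by (intro exI[of _ 0]) (auto simp: norm_power intro!: power_decreasing)
  show "summable (\<lambda>n. norm x ^ n)" using assms(1) by (intro summable_geometric) simp
qed

lemma gap_series_holomorphic:
  assumes "\<And>k. k \<le> e k"
  shows "(\<lambda>x::complex. \<Sum>k. x ^ e k) holomorphic_on ball 0 1"
proof (rule holomorphic_uniform_sequence[of _ "\<lambda>n x. \<Sum>k<n. x ^ e k"])
  fix x :: complex assume "x \<in> ball 0 1"
  then have x: "norm x < 1" by simp
  define d where "d = (1 - norm x) / 2"
  have d: "d > 0" "norm x + d < 1" using x by (simp_all add: d_def field_simps)
  have le: "norm y \<le> norm x + d" if "y \<in> cball x d" for y
    using that norm_triangle_ineq4[of x "x - y"] by (simp add: dist_norm)
  have "uniform_limit (cball x d) (\<lambda>n x. \<Sum>k<n. x ^ e k) (\<lambda>x. \<Sum>k. x ^ e k) sequentially"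
  proof (rule Weierstrass_m_test)
    fix n y assume y: "y \<in> cball x d"
    have "norm (y ^ e n) \<le> (norm x + d) ^ e n" unfolding norm_power by (intro power_mono le y norm_ge_zero)
    also have "\<dots> \<le> (norm x + d) ^ n" using d assms[of n] by (intro power_decreasing) auto
    finally show "norm (y ^ e n) \<le> (norm x + d) ^ n" .
  next
    show "summable (\<lambda>n. (norm x + d) ^ n)" using d by (intro summable_geometric) simp
  qed
  moreover have "cball x d \<subseteq> ball 0 1" using le d by fastforce
  ultimately show "\<exists>d>0. cball x d \<subseteq> ball 0 1 \<and> uniform_limit (cball x d) (\<lambda>n x. \<Sum>k<n. x ^ e k) (\<lambda>x. \<Sum>k. x ^ e k) sequentially"
    using d(1) by blast
qed (auto intro!: holomorphic_intros)

text \<open>The exponents are twice the triangular numbers.\<close>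
definition triangular_series :: "complex \<Rightarrow> complex" where
  "triangular_series y = (\<Sum>j. y ^ (j\<^sup>2 + j))"

lemma theta_series_holomorphic: "theta_series holomorphic_on ball 0 1"
  unfolding theta_series_def[abs_def]
  by (intro holomorphic_intros gap_series_holomorphic) (simp add: power2_eq_square)

lemma triangular_series_holomorphic: "triangular_series holomorphic_on ball 0 1"
  unfolding triangular_series_def[abs_def]
  by (intro holomorphic_intros gap_series_holomorphic) simp

lemma suminf_even_odd:
  fixes g :: "nat \<Rightarrow> complex"
  assumes "summable g" "summable (\<lambda>k. g (2 * k))" "summable (\<lambda>k. g (2 * k + 1))"
  shows "suminf g = (\<Sum>k. g (2 * k)) + (\<Sum>k. g (2 * k + 1))"
proof (rule LIMSEQ_unique)
  have "filterlim (\<lambda>n::nat. 2 * n) sequentially sequentially"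
    by (rule filterlim_subseq) (auto simp: strict_mono_def)
  from filterlim_compose[OF summable_LIMSEQ[OF assms(1)] this]
  show "(\<lambda>n. \<Sum>i<2*n. g i) \<longlonglongrightarrow> suminf g" .
  have "(\<Sum>i<2*n. g i) = (\<Sum>i<n. g (2 * i)) + (\<Sum>i<n. g (2 * i + 1))" for n
    by (induction n) simp_all
  then show "(\<lambda>n. \<Sum>i<2*n. g i) \<longlonglongrightarrow> (\<Sum>k. g (2 * k)) + (\<Sum>k. g (2 * k + 1))"
    using tendsto_add[OF summable_LIMSEQ[OF assms(2)] summable_LIMSEQ[OF assms(3)]] by simp
qed

text \<open>Even and odd \<open>n\<close> in the sum of \<open>x^(n^2)\<close>: \<open>(2k)^2 = 4 k^2\<close> and \<open>(2k + 1)^2 = 4 (k^2 + k) + 1\<close>.\<close>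
lemma theta_series_split:
  assumes "norm x < 1"
  shows "theta_series x = theta_series (x ^ 4) + 2 * x * triangular_series (x ^ 4)"
proof -
  have x4: "norm (x ^ 4) < 1" using assms by (simp add: norm_power power_less_one_iff)
  have full: "theta_series y = 2 * (\<Sum>j. y ^ (j\<^sup>2)) - 1" if "norm y < 1" for y
  proof -
    have "summable (\<lambda>j. y ^ (j\<^sup>2))"
      using summable_norm_cancel[OF gap_series_summable[OF that, of "\<lambda>j. j\<^sup>2"]] by (simp add: power2_eq_square)
    from suminf_split_head[OF this] show ?thesis by (simp add: theta_series_def)
  qed
  have even: "x ^ ((2 * k)\<^sup>2) = (x ^ 4) ^ (k\<^sup>2)" for k
    by (simp add: power_mult[symmetric] power_mult_distrib)
  have "(2 * k + 1)\<^sup>2 = 1 + 4 * (k\<^sup>2 + k)" for k :: nat by (simp add: power2_eq_square)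
  then have odd: "x ^ ((2 * k + 1)\<^sup>2) = x * (x ^ 4) ^ (k\<^sup>2 + k)" for k
    by (simp only: power_add power_mult power_one_right)
  have s: "summable (\<lambda>j. x ^ (j\<^sup>2))" "summable (\<lambda>j. (x ^ 4) ^ (j\<^sup>2))" "summable (\<lambda>j. (x ^ 4) ^ (j\<^sup>2 + j))"
    using summable_norm_cancel[OF gap_series_summable[OF assms, of "\<lambda>j. j\<^sup>2"]]
      summable_norm_cancel[OF gap_series_summable[OF x4, of "\<lambda>j. j\<^sup>2"]]
      summable_norm_cancel[OF gap_series_summable[OF x4, of "\<lambda>j. j\<^sup>2 + j"]]
    by (simp_all add: power2_eq_square)
  have "(\<Sum>j. x ^ (j\<^sup>2)) = (\<Sum>k. (x ^ 4) ^ (k\<^sup>2)) + (\<Sum>k. x * (x ^ 4) ^ (k\<^sup>2 + k))"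
    using suminf_even_odd[of "\<lambda>j. x ^ (j\<^sup>2)"] s summable_mult[OF s(3), of x] unfolding even odd by simp
  also have "(\<Sum>k. x * (x ^ 4) ^ (k\<^sup>2 + k)) = x * triangular_series (x ^ 4)"
    unfolding triangular_series_def by (rule suminf_mult[OF s(3)])
  finally show ?thesis unfolding full[OF assms] full[OF x4] by simp
qed

lemma q_pow_mult: "q_pow r \<tau> ^ n = q_pow (of_nat n * r) \<tau>"
  by (simp add: q_pow_def exp_of_nat_mult[symmetric] algebra_simps)

lemma q_pow_add: "q_pow r \<tau> * q_pow s \<tau> = q_pow (r + s) \<tau>"
  by (simp add: q_pow_def exp_add[symmetric] algebra_simps)

lemma q_pow_nonzero [simp]: "q_pow r \<tau> \<noteq> 0"
  by (simp add: q_pow_def)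

lemma norm_q_pow: "norm (q_pow r \<tau>) = exp (- (2 * pi * r * Im \<tau>))"
  by (simp add: q_pow_def)

lemma norm_q_pow_less: "r > 0 \<Longrightarrow> Im \<tau> > 0 \<Longrightarrow> norm (q_pow r \<tau>) < 1"
  by (simp add: norm_q_pow)

lemma q_pow_holomorphic [holomorphic_intros]: "q_pow r holomorphic_on S"
  unfolding q_pow_def[abs_def] by (intro holomorphic_intros)

lemma theta_eq_theta_series:
  assumes "Im \<tau> > 0"
  shows "theta \<tau> = theta_series (q_pow 1 \<tau>)"
proof -
  define q where "q = q_pow 1 \<tau>"
  have q: "norm q < 1" using assms by (simp add: q_def norm_q_pow_less)
  let ?f = "\<lambda>n::int. q_pow (of_int (n\<^sup>2)) \<tau>"
  have f1: "?f (int k) = q ^ (k\<^sup>2)" for k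
    unfolding q_def q_pow_mult by simp
  have f2: "?f (- int (Suc k)) = q ^ ((Suc k)\<^sup>2)" for k
    unfolding power2_minus q_def q_pow_mult by simp
  have sumn: "summable (\<lambda>k. norm (q ^ (k\<^sup>2)))"
    by (rule gap_series_summable[OF q]) (simp add: power2_eq_square)
  have sumn': "summable (\<lambda>k. norm (q ^ ((Suc k)\<^sup>2)))"
    by (rule gap_series_summable[OF q]) (simp add: power2_eq_square)
  have h1: "(?f has_sum (\<Sum>k. q ^ (k\<^sup>2))) (range int)"
  proof -
    have "((\<lambda>k. q ^ (k\<^sup>2)) has_sum (\<Sum>k. q ^ (k\<^sup>2))) UNIV"
      by (rule norm_summable_imp_has_sum[OF sumn summable_sums[OF summable_norm_cancel[OF sumn]]])
    then have "((?f \<circ> int) has_sum (\<Sum>k. q ^ (k\<^sup>2))) UNIV" by (simp only: o_def f1)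
    then show ?thesis by (subst has_sum_reindex) simp_all
  qed
  have h2: "(?f has_sum (\<Sum>k. q ^ ((Suc k)\<^sup>2))) (range (\<lambda>k. - int (Suc k)))"
  proof -
    have "((\<lambda>k. q ^ ((Suc k)\<^sup>2)) has_sum (\<Sum>k. q ^ ((Suc k)\<^sup>2))) UNIV"
      by (rule norm_summable_imp_has_sum[OF sumn' summable_sums[OF summable_norm_cancel[OF sumn']]])
    then have "((?f \<circ> (\<lambda>k. - int (Suc k))) has_sum (\<Sum>k. q ^ ((Suc k)\<^sup>2))) UNIV" by (simp only: o_def f2)
    moreover have "inj (\<lambda>k. - int (Suc k))" by (rule injI) simp
    ultimately show ?thesis by (subst has_sum_reindex) simp_all
  qed
  have "range int \<inter> range (\<lambda>k. - int (Suc k)) = {}" by auto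
  from has_sum_Un_disjoint[OF h1 h2 this]
  have "(?f has_sum ((\<Sum>k. q ^ (k\<^sup>2)) + (\<Sum>k. q ^ ((Suc k)\<^sup>2)))) (range int \<union> range (\<lambda>k. - int (Suc k)))" .
  moreover have "range int \<union> range (\<lambda>k. - int (Suc k)) = UNIV"
  proof -
    have "n \<in> range int \<union> range (\<lambda>k. - int (Suc k))" for n
      by (cases n) auto
    then show ?thesis by blast
  qed
  ultimately have "theta \<tau> = (\<Sum>k. q ^ (k\<^sup>2)) + (\<Sum>k. q ^ ((Suc k)\<^sup>2))"
    unfolding theta_def by (simp add: infsumI)
  also have "(\<Sum>k. q ^ (k\<^sup>2)) = 1 + (\<Sum>k. q ^ ((Suc k)\<^sup>2))"
    using suminf_split_head[OF summable_norm_cancel[OF sumn]] by simp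
  finally show ?thesis by (simp add: theta_series_def q_def)
qed

lemma holomorphic_comp_q_pow:
  assumes "f holomorphic_on ball 0 1" "r > 0"
  shows "(\<lambda>\<tau>. f (q_pow r \<tau>)) holomorphic_on upper_half_plane"
  by (rule holomorphic_on_compose_gen[unfolded o_def, OF q_pow_holomorphic assms(1)])
     (use assms(2) in \<open>auto simp: upper_half_plane_def norm_q_pow_less\<close>)

lemma theta_holomorphic: "theta holomorphic_on upper_half_plane"
  by (rule holomorphic_transform[OF holomorphic_comp_q_pow[OF theta_series_holomorphic, of 1]])
     (auto simp: theta_eq_theta_series upper_half_plane_def)

lemma open_upper_half_plane: "open upper_half_plane"
  unfolding upper_half_plane_def by (rule open_halfspace_Im_gt)

lemma connected_upper_half_plane: "connected upper_half_plane"
  unfolding upper_half_plane_def by (rule convex_connected[OF convex_halfspace_Im_gt])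

lemma Im_neg_inverse: "Im (- 1 / z) = Im z / (cmod z)\<^sup>2"
  by (simp add: Im_divide cmod_power2)

lemma Im_neg_inverse_pos: "Im z > 0 \<Longrightarrow> Im (- 1 / z) > 0"
  unfolding Im_neg_inverse by (rule divide_pos_pos) auto

text \<open>Both sides are holomorphic in the upper half plane, and on the imaginary axis the formula is the inversion of Gaussian sums; the identity theorem does the rest.\<close>
theorem theta_inversion:
  assumes "Im \<tau> > 0"
  shows "theta (- 1 / (4 * \<tau>)) = csqrt (- 2 * \<i> * \<tau>) * theta \<tau>"
proof -
  let ?f = "\<lambda>\<tau>. theta (- 1 / (4 * \<tau>)) - csqrt (- 2 * \<i> * \<tau>) * theta \<tau>"
  have im: "Im (- 1 / (4 * \<tau>)) > 0" if "Im \<tau> > 0" for \<tau>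
    using that by (intro Im_neg_inverse_pos) simp
  have "?f \<tau> = 0"
  proof (rule analytic_continuation[of ?f upper_half_plane "(\<lambda>t. \<i> * of_real t) ` {0<..}" \<i>])
    have "(\<lambda>\<tau>. - 1 / (4 * \<tau>)) holomorphic_on upper_half_plane"
      by (intro holomorphic_intros) (auto simp: upper_half_plane_def)
    moreover have "(\<lambda>\<tau>. - 1 / (4 * \<tau>)) ` upper_half_plane \<subseteq> upper_half_plane"
      using im by (auto simp only: upper_half_plane_def)
    ultimately have "(\<lambda>\<tau>. theta (- 1 / (4 * \<tau>))) holomorphic_on upper_half_plane"
      by (rule holomorphic_on_compose_gen[unfolded o_def, OF _ theta_holomorphic])
    moreover have "- 2 * \<i> * \<tau> \<notin> \<real>\<^sub>\<le>\<^sub>0" if "\<tau> \<in> upper_half_plane" for \<tau>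
      using that by (auto simp: upper_half_plane_def complex_nonpos_Reals_iff)
    ultimately show "?f holomorphic_on upper_half_plane"
      by (intro holomorphic_intros theta_holomorphic) auto
    show "\<i> islimpt (\<lambda>t. \<i> * of_real t) ` {0<..}"
      unfolding islimpt_approachable
    proof (intro allI impI)
      fix e :: real assume "e > 0"
      then have "\<i> * of_real (1 + e / 2) \<in> (\<lambda>t. \<i> * complex_of_real t) ` {0<..}"
        by (intro imageI) simp
      moreover have "\<i> * of_real (1 + e / 2) \<noteq> \<i>" "dist (\<i> * of_real (1 + e / 2)) \<i> < e"
        using \<open>e > 0\<close> by (auto simp: dist_norm algebra_simps norm_mult)
      ultimately show "\<exists>x'\<in>(\<lambda>t. \<i> * complex_of_real t) ` {0<..}. x' \<noteq> \<i> \<and> dist x' \<i> < e"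
        by blast
    qed
    fix z assume "z \<in> (\<lambda>t. \<i> * complex_of_real t) ` {0<..}"
    then obtain t where t: "t > 0" "z = \<i> * of_real t" by auto
    define s where "s = 2 * pi * t"
    have s: "s > 0" using t by (simp add: s_def)
    have series: "theta_series (of_real (exp (- c))) = of_real (1 + 2 * (\<Sum>j. exp (- c * (real (Suc j))\<^sup>2)))"
      if "c > 0" for c
    proof -
      have "complex_of_real (exp (- c)) ^ ((Suc j)\<^sup>2) = of_real (exp (- c * (real (Suc j))\<^sup>2))" for j
        by (simp only: of_real_power[symmetric] exp_of_nat_mult[symmetric] of_nat_power mult.commute)
      then have "theta_series (of_real (exp (- c))) = 1 + 2 * (\<Sum>j. of_real (exp (- c * (real (Suc j))\<^sup>2)))"
        by (simp only: theta_series_def)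
      then show ?thesis
        by (simp only: of_real_add of_real_mult of_real_1 of_real_numeral suminf_of_real[OF summable_gaussian[OF that]])
    qed
    have q1: "q_pow 1 z = of_real (exp (- s))"
    proof -
      have "q_pow 1 z = exp (of_real (- s))"
        unfolding q_pow_def by (rule arg_cong[of _ _ exp]) (simp add: t s_def algebra_simps)
      then show ?thesis by (simp only: exp_of_real)
    qed
    have q2: "q_pow 1 (- 1 / (4 * z)) = of_real (exp (- (pi\<^sup>2 / s)))"
    proof -
      have "q_pow 1 (- 1 / (4 * z)) = exp (of_real (- (pi\<^sup>2 / s)))"
        unfolding q_pow_def by (rule arg_cong[of _ _ exp]) (use t in \<open>simp add: s_def field_simps power2_eq_square\<close>)
      then show ?thesis by (simp only: exp_of_real)
    qed
    have "Im z > 0" using t by simp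
    have "theta (- 1 / (4 * z)) = of_real (1 + 2 * (\<Sum>j. exp (- (pi\<^sup>2 / s) * (real (Suc j))\<^sup>2)))"
      using theta_eq_theta_series[OF im[OF \<open>Im z > 0\<close>]] series[of "pi\<^sup>2 / s"] s by (simp only: q2) simp
    also have "\<dots> = of_real (sqrt (s / pi)) * of_real (1 + 2 * (\<Sum>j. exp (- s * (real (Suc j))\<^sup>2)))"
      unfolding gaussian_sum_inversion[OF s] by (rule of_real_mult)
    also have "of_real (1 + 2 * (\<Sum>j. exp (- s * (real (Suc j))\<^sup>2))) = theta z"
      using theta_eq_theta_series[OF \<open>Im z > 0\<close>] series[OF s] by (simp only: q1)
    also have "of_real (sqrt (s / pi)) = csqrt (- 2 * \<i> * z)"
    proof -
      have "- 2 * \<i> * z = of_real (s / pi)" by (simp add: t s_def algebra_simps)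
      moreover have "0 \<le> s / pi" using s by simp
      ultimately show ?thesis by (simp only: csqrt_of_real_nonneg[of "of_real (s/pi)"] Re_complex_of_real Im_complex_of_real csqrt_of_real)
    qed
    finally show "?f z = 0" by simp
  qed (use assms open_upper_half_plane connected_upper_half_plane in \<open>auto simp: upper_half_plane_def\<close>)
  then show ?thesis by simp
qed

section \<open>The even and odd parts of theta, and eta quotients\<close>

text \<open>With \<open>x = q^(1/4)\<close>, the function \<open>\<theta>(\<tau>/4)\<close> is the sum of \<open>x^(n^2)\<close>; its terms with even \<open>n\<close> form \<open>\<theta>(\<tau>)\<close>, those with odd \<open>n\<close> the function \<open>theta_odd\<close>.\<close>
definition theta_even :: "complex \<Rightarrow> complex" where
  "theta_even \<tau> = theta \<tau>"

definition theta_odd :: "complex \<Rightarrow> complex" where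
  "theta_odd \<tau> = theta (\<tau> / 4) - theta \<tau>"

text \<open>The local parameter of \<open>\<Gamma>(4)\<close> at infinity.\<close>
abbreviation "local_param \<equiv> q_pow (1/4)"

lemma q_pow_4: "q_pow 1 \<tau> = local_param \<tau> ^ 4"
  by (simp add: q_pow_mult)

lemma q_pow_scale: "q_pow r (\<tau> * of_real s) = q_pow (r * s) \<tau>"
  by (simp add: q_pow_def mult_ac)

context
  fixes \<tau> :: complex
  assumes im: "Im \<tau> > 0"
begin

lemma local_param_less: "norm (local_param \<tau>) < 1"
  using im by (simp add: norm_q_pow_less)

lemma theta_even_series: "theta_even \<tau> = theta_series (local_param \<tau> ^ 4)"
  using theta_eq_theta_series[OF im] by (simp only: theta_even_def q_pow_4)

lemma theta_quarter_series: "theta (\<tau> / 4) = theta_series (local_param \<tau>)"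
proof -
  have "q_pow 1 (\<tau> / 4) = local_param \<tau>" using q_pow_scale[of 1 \<tau> "1/4"] by simp
  then show ?thesis using theta_eq_theta_series[of "\<tau> / 4"] im by simp
qed

lemma theta_odd_series: "theta_odd \<tau> = 2 * local_param \<tau> * triangular_series (local_param \<tau> ^ 4)"
  using theta_series_split[OF local_param_less]
  unfolding theta_odd_def theta_quarter_series
  unfolding theta_even_def[symmetric] theta_even_series[symmetric] by simp

text \<open>The odd part is \<open>x\<close> times a power series in \<open>x^4\<close>, the even part is a power series in \<open>x^4\<close>. Hence the four functions \<open>A + i^j B\<close> are values of \<open>theta_series\<close>.\<close>
lemma theta_series_unit_mult:
  assumes "u ^ 4 = 1"
  shows "theta_series (u * local_param \<tau>) = theta_even \<tau> + u * theta_odd \<tau>"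
proof -
  have "norm u ^ 4 = 1" using assms by (metis norm_one norm_power)
  then have "norm u = 1" by (metis norm_ge_zero power_eq_1_iff zero_neq_numeral real_norm_def abs_norm_cancel)
  then have "norm (u * local_param \<tau>) < 1" using local_param_less by (simp add: norm_mult)
  from theta_series_split[OF this] show ?thesis
    using assms by (simp add: theta_odd_series theta_even_series power_mult_distrib)
qed

end

lemma theta_series_product:
  assumes "norm y < 1"
  shows "theta_series y = euler_prod (- y) ^ 2 / euler_prod (y\<^sup>2)"
  using gauss_theta_product[of "- y"] assms by simp

lemma theta_series_nonzero:
  assumes "norm y < 1"
  shows "theta_series y \<noteq> 0"
  using assms by (simp add: theta_series_product euler_prod_nonzero norm_power power_less_one_iff)

lemma triangular_series_product:
  assumes "norm y < 1"
  shows "triangular_series y = euler_prod (y ^ 4) ^ 2 / euler_prod (y\<^sup>2)"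
proof (cases "y = 0")
  case True
  have "(\<Sum>j. (0::complex) ^ (j\<^sup>2 + j)) = (\<Sum>j\<in>{0}. 0 ^ (j\<^sup>2 + j))"
    by (rule suminf_finite) auto
  then show ?thesis using True by (simp add: triangular_series_def euler_prod_def)
next
  case False
  then show ?thesis using gauss_triangular_product[OF assms] by (simp add: triangular_series_def)
qed

lemma triangular_series_nonzero:
  assumes "norm y < 1"
  shows "triangular_series y \<noteq> 0"
  using assms by (simp add: triangular_series_product euler_prod_nonzero norm_power power_less_one_iff)

text \<open>The product formula for the triangular series shows that there are no zeros.\<close>
lemma theta_odd_nonzero: "Im \<tau> > 0 \<Longrightarrow> theta_odd \<tau> \<noteq> 0"
  using local_param_less[of \<tau>]
  by (simp add: theta_odd_series triangular_series_nonzero norm_power power_less_one_iff)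

lemma theta_even_holomorphic: "theta_even holomorphic_on upper_half_plane"
  unfolding theta_even_def[abs_def] by (rule theta_holomorphic)

lemma theta_odd_holomorphic: "theta_odd holomorphic_on upper_half_plane"
proof -
  have "(\<lambda>\<tau>. theta (\<tau> / 4)) holomorphic_on upper_half_plane"
    by (rule holomorphic_on_compose_gen[unfolded o_def, OF _ theta_holomorphic])
       (auto simp: upper_half_plane_def intro!: holomorphic_intros)
  then show ?thesis unfolding theta_odd_def[abs_def] by (intro holomorphic_intros theta_holomorphic)
qed

lemma local_param_shift: "local_param (\<tau> + 1) = \<i> * local_param \<tau>"
proof -
  have "local_param (\<tau> + 1) = exp (\<i> * of_real (pi / 2)) * local_param \<tau>"
    unfolding q_pow_def exp_add[symmetric] by (rule arg_cong[of _ _ exp]) (simp add: field_simps)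
  also have "exp (\<i> * of_real (pi / 2)) = \<i>" by (simp only: cis_conv_exp[symmetric] cis_pi_half)
  finally show ?thesis .
qed

lemma theta_even_shift: "Im \<tau> > 0 \<Longrightarrow> theta_even (\<tau> + 1) = theta_even \<tau>"
  by (simp add: theta_even_series local_param_shift power_mult_distrib)

lemma theta_odd_shift: "Im \<tau> > 0 \<Longrightarrow> theta_odd (\<tau> + 1) = \<i> * theta_odd \<tau>"
  by (simp add: theta_odd_series local_param_shift power_mult_distrib)

lemma theta_even_shift_back: "Im \<tau> > 0 \<Longrightarrow> theta_even (\<tau> - 1) = theta_even \<tau>"
  using theta_even_shift[of "\<tau> - 1"] by simp

lemma theta_odd_shift_back: "Im \<tau> > 0 \<Longrightarrow> theta_odd (\<tau> - 1) = - \<i> * theta_odd \<tau>"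
  using theta_odd_shift[of "\<tau> - 1"] by (simp add: mult.assoc[symmetric])

lemma csqrt_4_mult: "csqrt (4 * z) = 2 * csqrt z"
proof (rule csqrt_unique)
  show "(2 * csqrt z)\<^sup>2 = 4 * z" by (simp add: power_mult_distrib)
  show "0 < Re (2 * csqrt z) \<or> Re (2 * csqrt z) = 0 \<and> 0 \<le> Im (2 * csqrt z)"
    using csqrt_principal[of z] by auto
qed

lemma theta_even_inversion:
  assumes "Im \<tau> > 0"
  shows "theta_even (- 1 / \<tau>) = csqrt (- \<i> * \<tau> / 2) * (theta_even \<tau> + theta_odd \<tau>)"
  using theta_inversion[of "\<tau> / 4"] assms by (simp add: theta_even_def theta_odd_def)

text \<open>Inversion interchanges \<open>\<theta>(\<tau>)\<close> and \<open>\<theta>(\<tau>/4)\<close> up to factors, which amounts to \<open>(A, B) \<mapsto> (A + B, A - B)\<close>.\<close>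
lemma theta_odd_inversion:
  assumes "Im \<tau> > 0"
  shows "theta_odd (- 1 / \<tau>) = csqrt (- \<i> * \<tau> / 2) * (theta_even \<tau> - theta_odd \<tau>)"
proof -
  have "theta_odd (- 1 / \<tau>) = theta (- 1 / (4 * \<tau>)) - theta_even (- 1 / \<tau>)"
    by (simp add: theta_odd_def theta_even_def mult.commute)
  also have "theta (- 1 / (4 * \<tau>)) = csqrt (- 2 * \<i> * \<tau>) * theta_even \<tau>"
    using theta_inversion[OF assms] by (simp add: theta_even_def)
  also have "csqrt (- 2 * \<i> * \<tau>) = 2 * csqrt (- \<i> * \<tau> / 2)"
  proof -
    have "- 2 * \<i> * \<tau> = 4 * (- \<i> * \<tau> / 2)" by simp
    then show ?thesis by (simp only: csqrt_4_mult)
  qed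
  finally show ?thesis unfolding theta_even_inversion[OF assms] by (simp add: algebra_simps)
qed

lemma dedekind_eta_eq: "dedekind_eta \<tau> = q_pow (1/24) \<tau> * euler_prod (q_pow 1 \<tau>)"
proof -
  have "q_pow (of_nat (Suc n)) \<tau> = q_pow 1 \<tau> ^ Suc n" for n
    unfolding q_pow_mult by simp
  then show ?thesis by (simp only: dedekind_eta_def euler_prod_def)
qed

lemma dedekind_eta_nonzero: "Im \<tau> > 0 \<Longrightarrow> dedekind_eta \<tau> \<noteq> 0"
  by (simp add: dedekind_eta_eq euler_prod_nonzero norm_q_pow_less)

lemma eta_flat_half:
  assumes "Im \<tau> > 0"
  shows "eta_flat (\<tau> / 2) = theta_even \<tau> - theta_odd \<tau>"
proof -
  have n: "norm (local_param \<tau>) < 1" "norm (local_param \<tau> ^ 2) < 1"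
    using local_param_less[OF assms] by (simp_all add: norm_power power_less_one_iff)
  have e4: "dedekind_eta (\<tau> / 2 / 2) = q_pow (1/96) \<tau> * euler_prod (local_param \<tau>)"
    using q_pow_scale[of "1/24" \<tau> "1/4"] q_pow_scale[of 1 \<tau> "1/4"] by (simp add: dedekind_eta_eq)
  have e2: "dedekind_eta (\<tau> / 2) = q_pow (1/96) \<tau> ^ 2 * euler_prod (local_param \<tau> ^ 2)"
    using q_pow_scale[of "1/24" \<tau> "1/2"] q_pow_scale[of 1 \<tau> "1/2"] by (simp add: dedekind_eta_eq q_pow_mult)
  have "eta_flat (\<tau> / 2) = euler_prod (local_param \<tau>) ^ 2 / euler_prod (local_param \<tau> ^ 2)"
    unfolding eta_flat_def e4 e2 by (simp add: power_mult_distrib)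
  also have "\<dots> = theta_series (- local_param \<tau>)"
    using gauss_theta_product[OF n(1)] by simp
  also have "\<dots> = theta_even \<tau> - theta_odd \<tau>"
    using theta_series_unit_mult[OF assms, of "-1"] by simp
  finally show ?thesis .
qed

lemma eta_sharp_double:
  assumes "Im \<tau> > 0"
  shows "eta_sharp (2 * \<tau>) = theta_odd \<tau> / 2"
proof -
  have n: "norm (local_param \<tau> ^ 4) < 1"
    using local_param_less[OF assms] by (simp_all add: norm_power power_less_one_iff)
  have e4: "dedekind_eta (2 * (2 * \<tau>)) = q_pow (1/6) \<tau> * euler_prod ((local_param \<tau> ^ 4) ^ 4)"
    using q_pow_scale[of "1/24" \<tau> 4] q_pow_scale[of 1 \<tau> 4]
    by (simp add: dedekind_eta_eq q_pow_mult mult.commute[of \<tau>])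
  have e2: "dedekind_eta (2 * \<tau>) = q_pow (1/12) \<tau> * euler_prod ((local_param \<tau> ^ 4) ^ 2)"
    using q_pow_scale[of "1/24" \<tau> 2] q_pow_scale[of 1 \<tau> 2]
    by (simp add: dedekind_eta_eq q_pow_mult mult.commute[of \<tau>])
  have "q_pow (1/6) \<tau> ^ 2 = local_param \<tau> * q_pow (1/12) \<tau>"
    unfolding q_pow_mult q_pow_add by simp
  then have "eta_sharp (2 * \<tau>) = local_param \<tau> * (euler_prod ((local_param \<tau> ^ 4) ^ 4) ^ 2 / euler_prod ((local_param \<tau> ^ 4) ^ 2))"
    unfolding eta_sharp_def e4 e2 by (simp add: power_mult_distrib)
  then show ?thesis
    using triangular_series_product[OF n] theta_odd_series[OF assms] by simp
qed

text \<open>All factors of \<open>A B (A + B) (A - B) (A + i B) (A - i B)\<close> have product expansions, since \<open>A + i^j B\<close> is the theta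
  series at \<open>i^j x\<close>. The values of \<open>euler_prod\<close> at negative arguments are then eliminated by \<open>euler_prod_minus\<close>.\<close>
theorem dedekind_eta_power_6:
  assumes "Im \<tau> > 0"
  shows "2 * dedekind_eta \<tau> ^ 6 = theta_even \<tau> * theta_odd \<tau> * (theta_even \<tau> ^ 4 - theta_odd \<tau> ^ 4)"
proof -
  define x where "x = local_param \<tau>"
  define A where "A = theta_even \<tau>"
  define B where "B = theta_odd \<tau>"
  note P = euler_prod_nonzero
  have x: "norm x < 1" using local_param_less[OF assms] by (simp add: x_def)
  have n: "norm (x ^ k) < 1" "norm (- (x ^ k)) < 1" if "k > 0" for k
    using x that by (simp_all add: norm_power power_less_one_iff)
  have n3: "norm (\<i> * x) < 1" using x by (simp add: norm_mult)
  have plus: "A + B = euler_prod (- x) ^ 2 / euler_prod (x\<^sup>2)"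
    using theta_series_unit_mult[OF assms, of 1] theta_series_product[OF x] by (simp add: A_def B_def x_def)
  have minus: "A - B = euler_prod x ^ 2 / euler_prod (x\<^sup>2)"
    using theta_series_unit_mult[OF assms, of "-1"] theta_series_product[of "- x"] x by (simp add: A_def B_def x_def)
  have iplus: "A + \<i> * B = euler_prod (- (\<i> * x)) ^ 2 / euler_prod (- (x\<^sup>2))"
    using theta_series_unit_mult[OF assms, of \<i>] theta_series_product[OF n3] by (simp add: A_def B_def x_def power_mult_distrib)
  have iminus: "A - \<i> * B = euler_prod (\<i> * x) ^ 2 / euler_prod (- (x\<^sup>2))"
    using theta_series_unit_mult[OF assms, of "- \<i>"] theta_series_product[of "- (\<i> * x)"] n3
    by (simp add: A_def B_def x_def power_mult_distrib)
  have A: "A = euler_prod (- (x ^ 4)) ^ 2 / euler_prod (x ^ 8)"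
    using theta_even_series[OF assms] theta_series_product[of "x ^ 4"] n(1)[of 4]
    by (simp add: A_def x_def power_mult[symmetric])
  have B: "B = 2 * x * (euler_prod (x ^ 16) ^ 2 / euler_prod (x ^ 8))"
    using theta_odd_series[OF assms] triangular_series_product[of "x ^ 4"] n(1)[of 4]
    by (simp add: B_def x_def power_mult[symmetric])
  have d1: "euler_prod x * euler_prod (- x) = euler_prod (x\<^sup>2) ^ 3 / euler_prod (x ^ 4)"
    using euler_prod_minus[OF x] P[OF n(1)[of 4]] by (simp add: field_simps)
  have d2: "euler_prod (\<i> * x) * euler_prod (- (\<i> * x)) = euler_prod (- (x\<^sup>2)) ^ 3 / euler_prod (x ^ 4)"
    using euler_prod_minus[OF n3] P[OF n(1)[of 4]] by (simp add: field_simps power_mult_distrib)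
  have d3: "euler_prod (x\<^sup>2) * euler_prod (- (x\<^sup>2)) = euler_prod (x ^ 4) ^ 3 / euler_prod (x ^ 8)"
    using euler_prod_minus[OF n(1)[of 2]] P[OF n(1)[of 8]] by (simp add: field_simps power_mult[symmetric])
  have d4: "euler_prod (- (x ^ 4)) * euler_prod (x ^ 16) = euler_prod (x ^ 8) ^ 3 / euler_prod (x ^ 4)"
    using euler_prod_minus[OF n(1)[of 4]] P[OF n(1)[of 4]] by (simp add: field_simps power_mult[symmetric])
  have cancel: "a * b / c / a = b / c" if "a \<noteq> 0" for a b c :: complex using that by simp
  have cancel2: "(u ^ 3 / v)\<^sup>2 / u\<^sup>2 = u ^ 4 / v\<^sup>2" if "u \<noteq> 0" for u v :: complex
  proof -
    have "(u ^ 3)\<^sup>2 = u\<^sup>2 * u ^ 4" by (simp flip: power_mult power_add)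
    then show ?thesis unfolding power_divide by (simp only: cancel[OF power_not_zero[OF that]])
  qed
  have cancel4: "(u ^ 3 / v) ^ 4 / u ^ 4 = u ^ 8 / v ^ 4" if "u \<noteq> 0" for u v :: complex
  proof -
    have "(u ^ 3) ^ 4 = u ^ 4 * u ^ 8" by (simp flip: power_mult power_add)
    then show ?thesis unfolding power_divide by (simp only: cancel[OF power_not_zero[OF that]])
  qed
  have "A\<^sup>2 - B\<^sup>2 = (A + B) * (A - B)" by (simp add: power2_eq_square algebra_simps)
  also have "\<dots> = (euler_prod x * euler_prod (- x)) ^ 2 / euler_prod (x\<^sup>2) ^ 2"
    unfolding plus minus by (simp add: power_mult_distrib power2_eq_square)
  also have "\<dots> = euler_prod (x\<^sup>2) ^ 4 / euler_prod (x ^ 4) ^ 2"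
    unfolding d1 using P[OF n(1)[of 2]] by (intro cancel2) simp
  finally have D1: "A\<^sup>2 - B\<^sup>2 = euler_prod (x\<^sup>2) ^ 4 / euler_prod (x ^ 4) ^ 2" .
  have "A\<^sup>2 + B\<^sup>2 = (A + \<i> * B) * (A - \<i> * B)" by (simp add: power2_eq_square algebra_simps)
  also have "\<dots> = (euler_prod (\<i> * x) * euler_prod (- (\<i> * x))) ^ 2 / euler_prod (- (x\<^sup>2)) ^ 2"
    unfolding iplus iminus by (simp add: power_mult_distrib power2_eq_square)
  also have "\<dots> = euler_prod (- (x\<^sup>2)) ^ 4 / euler_prod (x ^ 4) ^ 2"
    unfolding d2 using P[OF n(2)[of 2]] by (intro cancel2) simp
  finally have D2: "A\<^sup>2 + B\<^sup>2 = euler_prod (- (x\<^sup>2)) ^ 4 / euler_prod (x ^ 4) ^ 2" .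
  have "A ^ 4 - B ^ 4 = (A\<^sup>2 - B\<^sup>2) * (A\<^sup>2 + B\<^sup>2)"
    by (simp add: power4_eq_xxxx power2_eq_square algebra_simps)
  also have "\<dots> = (euler_prod (x\<^sup>2) * euler_prod (- (x\<^sup>2))) ^ 4 / euler_prod (x ^ 4) ^ 4"
    unfolding D1 D2 by (simp add: power_mult_distrib flip: power_add)
  also have "\<dots> = euler_prod (x ^ 4) ^ 8 / euler_prod (x ^ 8) ^ 4"
    unfolding d3 using P[OF n(1)[of 4]] by (intro cancel4) simp
  finally have D3: "A ^ 4 - B ^ 4 = euler_prod (x ^ 4) ^ 8 / euler_prod (x ^ 8) ^ 4" .
  have "A * B = 2 * x * ((euler_prod (- (x ^ 4)) * euler_prod (x ^ 16)) ^ 2 / euler_prod (x ^ 8) ^ 2)"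
    unfolding A B by (simp add: power_mult_distrib power2_eq_square)
  also have "(euler_prod (- (x ^ 4)) * euler_prod (x ^ 16)) ^ 2 / euler_prod (x ^ 8) ^ 2 = euler_prod (x ^ 8) ^ 4 / euler_prod (x ^ 4) ^ 2"
    unfolding d4 using P[OF n(1)[of 8]] by (intro cancel2) simp
  finally have D4: "A * B = 2 * x * (euler_prod (x ^ 8) ^ 4 / euler_prod (x ^ 4) ^ 2)" .
  have "A * B * (A ^ 4 - B ^ 4) = 2 * x * euler_prod (x ^ 4) ^ 6"
  proof -
    have "c * (v ^ 4 / u\<^sup>2) * (u ^ 8 / v ^ 4) = c * u ^ 6" if "u \<noteq> 0" "v \<noteq> 0" for c u v :: complex
    proof -
      have eq: "u ^ 8 = u\<^sup>2 * u ^ 6" by (simp flip: power_add)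
      have g: "c * (w / a) * (a * b / w) = c * b" if "a \<noteq> 0" "w \<noteq> 0" for a b w
        using that by simp
      show ?thesis unfolding eq by (rule g) (use that in simp_all)
    qed
    then show ?thesis unfolding D3 D4 using P[OF n(1)[of 8]] P[OF n(1)[of 4]] by simp
  qed
  also have "\<dots> = 2 * dedekind_eta \<tau> ^ 6"
    unfolding dedekind_eta_eq power_mult_distrib q_pow_mult q_pow_4 x_def by simp
  finally show ?thesis by (simp add: A_def B_def)
qed

section \<open>Generation of the modular group and of \<open>\<Gamma>\<^sub>1(4)\<close>\<close>

text \<open>The matrix with rows \<open>(a, b)\<close>, \<open>(c, d)\<close> is built by multiplication from the right. The proof is Euclid's algorithm on
  the bottom row: translations decrease \<open>\<bar>d\<bar>\<close>, and if \<open>\<bar>d\<bar> < \<bar>c\<bar>\<close>, the inversion interchanges the two; the weight \<open>2\<close> on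
  \<open>\<bar>c\<bar>\<close> makes both steps decrease the measure.\<close>
lemma SL2Z_induct [consumes 1, case_names one T T_inv S]:
  fixes a b c d :: int
  assumes "a * d - b * c = 1" and one: "P 1 0 0 1"
    and T: "\<And>a b c d. a * d - b * c = 1 \<Longrightarrow> P a b c d \<Longrightarrow> P a (a + b) c (c + d)"
    and T': "\<And>a b c d. a * d - b * c = 1 \<Longrightarrow> P a b c d \<Longrightarrow> P a (b - a) c (d - c)"
    and S: "\<And>a b c d. a * d - b * c = 1 \<Longrightarrow> P a b c d \<Longrightarrow> P b (- a) d (- c)"
  shows "P a b c d"
  using assms(1)
proof (induction "nat (2 * \<bar>c\<bar> + \<bar>d\<bar>)" arbitrary: a b c d rule: less_induct)
  case less
  have trans: "P 1 n 0 1" for n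
  proof (induction n rule: int_induct[of _ 0])
    case (step1 i)
    then show ?case using T[of 1 1 i 0] by (simp add: add.commute)
  next
    case (step2 i)
    then show ?case using T'[of 1 1 i 0] by simp
  qed (rule one)
  show ?case
  proof (cases "c = 0")
    case True
    then have "a * d = 1" using less.prems by simp
    then consider "a = 1" "d = 1" | "a = -1" "d = -1" by (auto simp: zmult_eq_1_iff)
    then show ?thesis
    proof cases
      case 1
      then show ?thesis using trans True by simp
    next
      case 2
      have "P (- b) (- 1) 1 0" using S[of 1 1 "- b" 0] trans by simp
      then show ?thesis using S[of "- b" 0 "- 1" 1] 2 True by simp
    qed
  next
    case False
    show ?thesis
    proof (cases "\<bar>d\<bar> < \<bar>c\<bar>")
      case True
      then have "P (- b) a (- d) c" using less.prems by (intro less.hyps) (auto simp: algebra_simps)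
      moreover have "(- b) * c - a * (- d) = 1" using less.prems by (simp add: algebra_simps)
      ultimately show ?thesis using S[of "- b" c a "- d"] by simp
    next
      case le: False
      show ?thesis
      proof (cases "c > 0 \<longleftrightarrow> d > 0")
        case True
        have "P a (b - a) c (d - c)"
          using less.prems True le False by (intro less.hyps) (auto simp: algebra_simps)
        moreover have "a * (d - c) - (b - a) * c = 1" using less.prems by (simp add: algebra_simps)
        ultimately show ?thesis using T[of a "d - c" "b - a" c] by simp
      next
        case neq: False
        have "P a (a + b) c (c + d)"
          using less.prems neq le False by (intro less.hyps) (auto simp: algebra_simps)
        moreover have "a * (c + d) - (a + b) * c = 1" using less.prems by (simp add: algebra_simps)
        ultimately show ?thesis using T'[of a "c + d" "a + b" c] by simp
      qed
    qed
  qed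
qed

text \<open>Euclid's algorithm on the bottom row with the steps \<open>d \<plusminus> c\<close> and \<open>c \<plusminus> 4 d\<close>. As \<open>d\<close> is odd and \<open>4\<close> divides \<open>c\<close>, the
  numbers \<open>\<bar>c\<bar>\<close> and \<open>2 \<bar>d\<bar>\<close> differ: if the second is larger, the first step decreases \<open>\<bar>d\<bar>\<close>, otherwise the second one decreases \<open>\<bar>c\<bar>\<close>.\<close>
lemma Gamma1_4_induct [consumes 3, case_names transl T T_inv W W_inv]:
  fixes a b c d :: int
  assumes "a * d - b * c = 1" "4 dvd c" "d mod 4 = 1" and transl: "\<And>n. P 1 n 0 1"
    and T: "\<And>a b c d. a * d - b * c = 1 \<Longrightarrow> 4 dvd c \<Longrightarrow> d mod 4 = 1 \<Longrightarrow> P a b c d \<Longrightarrow> P a (a + b) c (c + d)"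
    and T': "\<And>a b c d. a * d - b * c = 1 \<Longrightarrow> 4 dvd c \<Longrightarrow> d mod 4 = 1 \<Longrightarrow> P a b c d \<Longrightarrow> P a (b - a) c (d - c)"
    and W: "\<And>a b c d. a * d - b * c = 1 \<Longrightarrow> 4 dvd c \<Longrightarrow> d mod 4 = 1 \<Longrightarrow> P a b c d \<Longrightarrow> P (a + 4 * b) b (c + 4 * d) d"
    and W': "\<And>a b c d. a * d - b * c = 1 \<Longrightarrow> 4 dvd c \<Longrightarrow> d mod 4 = 1 \<Longrightarrow> P a b c d \<Longrightarrow> P (a - 4 * b) b (c - 4 * d) d"
  shows "P a b c d"
  using assms(1-3)
proof (induction "nat (\<bar>c\<bar> + \<bar>d\<bar>)" arbitrary: a b c d rule: less_induct)
  case less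
  have mods: "(d - c) mod 4 = 1" "(c + d) mod 4 = 1" "4 dvd c - 4 * d" "4 dvd c + 4 * d"
    using less.prems(2,3) by presburger+
  show ?case
  proof (cases "c = 0")
    case True
    then have "a * d = 1" using less.prems by simp
    then have "a = 1 \<and> d = 1 \<or> a = -1 \<and> d = -1" by (auto simp: zmult_eq_1_iff)
    then have "a = 1 \<and> d = 1" using less.prems(3) by auto
    then show ?thesis using transl True by simp
  next
    case False
    have "\<bar>c\<bar> \<noteq> 2 * \<bar>d\<bar>"
    proof
      assume "\<bar>c\<bar> = 2 * \<bar>d\<bar>"
      then have "4 dvd 2 * d" using less.prems(2) by (metis abs_mult abs_numeral dvd_abs_iff)
      then show False using less.prems(3) by presburger
    qed
    then consider "\<bar>c\<bar> < 2 * \<bar>d\<bar>" | "2 * \<bar>d\<bar> < \<bar>c\<bar>" by linarith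
    then show ?thesis
    proof cases
      case 1
      show ?thesis
      proof (cases "c > 0 \<longleftrightarrow> d > 0")
        case True
        have "P a (b - a) c (d - c)"
          using less.prems mods True 1 False by (intro less.hyps) (auto simp: algebra_simps)
        moreover have "a * (d - c) - (b - a) * c = 1" using less.prems by (simp add: algebra_simps)
        ultimately show ?thesis using T[of a "d - c" "b - a" c] less.prems mods by simp
      next
        case neq: False
        have "P a (a + b) c (c + d)"
          using less.prems mods neq 1 False by (intro less.hyps) (auto simp: algebra_simps)
        moreover have "a * (c + d) - (a + b) * c = 1" using less.prems by (simp add: algebra_simps)
        ultimately show ?thesis using T'[of a "c + d" "a + b" c] less.prems mods by simp
      qed
    next
      case 2
      have "d \<noteq> 0" using less.prems(3) by auto
      show ?thesis
      proof (cases "c > 0 \<longleftrightarrow> d > 0")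
        case True
        have "P (a - 4 * b) b (c - 4 * d) d"
          using less.prems mods True 2 \<open>d \<noteq> 0\<close> by (intro less.hyps) (auto simp: algebra_simps)
        moreover have "(a - 4 * b) * d - b * (c - 4 * d) = 1" using less.prems by (simp add: algebra_simps)
        ultimately show ?thesis using W[of "a - 4 * b" d b "c - 4 * d"] less.prems mods by simp
      next
        case neq: False
        have "P (a + 4 * b) b (c + 4 * d) d"
          using less.prems mods neq 2 \<open>d \<noteq> 0\<close> by (intro less.hyps) (auto simp: algebra_simps)
        moreover have "(a + 4 * b) * d - b * (c + 4 * d) = 1" using less.prems by (simp add: algebra_simps)
        ultimately show ?thesis using W'[of "a + 4 * b" d b "c + 4 * d"] less.prems mods by simp
      qed
    qed
  qed
qed

section \<open>The multiplier of theta on \<open>\<Gamma>\<^sub>1(4)\<close>\<close>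

(* Square roots are handled through the quadrant in which they lie, not by their explicit formula. *)
declare csqrt.simps [simp del]

lemma csqrt_first_quadrant: "Im z > 0 \<Longrightarrow> 0 < Re (csqrt z) \<and> 0 < Im (csqrt z)"
proof -
  assume im: "Im z > 0"
  have sq: "Im z = 2 * (Re (csqrt z) * Im (csqrt z))"
    by (metis Im_power2 power2_csqrt mult.assoc)
  have "Re (csqrt z) \<ge> 0" using csqrt_principal[of z] by auto
  moreover have "Re (csqrt z) * Im (csqrt z) > 0" using sq im by linarith
  ultimately show ?thesis by (auto simp: zero_less_mult_iff)
qed

lemma csqrt_fourth_quadrant: "Im z < 0 \<Longrightarrow> 0 < Re (csqrt z) \<and> Im (csqrt z) < 0"
proof -
  assume im: "Im z < 0"
  have sq: "Im z = 2 * (Re (csqrt z) * Im (csqrt z))"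
    by (metis Im_power2 power2_csqrt mult.assoc)
  have "Re (csqrt z) \<ge> 0" using csqrt_principal[of z] by auto
  moreover have "Re (csqrt z) * Im (csqrt z) < 0" using sq im by linarith
  ultimately show ?thesis by (auto simp: mult_less_0_iff)
qed

lemma csqrt_mult_sign: "csqrt z * csqrt u = csqrt (z * u) \<or> csqrt z * csqrt u = - csqrt (z * u)"
proof -
  have "(csqrt z * csqrt u)\<^sup>2 = (csqrt (z * u))\<^sup>2" by (simp add: power_mult_distrib)
  then show ?thesis by (simp only: power2_eq_iff)
qed

lemma csqrt_mult_right_half_plane:
  assumes "Re (csqrt z * csqrt u) > 0"
  shows "csqrt z * csqrt u = csqrt (z * u)"
proof -
  have "Re (csqrt (z * u)) \<ge> 0" using csqrt_principal[of "z * u"] by auto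
  moreover have "Re (- csqrt (z * u)) = - Re (csqrt (z * u))" by (rule uminus_complex.sel)
  ultimately have "csqrt z * csqrt u \<noteq> - csqrt (z * u)" using assms by (metis neg_0_le_iff_le not_less neg_le_0_iff_le)
  then show ?thesis using csqrt_mult_sign by blast
qed

text \<open>The product of the two square roots equals \<open>\<plusminus>\<close> the square root of the product, and \<open>-\<close> occurs exactly if the
  arguments add up beyond \<open>\<pi>/2\<close>. Inspecting the quadrants, this happens for \<open>c > 0 > c + 4 d\<close>. The Kronecker symbol
  changes its sign in the same case, because then \<open>d < 0\<close> and the numerator changes sign.\<close>
lemma kronecker_csqrt_cocycle:
  fixes c d :: int
  assumes "4 dvd c" "d mod 4 = 1" "coprime c d" "Im \<tau> > 0"
  shows "of_int (kronecker c d) * (csqrt (of_int c * (\<tau> / (4 * \<tau> + 1)) + of_int d) * csqrt (4 * \<tau> + 1)) =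
    of_int (kronecker (c + 4 * d) d) * csqrt (of_int (c + 4 * d) * \<tau> + of_int d)"
proof -
  define z where "z = of_int c * (\<tau> / (4 * \<tau> + 1)) + of_int d"
  define u where "u = 4 * \<tau> + 1"
  have imu: "Im u > 0" using assms by (simp add: u_def)
  then have u0: "u \<noteq> 0" by auto
  have zu: "z * u = of_int (c + 4 * d) * \<tau> + of_int d"
    using u0 by (simp add: z_def u_def[symmetric] distrib_right) (simp add: u_def algebra_simps)
  have Im_zu: "Im (z * u) = of_int (c + 4 * d) * Im \<tau>" unfolding zu by simp
  have "Im (\<tau> / u) = Im \<tau> / (cmod u)\<^sup>2"
    unfolding u_def by (simp add: Im_divide cmod_power2) (simp add: algebra_simps)
  then have "Im (\<tau> / u) > 0" using assms u0 by simp
  moreover define t where "t = \<tau> / u"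
  ultimately have imt: "Im t > 0" by simp
  have "z = of_int c * t + of_int d" by (simp only: z_def t_def u_def)
  then have Im_z: "Im z = of_int c * Im t" by simp
  have "odd d" using assms(2) by presburger
  have co: "coprime (c + 4 * d) d" using assms(3)
    by (metis coprime_iff_gcd_eq_1 gcd.commute gcd_add_mult add.commute)
  have K: "kronecker (c + 4 * d) d = (if d < 0 \<and> (c < 0 \<longleftrightarrow> c + 4 * d \<ge> 0) then -1 else 1) * kronecker c d"
    by (rule kronecker_add_numerator[OF \<open>odd d\<close> assms(3) co]) (simp add: cong_iff_dvd_diff)
  note qu = csqrt_first_quadrant[OF imu]
  consider "c < 0" | "c = 0" | "c > 0" by linarith
  then have "csqrt z * csqrt u = (if d < 0 \<and> (c < 0 \<longleftrightarrow> c + 4 * d \<ge> 0) then -1 else 1) * csqrt (z * u)"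
  proof cases
    case 1
    then have "Im z < 0" using Im_z imt by (simp add: mult_less_0_iff)
    then have qz: "0 < Re (csqrt z)" "Im (csqrt z) < 0" using csqrt_fourth_quadrant by auto
    have "Im (csqrt z) * Im (csqrt u) < 0" "Re (csqrt z) * Re (csqrt u) > 0"
      using qz qu by (simp_all add: mult_neg_pos)
    then have "Re (csqrt z * csqrt u) > 0" unfolding times_complex.sel by linarith
    then have "csqrt z * csqrt u = csqrt (z * u)" by (rule csqrt_mult_right_half_plane)
    moreover have "\<not> (d < 0 \<and> (c < 0 \<longleftrightarrow> c + 4 * d \<ge> 0))" using 1 by auto
    ultimately show ?thesis by (simp only: if_False mult_1)
  next
    case 2
    then have "is_unit d" using assms(3) by simp
    then have "d = 1" using assms(2) by (auto simp: zdvd1_eq abs_if split: if_splits)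
    then show ?thesis using 2 by (simp add: z_def)
  next
    case 3
    then have "Im z > 0" using Im_z imt by simp
    then have qz: "0 < Re (csqrt z)" "0 < Im (csqrt z)" using csqrt_first_quadrant by auto
    then have im_prod: "Im (csqrt z * csqrt u) > 0" using qu by (simp add: add_pos_pos)
    consider "c + 4 * d > 0" | "c + 4 * d < 0" | "c + 4 * d = 0" by linarith
    then show ?thesis
    proof cases
      case 1
      then have "Im (z * u) > 0" unfolding Im_zu using assms(4) by (simp del: of_int_add of_int_mult)
      then have "Im (csqrt (z * u)) > 0" using csqrt_first_quadrant by auto
      moreover have "Im (- csqrt (z * u)) = - Im (csqrt (z * u))" by (rule uminus_complex.sel)
      ultimately have "csqrt z * csqrt u \<noteq> - csqrt (z * u)"
        using im_prod by (metis neg_0_less_iff_less less_asym)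
      then have "csqrt z * csqrt u = csqrt (z * u)" using csqrt_mult_sign by blast
      then show ?thesis using 1 3 by simp
    next
      case 2
      then have "Im (z * u) < 0" unfolding Im_zu using assms(4) by (simp add: mult_less_0_iff del: of_int_add of_int_mult)
      then have "Im (csqrt (z * u)) < 0" using csqrt_fourth_quadrant by auto
      then have "csqrt z * csqrt u \<noteq> csqrt (z * u)" using im_prod by (metis less_asym)
      then have "csqrt z * csqrt u = - csqrt (z * u)" using csqrt_mult_sign by blast
      moreover have "d < 0" using 2 3 by linarith
      ultimately show ?thesis using 2 3 by simp
    next
      case zero: 3
      then have "c = d * (- 4)" by linarith
      then have "d dvd c" by (rule dvdI)
      then have "is_unit d" using coprime_common_divisor[OF assms(3)] by simp
      then have "d = 1" using assms(2) by (auto simp: zdvd1_eq abs_if split: if_splits)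
      then show ?thesis using zero 3 by simp
    qed
  qed
  then show ?thesis
    unfolding z_def[symmetric] unfolding u_def[symmetric] zu[symmetric] K by (simp split: if_splits)
qed

lemma theta_translate: "Im \<tau> > 0 \<Longrightarrow> theta (\<tau> + 1) = theta \<tau>"
  using theta_even_shift by (simp add: theta_even_def)

lemma theta_translate_int: "Im \<tau> > 0 \<Longrightarrow> theta (\<tau> + of_int n) = theta \<tau>"
proof (induction n rule: int_induct[of _ 0])
  case (step1 i)
  then show ?case using theta_translate[of "\<tau> + of_int i"] by (simp add: add.assoc)
next
  case (step2 i)
  then show ?case using theta_translate[of "\<tau> + of_int (i - 1)"] by (simp add: algebra_simps)
qed simp

text \<open>Conjugation by \<open>\<tau> \<mapsto> -1/(4\<tau>)\<close> turns \<open>\<tau>/(4\<tau> + 1)\<close> into a translation by \<open>-1\<close>.\<close>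
lemma theta_W:
  assumes "Im \<tau> > 0"
  shows "theta (\<tau> / (4 * \<tau> + 1)) = csqrt (4 * \<tau> + 1) * theta \<tau>"
proof -
  have t0: "\<tau> \<noteq> 0" "4 * \<tau> + 1 \<noteq> 0" using assms by (auto simp: complex_eq_iff)
  define s where "s = - 1 / (4 * \<tau>)"
  have ims: "Im s > 0" unfolding s_def by (rule Im_neg_inverse_pos) (use assms in simp)
  have ims1: "Im (s - 1) > 0" using ims by simp
  then have "s - 1 \<noteq> 0" by auto
  have "- 1 / (4 * (s - 1)) = \<tau> / (4 * \<tau> + 1)"
    using t0 \<open>s - 1 \<noteq> 0\<close> by (simp add: s_def field_simps)
  then have "theta (\<tau> / (4 * \<tau> + 1)) = csqrt (- 2 * \<i> * (s - 1)) * theta (s - 1)"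
    using theta_inversion[OF ims1] by simp
  also have "theta (s - 1) = theta s" using theta_translate[OF ims1] by simp
  also have "theta s = csqrt (- 2 * \<i> * \<tau>) * theta \<tau>"
    unfolding s_def by (rule theta_inversion[OF assms])
  also have "csqrt (- 2 * \<i> * (s - 1)) * (csqrt (- 2 * \<i> * \<tau>) * theta \<tau>) =
      (csqrt (- 2 * \<i> * (s - 1)) * csqrt (- 2 * \<i> * \<tau>)) * theta \<tau>" by simp
  also have "csqrt (- 2 * \<i> * (s - 1)) * csqrt (- 2 * \<i> * \<tau>) = csqrt ((- 2 * \<i> * (s - 1)) * (- 2 * \<i> * \<tau>))"
  proof (rule csqrt_mult_right_half_plane)
    have half: "\<bar>Im (csqrt w)\<bar> < Re (csqrt w)" if "Re w > 0" for w
    proof -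
      have "Re w = (Re (csqrt w))\<^sup>2 - (Im (csqrt w))\<^sup>2"
        by (metis Re_power2 power2_csqrt)
      then have "(Im (csqrt w))\<^sup>2 < (Re (csqrt w))\<^sup>2" using that by linarith
      moreover have "Re (csqrt w) \<ge> 0" using csqrt_principal[of w] by auto
      ultimately show ?thesis by (metis abs_le_square_iff abs_of_nonneg linorder_not_less)
    qed
    have 1: "\<bar>Im (csqrt (- 2 * \<i> * (s - 1)))\<bar> < Re (csqrt (- 2 * \<i> * (s - 1)))"
      by (rule half) (use ims1 in simp)
    have 2: "\<bar>Im (csqrt (- 2 * \<i> * \<tau>))\<bar> < Re (csqrt (- 2 * \<i> * \<tau>))"
      by (rule half) (use assms in simp)
    have "\<bar>Im (csqrt (- 2 * \<i> * (s - 1))) * Im (csqrt (- 2 * \<i> * \<tau>))\<bar> < Re (csqrt (- 2 * \<i> * (s - 1))) * Re (csqrt (- 2 * \<i> * \<tau>))"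
      unfolding abs_mult using 1 2 by (intro mult_strict_mono') auto
    then show "0 < Re (csqrt (- 2 * \<i> * (s - 1)) * csqrt (- 2 * \<i> * \<tau>))" unfolding times_complex.sel by linarith
  qed
  also have "(- 2 * \<i> * (s - 1)) * (- 2 * \<i> * \<tau>) = 4 * \<tau> + 1"
    using t0 by (simp add: s_def field_simps)
  finally show ?thesis .
qed

text \<open>The action on the upper half plane, in terms of the entries of the matrix.\<close>
definition mob :: "int \<Rightarrow> int \<Rightarrow> int \<Rightarrow> int \<Rightarrow> complex \<Rightarrow> complex" where
  "mob a b c d \<tau> = (of_int a * \<tau> + of_int b) / (of_int c * \<tau> + of_int d)"

lemma cocycle_nonzero:
  fixes c d :: int
  assumes "Im \<tau> > 0" "c \<noteq> 0 \<or> d \<noteq> 0"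
  shows "of_int c * \<tau> + of_int d \<noteq> 0"
  using assms by (auto simp: complex_eq_iff)

lemma det_nonzero: "a * d - b * c = 1 \<Longrightarrow> c \<noteq> 0 \<or> d \<noteq> (0::int)" by auto

lemma det_coprime: "a * d - b * c = (1::int) \<Longrightarrow> coprime c d"
  by (rule coprimeI) (metis dvd_diff dvd_mult dvd_mult2 dvd_mult_left dvd_mult_right)

lemma Im_mob:
  assumes "Im \<tau> > 0" "a * d - b * c = 1"
  shows "Im (mob a b c d \<tau>) = Im \<tau> / (cmod (of_int c * \<tau> + of_int d))\<^sup>2"
proof -
  have det: "real_of_int a * of_int d - of_int b * of_int c = 1"
    using assms(2) by (metis of_int_1 of_int_diff of_int_mult)
  have "Im (mob a b c d \<tau>) = ((of_int a * of_int d - of_int b * of_int c) * Im \<tau>) / (cmod (of_int c * \<tau> + of_int d))\<^sup>2"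
    unfolding mob_def by (simp add: Im_divide cmod_power2) (simp add: algebra_simps)
  then show ?thesis unfolding det by simp
qed

lemma Im_mob_pos:
  assumes "Im \<tau> > 0" "a * d - b * c = 1"
  shows "Im (mob a b c d \<tau>) > 0"
  unfolding Im_mob[OF assms] using assms cocycle_nonzero[OF assms(1) det_nonzero[OF assms(2)]] by simp

lemma mob_shift: "mob a (a * n + b) c (c * n + d) \<tau> = mob a b c d (\<tau> + of_int n)"
  by (simp add: mob_def algebra_simps)

lemma mob_T: "mob a (a + b) c (c + d) \<tau> = mob a b c d (\<tau> + 1)"
  using mob_shift[of a 1 b c d \<tau>] by simp

lemma mob_T_inv: "mob a (b - a) c (d - c) \<tau> = mob a b c d (\<tau> - 1)"
  using mob_shift[of a "-1" b c d \<tau>] by simp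

lemma mob_S:
  assumes "\<tau> \<noteq> 0"
  shows "mob b (- a) d (- c) \<tau> = mob a b c d (- 1 / \<tau>)"
proof -
  have 1: "of_int a * (- 1 / \<tau>) + of_int b = (of_int b * \<tau> + of_int (- a)) / \<tau>"
    using assms by (simp add: field_simps)
  have 2: "of_int c * (- 1 / \<tau>) + of_int d = (of_int d * \<tau> + of_int (- c)) / \<tau>"
    using assms by (simp add: field_simps)
  show ?thesis unfolding mob_def 1 2 using assms by simp
qed

lemma mob_W:
  assumes "4 * \<tau> + 1 \<noteq> 0"
  shows "mob (a + 4 * b) b (c + 4 * d) d \<tau> = mob a b c d (\<tau> / (4 * \<tau> + 1))"
proof -
  have "of_int e * (\<tau> / (4 * \<tau> + 1)) + of_int f = (of_int (e + 4 * f) * \<tau> + of_int f) / (4 * \<tau> + 1)" for e f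
  proof -
    define u where "u = 4 * \<tau> + 1"
    have "of_int (e + 4 * f) * \<tau> + of_int f = of_int e * \<tau> + of_int f * u"
      by (simp add: u_def algebra_simps)
    moreover have "u \<noteq> 0" using assms by (simp add: u_def)
    ultimately show ?thesis unfolding u_def[symmetric] by (simp add: add_divide_distrib)
  qed
  then show ?thesis unfolding mob_def using assms by simp
qed

text \<open>Along the word in the two generators, the factor is multiplied as in \<open>kronecker_add_period\<close> and \<open>kronecker_csqrt_cocycle\<close>.\<close>
theorem theta_Gamma1_4:
  fixes a b c d :: int
  assumes "a * d - b * c = 1" "4 dvd c" "d mod 4 = 1" and "Im \<tau> > 0"
  shows "theta (mob a b c d \<tau>) = of_int (kronecker c d) * csqrt (of_int c * \<tau> + of_int d) * theta \<tau>"
proof -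
  let ?P = "\<lambda>a b c d. \<forall>\<tau>. Im \<tau> > 0 \<longrightarrow>
     theta (mob a b c d \<tau>) = of_int (kronecker c d) * csqrt (of_int c * \<tau> + of_int d) * theta \<tau>"
  have "?P a b c d"
    using assms(1-3)
  proof (induction a b c d rule: Gamma1_4_induct)
    case (transl n)
    show ?case by (simp add: mob_def theta_translate_int kronecker_1)
  next
    case (T a b c d)
    show ?case
    proof (intro allI impI)
      fix \<tau> :: complex assume \<tau>: "Im \<tau> > 0"
      have "theta (mob a (a + b) c (c + d) \<tau>) = of_int (kronecker c d) * csqrt (of_int c * (\<tau> + 1) + of_int d) * theta (\<tau> + 1)"
        unfolding mob_T using T \<tau> by simp
      also have "of_int c * (\<tau> + 1) + of_int d = of_int c * \<tau> + of_int (c + d)" by (simp add: algebra_simps)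
      also have "kronecker c d = kronecker c (c + d)"
        using kronecker_add_period[OF T(2,3) det_coprime[OF T(1)]] by (simp add: add.commute)
      finally show "theta (mob a (a + b) c (c + d) \<tau>) = of_int (kronecker c (c + d)) * csqrt (of_int c * \<tau> + of_int (c + d)) * theta \<tau>"
        using theta_translate[OF \<tau>] by simp
    qed
  next
    case (T_inv a b c d)
    show ?case
    proof (intro allI impI)
      fix \<tau> :: complex assume \<tau>: "Im \<tau> > 0"
      have det: "a * (d - c) - (b - a) * c = 1" using T_inv(1) by (simp add: algebra_simps)
      have "(d - c) mod 4 = 1" using T_inv(2,3) by presburger
      from kronecker_add_period[OF T_inv(2) this det_coprime[OF det]]
      have k: "kronecker c d = kronecker c (d - c)" by simp
      have "theta (mob a (b - a) c (d - c) \<tau>) = of_int (kronecker c d) * csqrt (of_int c * (\<tau> - 1) + of_int d) * theta (\<tau> - 1)"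
        unfolding mob_T_inv using T_inv(4) \<tau> by simp
      also have "of_int c * (\<tau> - 1) + of_int d = of_int c * \<tau> + of_int (d - c)" by (simp add: algebra_simps)
      also have "theta (\<tau> - 1) = theta \<tau>" using theta_translate[of "\<tau> - 1"] \<tau> by simp
      finally show "theta (mob a (b - a) c (d - c) \<tau>) = of_int (kronecker c (d - c)) * csqrt (of_int c * \<tau> + of_int (d - c)) * theta \<tau>"
        unfolding k .
    qed
  next
    case (W a b c d)
    show ?case
    proof (intro allI impI)
      fix \<tau> :: complex assume \<tau>: "Im \<tau> > 0"
      then have nz: "4 * \<tau> + 1 \<noteq> 0" by (auto simp: complex_eq_iff)
      have mW: "mob 1 0 4 1 \<tau> = \<tau> / (4 * \<tau> + 1)" by (simp add: mob_def)
      have im: "Im (\<tau> / (4 * \<tau> + 1)) > 0" using Im_mob_pos[OF \<tau>, of 1 1 0 4] by (simp add: mW)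
      have "theta (mob (a + 4 * b) b (c + 4 * d) d \<tau>) =
         of_int (kronecker c d) * csqrt (of_int c * (\<tau> / (4 * \<tau> + 1)) + of_int d) * theta (\<tau> / (4 * \<tau> + 1))"
        unfolding mob_W[OF nz] using W(4) im by blast
      also have "\<dots> = of_int (kronecker c d) * (csqrt (of_int c * (\<tau> / (4 * \<tau> + 1)) + of_int d) * csqrt (4 * \<tau> + 1)) * theta \<tau>"
        unfolding theta_W[OF \<tau>] by (simp only: mult.assoc)
      finally show "theta (mob (a + 4 * b) b (c + 4 * d) d \<tau>) =
         of_int (kronecker (c + 4 * d) d) * csqrt (of_int (c + 4 * d) * \<tau> + of_int d) * theta \<tau>"
        unfolding kronecker_csqrt_cocycle[OF W(2,3) det_coprime[OF W(1)] \<tau>] .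
    qed
  next
    case (W_inv a b c d)
    show ?case
    proof (intro allI impI)
      fix \<sigma> :: complex assume \<sigma>: "Im \<sigma> > 0"
      \<comment> \<open>The step backwards is the forward identity at the preimage \<open>\<tau>\<close> of \<open>\<sigma>\<close>.\<close>
      define \<tau> where "\<tau> = mob 1 0 (-4) 1 \<sigma>"
      have \<tau>: "Im \<tau> > 0" unfolding \<tau>_def using \<sigma> by (rule Im_mob_pos) simp
      then have nz: "4 * \<tau> + 1 \<noteq> 0" by (auto simp: complex_eq_iff)
      have "1 - 4 * \<sigma> \<noteq> 0" using \<sigma> by (auto simp: complex_eq_iff)
      then have inverse_W: "\<tau> / (4 * \<tau> + 1) = \<sigma>"
      proof -
        have "\<tau> = \<sigma> / (1 - 4 * \<sigma>)" by (simp add: \<tau>_def mob_def)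
        moreover have "4 * (\<sigma> / (1 - 4 * \<sigma>)) + 1 = 1 / (1 - 4 * \<sigma>)" using \<open>1 - 4 * \<sigma> \<noteq> 0\<close> by (simp add: field_simps)
        ultimately show ?thesis using \<open>1 - 4 * \<sigma> \<noteq> 0\<close> by simp
      qed
      have c': "4 dvd c - 4 * d" using W_inv(2) by presburger
      have det: "(a - 4 * b) * d - b * (c - 4 * d) = 1" using W_inv(1) by (simp add: algebra_simps)
      have "theta (mob (a - 4 * b) b (c - 4 * d) d \<sigma>) = theta (mob a b c d \<tau>)"
        using mob_W[OF nz, of "a - 4 * b" b "c - 4 * d" d] by (simp add: inverse_W)
      also have "\<dots> = of_int (kronecker c d) * csqrt (of_int c * \<tau> + of_int d) * theta \<tau>"
        using W_inv(4) \<tau> by blast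
      also have "\<dots> = (of_int (kronecker (c - 4 * d) d) * (csqrt (of_int (c - 4 * d) * \<sigma> + of_int d) * csqrt (4 * \<tau> + 1))) * theta \<tau>"
        using kronecker_csqrt_cocycle[OF c' W_inv(3) det_coprime[OF det] \<tau>] by (simp add: inverse_W)
      also have "\<dots> = of_int (kronecker (c - 4 * d) d) * csqrt (of_int (c - 4 * d) * \<sigma> + of_int d) * theta \<sigma>"
        using theta_W[OF \<tau>] by (simp add: inverse_W)
      finally show "theta (mob (a - 4 * b) b (c - 4 * d) d \<sigma>) =
         of_int (kronecker (c - 4 * d) d) * csqrt (of_int (c - 4 * d) * \<sigma> + of_int d) * theta \<sigma>" .
    qed
  qed
  then show ?thesis using assms(4) by blast
qed

text \<open>Conjugation by \<open>\<tau>/4\<close> divides \<open>b\<close> and multiplies \<open>c\<close> by \<open>4\<close>; this square does not affect the Kronecker symbol.\<close>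
corollary theta_quarter_Gamma_4:
  fixes a b c d :: int
  assumes "a * d - b * c = 1" "4 dvd c" "4 dvd b" "d mod 4 = 1" and "Im \<tau> > 0"
  shows "theta (mob a b c d \<tau> / 4) = of_int (kronecker c d) * csqrt (of_int c * \<tau> + of_int d) * theta (\<tau> / 4)"
proof -
  obtain b' where b: "b = 4 * b'" using assms(3) by (rule dvdE)
  have "mob a b' (4 * c) d (\<tau> / 4) = mob a b c d \<tau> / 4"
    by (simp add: mob_def b field_simps)
  moreover have "a * d - b' * (4 * c) = 1" using assms(1) b by simp
  moreover have "odd d" using assms(4) by presburger
  then have "kronecker (4 * c) d = kronecker c d" by (rule kronecker_4_mult)
  moreover have "of_int (4 * c) * (\<tau> / 4) = of_int c * \<tau>" by simp
  moreover have "4 dvd 4 * c" "Im (\<tau> / 4) > 0" using assms(5) by simp_all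
  ultimately show ?thesis
    using theta_Gamma1_4[of a d b' "4 * c" "\<tau> / 4"] assms(4) by metis
qed

section \<open>The action of the modular group on the pair of theta functions\<close>

definition i_pow :: "int \<Rightarrow> complex" where
  "i_pow n = (if n mod 4 = 0 then 1 else if n mod 4 = 1 then \<i> else if n mod 4 = 2 then -1 else - \<i>)"

text \<open>Up to a scalar, \<open>theta_odd\<close> transforms under a matrix with bottom row \<open>(c, d)\<close> into the linear form
  \<open>r A + s B\<close>, which depends on \<open>(c, d)\<close> modulo \<open>4\<close> only: the six possible lines \<open>B\<close>, \<open>A\<close>, \<open>A - i^j B\<close> belong to the
  six cusps.\<close>
definition odd_line :: "int \<Rightarrow> int \<Rightarrow> complex \<Rightarrow> complex \<Rightarrow> bool" where
  "odd_line c d r s \<longleftrightarrow>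
     (if c mod 4 = 0 then r = 0 \<and> s \<noteq> 0 else if c mod 4 = 2 then r \<noteq> 0 \<and> s = 0 else r \<noteq> 0 \<and> s = - i_pow (c * d) * r)"

lemma mod_4_cases: "(n::int) mod 4 = 0 \<or> n mod 4 = 1 \<or> n mod 4 = 2 \<or> n mod 4 = 3"
  by presburger

lemma i_pow_mod: "i_pow (m * n) = i_pow ((m mod 4) * (n mod 4))"
  by (simp add: i_pow_def mod_mult_eq)

lemma odd_line_T:
  assumes "odd_line c d r s"
  shows "odd_line c (c + d) r (\<i> * s)"
proof -
  have "(c + d) mod 4 = (c mod 4 + d mod 4) mod 4" by (simp add: mod_add_eq)
  then show ?thesis
    using assms mod_4_cases[of c] mod_4_cases[of d]
    unfolding odd_line_def i_pow_mod[of c d] i_pow_mod[of c "c + d"]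
    by (elim disjE) (simp_all add: i_pow_def)
qed

lemma odd_line_T_inv:
  assumes "odd_line c d r s"
  shows "odd_line c (d - c) r (- \<i> * s)"
proof -
  have "(d - c) mod 4 = (d mod 4 - c mod 4) mod 4" by (simp add: mod_diff_eq)
  then show ?thesis
    using assms mod_4_cases[of c] mod_4_cases[of d]
    unfolding odd_line_def i_pow_mod[of c d] i_pow_mod[of c "d - c"]
    by (elim disjE) (simp_all add: i_pow_def)
qed

lemma odd_line_S:
  assumes "odd_line c d r s" "odd c \<or> odd d" "k \<noteq> 0"
  shows "odd_line d (- c) (k * (r + s)) (k * (r - s))"
proof -
  have m: "(- c) mod 4 = (- (c mod 4)) mod 4" by (simp add: mod_minus_eq)
  have par: "\<not> (c mod 4 = 0 \<and> d mod 4 = 0)" "\<not> (c mod 4 = 0 \<and> d mod 4 = 2)" "\<not> (c mod 4 = 2 \<and> d mod 4 = 0)" "\<not> (c mod 4 = 2 \<and> d mod 4 = 2)"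
    using assms(2) by presburger+
  have u: "1 - \<i> \<noteq> 0" "1 + \<i> \<noteq> 0" by (simp_all add: complex_eq_iff)
  have eq: "r - \<i> * r = (1 - \<i>) * r" "r + \<i> * r = (1 + \<i>) * r" by (simp_all add: algebra_simps)
  show ?thesis
    using assms(1,3) par u mod_4_cases[of c] mod_4_cases[of d]
    unfolding odd_line_def i_pow_mod[of c d] i_pow_mod[of d "- c"] m
    by (elim disjE) (simp_all add: i_pow_def eq, simp_all add: algebra_simps)
qed

text \<open>The generators act by \<open>(A, i B)\<close> and, up to a factor, by \<open>(A + B, A - B)\<close>. The factor \<open>w\<close> may
  depend on \<open>\<tau>\<close> in an arbitrary way; only its absolute value matters for the growth at the cusps.\<close>
lemma theta_pair_SL2Z:
  fixes a b c d :: int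
  assumes "a * d - b * c = 1"
  shows "\<exists>p q r s. odd_line c d r s \<and> (\<forall>\<tau>. Im \<tau> > 0 \<longrightarrow>
    (\<exists>w. (cmod w)\<^sup>2 = cmod (of_int c * \<tau> + of_int d) \<and>
      theta_even (mob a b c d \<tau>) = w * (p * theta_even \<tau> + q * theta_odd \<tau>) \<and>
      theta_odd (mob a b c d \<tau>) = w * (r * theta_even \<tau> + s * theta_odd \<tau>)))"
  using assms
proof (induction a b c d rule: SL2Z_induct)
  case one
  show ?case
    by (rule exI[of _ 1], rule exI[of _ 0], rule exI[of _ 0], rule exI[of _ 1])
       (auto simp: odd_line_def mob_def intro!: exI[of _ 1])
next
  case (T a b c d)
  then obtain p q r s where l: "odd_line c d r s" and IH: "\<And>\<tau>. Im \<tau> > 0 \<Longrightarrow>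
    (\<exists>w. (cmod w)\<^sup>2 = cmod (of_int c * \<tau> + of_int d) \<and>
      theta_even (mob a b c d \<tau>) = w * (p * theta_even \<tau> + q * theta_odd \<tau>) \<and>
      theta_odd (mob a b c d \<tau>) = w * (r * theta_even \<tau> + s * theta_odd \<tau>))" by blast
  show ?case
  proof (rule exI[of _ p], rule exI[of _ "\<i> * q"], rule exI[of _ r], rule exI[of _ "\<i> * s"], intro conjI allI impI)
    show "odd_line c (c + d) r (\<i> * s)" by (rule odd_line_T[OF l])
    fix \<tau> :: complex assume \<tau>: "Im \<tau> > 0"
    then obtain w where w: "(cmod w)\<^sup>2 = cmod (of_int c * (\<tau> + 1) + of_int d)"
      "theta_even (mob a b c d (\<tau> + 1)) = w * (p * theta_even (\<tau> + 1) + q * theta_odd (\<tau> + 1))"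
      "theta_odd (mob a b c d (\<tau> + 1)) = w * (r * theta_even (\<tau> + 1) + s * theta_odd (\<tau> + 1))"
      using IH[of "\<tau> + 1"] by auto
    then show "\<exists>w. (cmod w)\<^sup>2 = cmod (of_int c * \<tau> + of_int (c + d)) \<and>
      theta_even (mob a (a + b) c (c + d) \<tau>) = w * (p * theta_even \<tau> + (\<i> * q) * theta_odd \<tau>) \<and>
      theta_odd (mob a (a + b) c (c + d) \<tau>) = w * (r * theta_even \<tau> + (\<i> * s) * theta_odd \<tau>)"
      unfolding mob_T theta_even_shift[OF \<tau>] theta_odd_shift[OF \<tau>]
      by (intro exI[of _ w]) (simp add: algebra_simps)
  qed
next
  case (T_inv a b c d)
  then obtain p q r s where l: "odd_line c d r s" and IH: "\<And>\<tau>. Im \<tau> > 0 \<Longrightarrow>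
    (\<exists>w. (cmod w)\<^sup>2 = cmod (of_int c * \<tau> + of_int d) \<and>
      theta_even (mob a b c d \<tau>) = w * (p * theta_even \<tau> + q * theta_odd \<tau>) \<and>
      theta_odd (mob a b c d \<tau>) = w * (r * theta_even \<tau> + s * theta_odd \<tau>))" by blast
  show ?case
  proof (rule exI[of _ p], rule exI[of _ "- \<i> * q"], rule exI[of _ r], rule exI[of _ "- \<i> * s"], intro conjI allI impI)
    show "odd_line c (d - c) r (- \<i> * s)" by (rule odd_line_T_inv[OF l])
    fix \<tau> :: complex assume \<tau>: "Im \<tau> > 0"
    then obtain w where w: "(cmod w)\<^sup>2 = cmod (of_int c * (\<tau> - 1) + of_int d)"
      "theta_even (mob a b c d (\<tau> - 1)) = w * (p * theta_even (\<tau> - 1) + q * theta_odd (\<tau> - 1))"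
      "theta_odd (mob a b c d (\<tau> - 1)) = w * (r * theta_even (\<tau> - 1) + s * theta_odd (\<tau> - 1))"
      using IH[of "\<tau> - 1"] by auto
    then show "\<exists>w. (cmod w)\<^sup>2 = cmod (of_int c * \<tau> + of_int (d - c)) \<and>
      theta_even (mob a (b - a) c (d - c) \<tau>) = w * (p * theta_even \<tau> + (- \<i> * q) * theta_odd \<tau>) \<and>
      theta_odd (mob a (b - a) c (d - c) \<tau>) = w * (r * theta_even \<tau> + (- \<i> * s) * theta_odd \<tau>)"
      unfolding mob_T_inv theta_even_shift_back[OF \<tau>] theta_odd_shift_back[OF \<tau>]
      by (intro exI[of _ w]) (simp add: algebra_simps)
  qed
next
  case (S a b c d)
  then obtain p q r s where l: "odd_line c d r s" and IH: "\<And>\<tau>. Im \<tau> > 0 \<Longrightarrow>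
    (\<exists>w. (cmod w)\<^sup>2 = cmod (of_int c * \<tau> + of_int d) \<and>
      theta_even (mob a b c d \<tau>) = w * (p * theta_even \<tau> + q * theta_odd \<tau>) \<and>
      theta_odd (mob a b c d \<tau>) = w * (r * theta_even \<tau> + s * theta_odd \<tau>))" by blast
  have par: "odd c \<or> odd d"
  proof (rule ccontr)
    assume "\<not> (odd c \<or> odd d)"
    then have "even (a * d - b * c)" by simp
    then show False using S by simp
  qed
  \<comment> \<open>The inversion factor has absolute value \<open>sqrt (\<bar>\<tau>\<bar>/2)\<close>; the constant \<open>sqrt 2\<close> is moved into the coefficients.\<close>
  define k where "k = complex_of_real (1 / sqrt 2)"
  show ?case
  proof (rule exI[of _ "k * (p + q)"], rule exI[of _ "k * (p - q)"], rule exI[of _ "k * (r + s)"],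
      rule exI[of _ "k * (r - s)"], intro conjI allI impI)
    show "odd_line d (- c) (k * (r + s)) (k * (r - s))" by (rule odd_line_S[OF l par]) (simp add: k_def)
    fix \<tau> :: complex assume \<tau>: "Im \<tau> > 0"
    then have t0: "\<tau> \<noteq> 0" by auto
    have im: "Im (- 1 / \<tau>) > 0" by (rule Im_neg_inverse_pos[OF \<tau>])
    obtain w where w: "(cmod w)\<^sup>2 = cmod (of_int c * (- 1 / \<tau>) + of_int d)"
      "theta_even (mob a b c d (- 1 / \<tau>)) = w * (p * theta_even (- 1 / \<tau>) + q * theta_odd (- 1 / \<tau>))"
      "theta_odd (mob a b c d (- 1 / \<tau>)) = w * (r * theta_even (- 1 / \<tau>) + s * theta_odd (- 1 / \<tau>))"
      using IH[OF im] by auto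
    define v where "v = w * csqrt (- \<i> * \<tau> / 2) / k"
    have k0: "k \<noteq> 0" by (simp add: k_def)
    have vk: "w * csqrt (- \<i> * \<tau> / 2) = v * k" using k0 by (simp add: v_def)
    have "of_int c * (- 1 / \<tau>) + of_int d = (of_int d * \<tau> + of_int (- c)) / \<tau>"
      using t0 by (simp add: field_simps)
    then have w1: "(cmod w)\<^sup>2 = cmod (of_int d * \<tau> + of_int (- c)) / cmod \<tau>"
      using w(1) by (simp only: norm_divide)
    have "(cmod (csqrt z))\<^sup>2 = cmod z" for z by (metis norm_power power2_csqrt)
    then have "(cmod v)\<^sup>2 = (cmod w)\<^sup>2 * (cmod (- \<i> * \<tau> / 2)) / (cmod k)\<^sup>2"
      by (simp only: v_def norm_divide norm_mult power_divide power_mult_distrib)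
    also have "(cmod k)\<^sup>2 = 1 / 2" by (simp add: k_def power_divide norm_divide)
    also have "cmod (- \<i> * \<tau> / 2) = cmod \<tau> / 2" by (simp add: norm_divide norm_mult)
    finally have v: "(cmod v)\<^sup>2 = cmod (of_int d * \<tau> + of_int (- c))"
      unfolding w1 using t0 by simp
    have even: "theta_even (mob b (- a) d (- c) \<tau>) = v * (k * (p + q) * theta_even \<tau> + k * (p - q) * theta_odd \<tau>)"
    proof -
      have "theta_even (mob b (- a) d (- c) \<tau>) = (w * csqrt (- \<i> * \<tau> / 2)) * ((p + q) * theta_even \<tau> + (p - q) * theta_odd \<tau>)"
        unfolding mob_S[OF t0] w(2) theta_even_inversion[OF \<tau>] theta_odd_inversion[OF \<tau>] by (simp add: algebra_simps)
      then show ?thesis unfolding vk by (simp add: algebra_simps)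
    qed
    have odd: "theta_odd (mob b (- a) d (- c) \<tau>) = v * (k * (r + s) * theta_even \<tau> + k * (r - s) * theta_odd \<tau>)"
    proof -
      have "theta_odd (mob b (- a) d (- c) \<tau>) = (w * csqrt (- \<i> * \<tau> / 2)) * ((r + s) * theta_even \<tau> + (r - s) * theta_odd \<tau>)"
        unfolding mob_S[OF t0] w(3) theta_even_inversion[OF \<tau>] theta_odd_inversion[OF \<tau>] by (simp add: algebra_simps)
      then show ?thesis unfolding vk by (simp add: algebra_simps)
    qed
    show "\<exists>w. (cmod w)\<^sup>2 = cmod (of_int d * \<tau> + of_int (- c)) \<and>
      theta_even (mob b (- a) d (- c) \<tau>) = w * (k * (p + q) * theta_even \<tau> + k * (p - q) * theta_odd \<tau>) \<and>
      theta_odd (mob b (- a) d (- c) \<tau>) = w * (k * (r + s) * theta_even \<tau> + k * (r - s) * theta_odd \<tau>)"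
      using v even odd by blast
  qed
qed

text \<open>\<open>A B (A^4 - B^4)\<close> is invariant, up to a constant of absolute value one, under \<open>(A, i B)\<close> and under \<open>(A + B, A - B)/sqrt 2\<close>.\<close>
lemma norm_eta_SL2Z:
  fixes a b c d :: int
  assumes "a * d - b * c = 1" "Im \<tau> > 0"
  shows "cmod (dedekind_eta (mob a b c d \<tau>) ^ 6) = cmod (of_int c * \<tau> + of_int d) ^ 3 * cmod (dedekind_eta \<tau> ^ 6)"
proof -
  let ?D = "\<lambda>\<tau>. cmod (dedekind_eta \<tau> ^ 6)"
  have eta: "?D \<tau> = cmod (theta_even \<tau> * theta_odd \<tau> * (theta_even \<tau> ^ 4 - theta_odd \<tau> ^ 4)) / 2" if "Im \<tau> > 0" for \<tau>
    unfolding dedekind_eta_power_6[OF that, symmetric] by (simp add: norm_mult)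
  have T: "?D (\<tau> + 1) = ?D \<tau>" if "Im \<tau> > 0" for \<tau>
    using eta[OF that] eta[of "\<tau> + 1"] that
    by (simp add: theta_even_shift theta_odd_shift norm_mult power_mult_distrib)
  have T': "?D (\<tau> - 1) = ?D \<tau>" if "Im \<tau> > 0" for \<tau> using T[of "\<tau> - 1"] that by simp
  have S: "?D (- 1 / \<tau>) = cmod \<tau> ^ 3 * ?D \<tau>" if \<tau>: "Im \<tau> > 0" for \<tau>
  proof -
    define A where "A = theta_even \<tau>"
    define B where "B = theta_odd \<tau>"
    define w where "w = csqrt (- \<i> * \<tau> / 2)"
    have "(cmod w)\<^sup>2 = cmod (- \<i> * \<tau> / 2)" unfolding w_def by (metis norm_power power2_csqrt)
    then have w2: "(cmod w)\<^sup>2 = cmod \<tau> / 2" by (simp add: norm_divide norm_mult)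
    have "cmod w ^ 6 = ((cmod w)\<^sup>2) ^ 3" by (simp flip: power_mult)
    then have w6: "cmod w ^ 6 = cmod \<tau> ^ 3 / 8" unfolding w2 by (simp add: power_divide)
    have "w * (A + B) * (w * (A - B)) * ((w * (A + B)) ^ 4 - (w * (A - B)) ^ 4) = w ^ 6 * (8 * (A * B * (A ^ 4 - B ^ 4)))"
    proof -
      have "(A + B) ^ 4 - (A - B) ^ 4 = 8 * (A * B * (A\<^sup>2 + B\<^sup>2))"
        by (simp add: power4_eq_xxxx power2_eq_square algebra_simps)
      then have "(A + B) * (A - B) * ((A + B) ^ 4 - (A - B) ^ 4) = 8 * (A * B * (A ^ 4 - B ^ 4))"
        by (simp only:) (simp add: power4_eq_xxxx power2_eq_square algebra_simps)
      moreover have "w * X * (w * Y) * ((w * X) ^ 4 - (w * Y) ^ 4) = w ^ 6 * (X * Y * (X ^ 4 - Y ^ 4))" for X Y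
      proof -
        have "w ^ 6 = w * w * w ^ 4" by (simp add: power_numeral_reduce)
        then show ?thesis by (simp only: power_mult_distrib right_diff_distrib[symmetric]) (simp only: mult_ac)
      qed
      ultimately show ?thesis by (simp only:)
    qed
    then have "?D (- 1 / \<tau>) = cmod (w ^ 6 * (8 * (A * B * (A ^ 4 - B ^ 4)))) / 2"
      using eta[OF Im_neg_inverse_pos[OF \<tau>]] theta_even_inversion[OF \<tau>] theta_odd_inversion[OF \<tau>]
      by (simp only: A_def B_def w_def)
    also have "\<dots> = cmod \<tau> ^ 3 * (cmod (A * B * (A ^ 4 - B ^ 4)) / 2)"
      unfolding norm_mult norm_power w6 by simp
    finally show ?thesis using eta[OF \<tau>] by (simp only: A_def B_def)
  qed
  have "\<forall>\<tau>. Im \<tau> > 0 \<longrightarrow> ?D (mob a b c d \<tau>) = cmod (of_int c * \<tau> + of_int d) ^ 3 * ?D \<tau>"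
    using assms(1)
  proof (induction a b c d rule: SL2Z_induct)
    case one
    show ?case by (simp add: mob_def)
  next
    case (T a b c d)
    show ?case
    proof (intro allI impI)
      fix \<tau> :: complex assume \<tau>: "Im \<tau> > 0"
      have e: "of_int c * (\<tau> + 1) + of_int d = of_int c * \<tau> + of_int (c + d)" by (simp add: algebra_simps)
      have "Im (\<tau> + 1) > 0" using \<tau> by simp
      then show "?D (mob a (a + b) c (c + d) \<tau>) = cmod (of_int c * \<tau> + of_int (c + d)) ^ 3 * ?D \<tau>"
        using T(2) \<open>\<And>\<tau>. 0 < Im \<tau> \<Longrightarrow> ?D (\<tau> + 1) = ?D \<tau>\<close>[OF \<tau>] unfolding mob_T e[symmetric] by simp
    qed
  next
    case (T_inv a b c d)
    show ?case
    proof (intro allI impI)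
      fix \<tau> :: complex assume \<tau>: "Im \<tau> > 0"
      have e: "of_int c * (\<tau> - 1) + of_int d = of_int c * \<tau> + of_int (d - c)" by (simp add: algebra_simps)
      have "Im (\<tau> - 1) > 0" using \<tau> by simp
      then show "?D (mob a (b - a) c (d - c) \<tau>) = cmod (of_int c * \<tau> + of_int (d - c)) ^ 3 * ?D \<tau>"
        using T_inv(2) T'[OF \<tau>] unfolding mob_T_inv e[symmetric] by simp
    qed
  next
    case (S a b c d)
    show ?case
    proof (intro allI impI)
      fix \<tau> :: complex assume \<tau>: "Im \<tau> > 0"
      then have t0: "\<tau> \<noteq> 0" by auto
      have e: "of_int c * (- 1 / \<tau>) + of_int d = (of_int d * \<tau> + of_int (- c)) / \<tau>"
        using t0 by (simp add: field_simps)
      have "?D (mob b (- a) d (- c) \<tau>) = cmod (of_int c * (- 1 / \<tau>) + of_int d) ^ 3 * ?D (- 1 / \<tau>)"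
        unfolding mob_S[OF t0] using S(2) Im_neg_inverse_pos[OF \<tau>] by blast
      also have "\<dots> = cmod (of_int d * \<tau> + of_int (- c)) ^ 3 * ?D \<tau>"
        unfolding e \<open>\<And>\<tau>. 0 < Im \<tau> \<Longrightarrow> ?D (- 1 / \<tau>) = cmod \<tau> ^ 3 * ?D \<tau>\<close>[OF \<tau>] norm_divide power_divide
        using t0 by simp
      finally show "?D (mob b (- a) d (- c) \<tau>) = cmod (of_int d * \<tau> + of_int (- c)) ^ 3 * ?D \<tau>" .
    qed
  qed
  then show ?thesis using assms(2) by blast
qed

section \<open>Forms and their behaviour at infinity\<close>

text \<open>The absolute value of \<open>theta_factor\<close>, free of any choice of a square root; growth at the cusps only depends on it.\<close>
definition abs_factor :: "int \<Rightarrow> int \<Rightarrow> complex \<Rightarrow> real" where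
  "abs_factor c d \<tau> = sqrt (cmod (of_int c * \<tau> + of_int d))"

text \<open>The automorphy factor of weight \<open>1/2\<close>.\<close>
definition theta_factor :: "int \<Rightarrow> int \<Rightarrow> complex \<Rightarrow> complex" where
  "theta_factor c d \<tau> = of_int (kronecker c d) * csqrt (of_int c * \<tau> + of_int d)"

text \<open>This predicate and the following ones only concern the values of \<open>f\<close> on the upper half plane, so that
  sums, products and quotients of forms can be written down without restricting them to it.\<close>
definition invariant_form :: "nat \<Rightarrow> (complex \<Rightarrow> complex) \<Rightarrow> bool" where
  "invariant_form k f \<longleftrightarrow> f holomorphic_on upper_half_plane \<and>
     (\<forall>a b c d \<tau>. a * d - b * c = 1 \<longrightarrow> a mod 4 = 1 \<longrightarrow> 4 dvd b \<longrightarrow> 4 dvd c \<longrightarrow> d mod 4 = 1 \<longrightarrow> Im \<tau> > 0 \<longrightarrow>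
        f (mob a b c d \<tau>) = theta_factor c d \<tau> ^ k * f \<tau>)"

definition bounded_at_cusp :: "nat \<Rightarrow> (complex \<Rightarrow> complex) \<Rightarrow> int \<Rightarrow> int \<Rightarrow> int \<Rightarrow> int \<Rightarrow> bool" where
  "bounded_at_cusp k f a b c d \<longleftrightarrow>
     (\<exists>K. \<forall>\<^sub>F \<tau> in at_i_infinity. cmod (f (mob a b c d \<tau>)) \<le> K * abs_factor c d \<tau> ^ k)"

definition vanishing_at_cusp :: "nat \<Rightarrow> (complex \<Rightarrow> complex) \<Rightarrow> int \<Rightarrow> int \<Rightarrow> int \<Rightarrow> int \<Rightarrow> bool" where
  "vanishing_at_cusp k f a b c d \<longleftrightarrow>
     ((\<lambda>\<tau>. cmod (f (mob a b c d \<tau>)) / abs_factor c d \<tau> ^ k) \<longlongrightarrow> 0) at_i_infinity"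

definition form :: "nat \<Rightarrow> (complex \<Rightarrow> complex) \<Rightarrow> bool" where
  "form k f \<longleftrightarrow> invariant_form k f \<and> (\<forall>a b c d. a * d - b * c = 1 \<longrightarrow> bounded_at_cusp k f a b c d)"

definition cuspidal :: "nat \<Rightarrow> (complex \<Rightarrow> complex) \<Rightarrow> bool" where
  "cuspidal k f \<longleftrightarrow> form k f \<and> (\<forall>a b c d. a * d - b * c = 1 \<longrightarrow> vanishing_at_cusp k f a b c d)"

lemma abs_factor_pos:
  assumes "Im \<tau> > 0" "a * d - b * c = 1"
  shows "abs_factor c d \<tau> > 0"
  unfolding abs_factor_def using cocycle_nonzero[OF assms(1) det_nonzero[OF assms(2)]] by simp

lemma norm_theta_factor:
  assumes "coprime c d"
  shows "cmod (theta_factor c d \<tau>) = abs_factor c d \<tau>"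
proof -
  have "cmod (of_int (kronecker c d)) = 1"
    using abs_kronecker[OF assms] by (simp flip: of_int_abs)
  moreover have "cmod (csqrt z) = sqrt (cmod z)" for z
    by (metis norm_ge_zero norm_power power2_csqrt real_sqrt_unique)
  ultimately show ?thesis by (simp add: theta_factor_def abs_factor_def norm_mult)
qed

lemma theta_factor_nonzero:
  assumes "Im \<tau> > 0" "a * d - b * c = 1"
  shows "theta_factor c d \<tau> \<noteq> 0"
  using abs_factor_pos[OF assms] norm_theta_factor[OF det_coprime[OF assms(2)], of \<tau>] by auto

lemma at_i_infinity_neq_bot [simp]: "at_i_infinity \<noteq> bot"
proof (rule filtercomap_neq_bot_surj)
  show "surj Im" by (metis complex.sel(2) surjI)
qed simp

lemma eventually_Im_greater: "\<forall>\<^sub>F \<tau> in at_i_infinity. Im \<tau> > y"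
  using filterlim_filtercomap[of Im at_top] unfolding filterlim_at_top_dense by blast

lemma eventually_at_i_infinity: "eventually P at_i_infinity \<longleftrightarrow> (\<exists>N. \<forall>\<tau>. Im \<tau> \<ge> N \<longrightarrow> P \<tau>)"
  by (rule eventually_filtercomap_at_top_linorder)

lemma filterlim_shift: "filterlim (\<lambda>\<tau>. \<tau> + of_int n) at_i_infinity at_i_infinity"
  unfolding filterlim_filtercomap_iff using filterlim_filtercomap[of Im at_top] by (simp add: o_def)

lemma filterlim_local_param: "filterlim local_param (at 0) at_i_infinity"
proof -
  have "filterlim (\<lambda>y. exp (- (2 * pi * (1/4) * y))) (nhds 0) (at_top :: real filter)" by real_asymp
  from filterlim_compose[OF this filterlim_filtercomap[of Im at_top]]
  have "((\<lambda>\<tau>. cmod (local_param \<tau>)) \<longlongrightarrow> 0) at_i_infinity" by (simp only: norm_q_pow)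
  then show ?thesis unfolding filterlim_at by (simp add: tendsto_norm_zero_iff)
qed

lemma tendsto_local_param:
  assumes "g holomorphic_on ball 0 1"
  shows "((\<lambda>\<tau>. g (local_param \<tau>)) \<longlongrightarrow> g 0) at_i_infinity"
proof -
  have "isCont g 0"
    using holomorphic_on_imp_continuous_on[OF assms] by (simp add: continuous_on_eq_continuous_at)
  then have "(g \<longlongrightarrow> g 0) (at 0)" by (simp add: isCont_def)
  from filterlim_compose[OF this filterlim_local_param] show ?thesis .
qed

lemma tendsto_theta_even: "(theta_even \<longlongrightarrow> 1) at_i_infinity"
proof -
  have "(\<lambda>x. theta_series (x ^ 4)) holomorphic_on ball 0 1"
    by (rule holomorphic_on_compose_gen[unfolded o_def, OF _ theta_series_holomorphic])
       (auto simp: norm_power power_less_one_iff intro!: holomorphic_intros)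
  from tendsto_local_param[OF this]
  have "((\<lambda>\<tau>. theta_series (local_param \<tau> ^ 4)) \<longlongrightarrow> 1) at_i_infinity"
    by (simp add: theta_series_def zero_power)
  moreover have "\<forall>\<^sub>F \<tau> in at_i_infinity. theta_series (local_param \<tau> ^ 4) = theta_even \<tau>"
    using eventually_Im_greater[of 0] by eventually_elim (simp add: theta_even_series)
  ultimately show ?thesis by (rule Lim_transform_eventually)
qed

lemma tendsto_theta_odd_quotient: "((\<lambda>\<tau>. theta_odd \<tau> / local_param \<tau>) \<longlongrightarrow> 2) at_i_infinity"
proof -
  have "(\<lambda>x. 2 * triangular_series (x ^ 4)) holomorphic_on ball 0 1"
    by (intro holomorphic_intros holomorphic_on_compose_gen[unfolded o_def, OF _ triangular_series_holomorphic])
       (auto simp: norm_power power_less_one_iff intro!: holomorphic_intros)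
  from tendsto_local_param[OF this]
  have "((\<lambda>\<tau>. 2 * triangular_series (local_param \<tau> ^ 4)) \<longlongrightarrow> 2 * triangular_series 0) at_i_infinity" by simp
  also have "triangular_series 0 = 1"
    using triangular_series_product[of 0] by (simp add: euler_prod_def)
  finally have "((\<lambda>\<tau>. 2 * triangular_series (local_param \<tau> ^ 4)) \<longlongrightarrow> 2) at_i_infinity" by simp
  moreover have "\<forall>\<^sub>F \<tau> in at_i_infinity. 2 * triangular_series (local_param \<tau> ^ 4) = theta_odd \<tau> / local_param \<tau>"
    using eventually_Im_greater[of 0] by eventually_elim (simp add: theta_odd_series)
  ultimately show ?thesis by (rule Lim_transform_eventually)
qed

lemma tendsto_theta_odd: "(theta_odd \<longlongrightarrow> 0) at_i_infinity"
proof -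
  have "((\<lambda>\<tau>. theta_odd \<tau> / local_param \<tau> * local_param \<tau>) \<longlongrightarrow> 2 * 0) at_i_infinity"
    using filterlim_local_param by (intro tendsto_mult tendsto_theta_odd_quotient) (simp add: filterlim_at)
  then show ?thesis by simp
qed

text \<open>The leading term of \<open>A B (A^4 - B^4) / 2\<close> is \<open>x\<close>.\<close>
lemma tendsto_eta_quotient: "((\<lambda>\<tau>. dedekind_eta \<tau> ^ 6 / local_param \<tau>) \<longlongrightarrow> 1) at_i_infinity"
proof -
  have "((\<lambda>\<tau>. theta_even \<tau> * (theta_odd \<tau> / local_param \<tau>) * (theta_even \<tau> ^ 4 - theta_odd \<tau> ^ 4) / 2) \<longlongrightarrow>
      1 * 2 * (1 ^ 4 - 0 ^ 4) / 2) at_i_infinity"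
    by (intro tendsto_intros tendsto_theta_even tendsto_theta_odd tendsto_theta_odd_quotient) simp
  then have "((\<lambda>\<tau>. theta_even \<tau> * (theta_odd \<tau> / local_param \<tau>) * (theta_even \<tau> ^ 4 - theta_odd \<tau> ^ 4) / 2) \<longlongrightarrow> 1) at_i_infinity"
    by simp
  moreover have "\<forall>\<^sub>F \<tau> in at_i_infinity. theta_even \<tau> * (theta_odd \<tau> / local_param \<tau>) * (theta_even \<tau> ^ 4 - theta_odd \<tau> ^ 4) / 2
      = dedekind_eta \<tau> ^ 6 / local_param \<tau>"
    using eventually_Im_greater[of 0]
  proof eventually_elim
    case (elim \<tau>)
    have "theta_even \<tau> * (theta_odd \<tau> / local_param \<tau>) * (theta_even \<tau> ^ 4 - theta_odd \<tau> ^ 4) / 2 =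
        (theta_even \<tau> * theta_odd \<tau> * (theta_even \<tau> ^ 4 - theta_odd \<tau> ^ 4)) / 2 / local_param \<tau>"
      by simp
    also have "\<dots> = dedekind_eta \<tau> ^ 6 / local_param \<tau>"
      unfolding dedekind_eta_power_6[OF elim, symmetric] by simp
    finally show ?case .
  qed
  ultimately show ?thesis by (rule Lim_transform_eventually)
qed

section \<open>Expansions in the local parameter\<close>

lemma local_param_surj:
  assumes "x \<noteq> 0" "norm x < 1"
  shows "local_param (2 / (of_real pi * \<i>) * Ln x) = x"
proof -
  have "2 * of_real pi * \<i> * of_real (1/4) * (2 / (of_real pi * \<i>) * Ln x) = Ln x" by simp
  then show ?thesis unfolding q_pow_def by (simp only: exp_Ln[OF assms(1)])
qed

lemma Im_of_local_param: "norm (local_param \<tau>) < exp (- (pi / 2) * y) \<longleftrightarrow> Im \<tau> > y"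
  unfolding norm_q_pow by simp

text \<open>Near each point of the punctured disc a branch of the logarithm provides a local inverse of the local
  parameter, by periodicity the choice of the branch is irrelevant. Boundedness removes the singularity at the origin.\<close>
lemma local_expansion:
  assumes hol: "F holomorphic_on upper_half_plane"
    and per: "\<And>\<tau>. Im \<tau> > 0 \<Longrightarrow> F (\<tau> + 4) = F \<tau>"
    and bdd: "\<forall>\<^sub>F \<tau> in at_i_infinity. cmod (F \<tau>) \<le> K"
  obtains g where "g holomorphic_on ball 0 1" "\<And>\<tau>. Im \<tau> > 0 \<Longrightarrow> F \<tau> = g (local_param \<tau>)"
proof -
  define t where "t x = 2 / (of_real pi * \<i>) * Ln x" for x :: complex
  define g where "g x = F (t x)" for x
  have t: "local_param (t x) = x" if "x \<noteq> 0" "norm x < 1" for x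
    unfolding t_def by (rule local_param_surj[OF that])
  have im: "Im \<tau> > 0" if "norm (local_param \<tau>) < 1" for \<tau>
    using that Im_of_local_param[of \<tau> 0] by simp
  have per_int: "F (\<tau> + of_int (4 * n)) = F \<tau>" if "Im \<tau> > 0" for \<tau> n
  proof (induction n rule: int_induct[of _ 0])
    case (step1 i)
    then show ?case using per[of "\<tau> + of_int (4 * i)"] that by (simp add: algebra_simps)
  next
    case (step2 i)
    then show ?case using per[of "\<tau> + of_int (4 * (i - 1))"] that by (simp add: algebra_simps)
  qed simp
  have same: "F \<sigma> = F \<tau>" if "Im \<tau> > 0" "local_param \<sigma> = local_param \<tau>" for \<sigma> \<tau>
  proof -
    have "exp (2 * of_real pi * \<i> * of_real (1/4) * \<sigma>) = exp (2 * of_real pi * \<i> * of_real (1/4) * \<tau>)"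
      using that(2) by (simp only: q_pow_def)
    then obtain n :: int where "2 * of_real pi * \<i> * of_real (1/4) * \<sigma> =
        2 * of_real pi * \<i> * of_real (1/4) * \<tau> + of_real (of_int (2 * n) * pi) * \<i>"
      by (auto simp only: exp_eq)
    then have "(of_real pi * \<i>) * \<sigma> = (of_real pi * \<i>) * (\<tau> + of_int (4 * n))" by (simp add: field_simps)
    then have "\<sigma> = \<tau> + of_int (4 * n)" by simp
    then show ?thesis using per_int[OF that(1)] by simp
  qed
  have g: "F \<tau> = g (local_param \<tau>)" if "Im \<tau> > 0" for \<tau>
    unfolding g_def
  proof (rule same[symmetric, OF that])
    show "local_param (t (local_param \<tau>)) = local_param \<tau>" using local_param_less[OF that] by (intro t) simp_all
  qed
  have "g holomorphic_on ball 0 1 - {0}"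
  proof (rule holomorphic_onI)
    fix x0 :: complex assume x0: "x0 \<in> ball 0 1 - {0}"
    \<comment> \<open>On \<open>U\<close> the quotient \<open>x / x0\<close> has positive real part, and its principal logarithm is holomorphic.\<close>
    define U where "U = ball x0 (cmod x0) \<inter> ball 0 1"
    define h where "h x = t x0 + 2 / (of_real pi * \<i>) * Ln (x / x0)" for x
    have U0: "x \<noteq> 0 \<and> norm x < 1 \<and> x / x0 \<notin> \<real>\<^sub>\<le>\<^sub>0" if "x \<in> U" for x
    proof -
      have "norm (x0 - x) < norm x0" using that by (simp add: U_def dist_norm)
      then have "x \<noteq> 0" by auto
      have "norm (1 - x / x0) = norm (x0 - x) / norm x0"
        using x0 by (simp add: norm_divide[symmetric] diff_divide_distrib)
      then have "norm (1 - x / x0) < 1" using \<open>norm (x0 - x) < norm x0\<close> x0 by simp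
      then have "Re (1 - x / x0) < 1" using complex_Re_le_cmod[of "1 - x / x0"] by linarith
      then have "Re (x / x0) > 0" by simp
      then show ?thesis using that \<open>x \<noteq> 0\<close> by (auto simp: U_def complex_nonpos_Reals_iff)
    qed
    have lp: "local_param (h x) = x" if "x \<in> U" for x
    proof -
      have "x / x0 \<noteq> 0" using U0[OF that] x0 by simp
      have "local_param (h x) = local_param (t x0) * exp (Ln (x / x0))"
        unfolding q_pow_def h_def exp_add[symmetric] by (rule arg_cong[of _ _ exp]) (simp add: algebra_simps)
      also have "\<dots> = x0 * (x / x0)" 
        unfolding exp_Ln[OF \<open>x / x0 \<noteq> 0\<close>] using t[of x0] x0 by simp
      finally show ?thesis using x0 by simp
    qed
    have himg: "h ` U \<subseteq> upper_half_plane"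
    proof
      fix y assume "y \<in> h ` U"
      then obtain x where x: "x \<in> U" "y = h x" by blast
      have "norm (local_param (h x)) < 1" using U0[OF x(1)] by (simp only: lp[OF x(1)])
      then show "y \<in> upper_half_plane" using im x by (simp add: upper_half_plane_def)
    qed
    have "h holomorphic_on U"
      unfolding h_def[abs_def] using U0 x0 by (intro holomorphic_intros) auto
    then have "(\<lambda>x. F (h x)) holomorphic_on U"
      using himg by (rule holomorphic_on_compose_gen[unfolded o_def, OF _ hol])
    then have "g holomorphic_on U"
    proof (rule holomorphic_transform)
      fix x assume x: "x \<in> U"
      have "Im (h x) > 0" using himg x by (auto simp: upper_half_plane_def)
      then show "F (h x) = g x" using g lp[OF x] by simp
    qed
    moreover have "open U" "x0 \<in> U" using x0 by (auto simp: U_def)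
    ultimately have "g field_differentiable (at x0)" using holomorphic_on_imp_differentiable_at by blast
    then show "g field_differentiable (at x0 within ball 0 1 - {0})" by (rule field_differentiable_at_within)
  qed
  moreover have "g \<in> O[at 0](\<lambda>_. 1)"
  proof (rule bigoI)
    obtain N where N: "\<And>\<tau>. Im \<tau> \<ge> N \<Longrightarrow> cmod (F \<tau>) \<le> K"
      using bdd unfolding eventually_at_i_infinity by blast
    define r where "r = min 1 (exp (- (pi / 2) * N))"
    have "r > 0" by (simp add: r_def)
    then have "\<forall>\<^sub>F x in at (0::complex). dist x 0 < r \<and> x \<noteq> 0"
      unfolding eventually_at by (intro exI[of _ r]) auto
    then show "\<forall>\<^sub>F x in at 0. norm (g x) \<le> K * norm (1::complex)"
    proof eventually_elim
      case (elim x)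
      then have x: "x \<noteq> 0" "norm x < 1" "norm x < exp (- (pi / 2) * N)" by (simp_all add: r_def)
      then have "Im (t x) > N" using Im_of_local_param[of "t x" N] t[OF x(1,2)] by simp
      then show ?case using N[of "t x"] by (simp add: g_def)
    qed
  qed
  moreover have "(0::complex) \<in> interior (ball 0 1)" by (simp add: interior_open)
  ultimately obtain g' where g': "g' holomorphic_on ball 0 1" "\<forall>z\<in>ball 0 1 - {0}. g' z = g z"
    using holomorphic_on_extend by blast
  show ?thesis
  proof (rule that[OF g'(1)])
    fix \<tau> :: complex assume "Im \<tau> > 0"
    then show "F \<tau> = g' (local_param \<tau>)" using g g'(2) local_param_less by simp
  qed
qed

section \<open>Forms of weight zero are constant\<close>

lemma mob_mult:
  assumes "Im \<tau> > 0" "a' * d' - b' * c' = 1"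
  shows "mob a b c d (mob a' b' c' d' \<tau>) = mob (a * a' + b * c') (a * b' + b * d') (c * a' + d * c') (c * b' + d * d') \<tau>"
proof -
  define u where "u = of_int c' * \<tau> + of_int d'"
  have u: "u \<noteq> 0" unfolding u_def by (rule cocycle_nonzero[OF assms(1) det_nonzero[OF assms(2)]])
  have "of_int e * mob a' b' c' d' \<tau> + of_int f = (of_int (e * a' + f * c') * \<tau> + of_int (e * b' + f * d')) / u" for e f
  proof -
    have "of_int (e * a' + f * c') * \<tau> + of_int (e * b' + f * d') = of_int e * (of_int a' * \<tau> + of_int b') + of_int f * u"
      by (simp add: u_def algebra_simps)
    moreover have "p * (v / u) + r = (p * v + r * u) / u" for p v r
      using u by (simp add: add_divide_distrib)
    ultimately show ?thesis unfolding mob_def u_def[symmetric] by (simp only:)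
  qed
  then show ?thesis unfolding mob_def[of a b c d] using u by (simp add: mob_def)
qed

lemma mob_inverse:
  assumes "Im \<tau> > 0" "a * d - b * c = 1"
  shows "mob a b c d (mob d (- b) (- c) a \<tau>) = \<tau>"
proof -
  have "d * a - (- b) * (- c) = 1" using assms(2) by (simp add: algebra_simps)
  then have "mob a b c d (mob d (- b) (- c) a \<tau>) = mob (a * d + b * (- c)) (a * (- b) + b * a) (c * d + d * (- c)) (c * (- b) + d * a) \<tau>"
    by (rule mob_mult[OF assms(1)])
  moreover have "a * d + b * (- c) = 1" "a * (- b) + b * a = 0" "c * d + d * (- c) = 0" "c * (- b) + d * a = 1"
    using assms(2) by (simp_all add: algebra_simps)
  ultimately have "mob a b c d (mob d (- b) (- c) a \<tau>) = mob 1 0 0 1 \<tau>" by (simp only:)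
  then show ?thesis by (simp add: mob_def)
qed

lemma mod_4_eqE:
  assumes "x mod 4 = y mod (4::int)"
  shows "\<exists>k. x = y + 4 * k"
proof -
  have "4 dvd x - y" using assms by (simp only: mod_eq_dvd_iff)
  then obtain k where "x - y = 4 * k" by (rule dvdE)
  then show ?thesis by (intro exI[of _ k]) linarith
qed

text \<open>The matrices \<open>\<alpha>\<close> and \<open>\<alpha>'\<close> are congruent modulo \<open>4\<close>, so that \<open>\<alpha>' \<alpha>\<^sup>-\<^sup>1\<close>, with entries \<open>A, B, C, D\<close>, lies in \<open>\<Gamma>(4)\<close>.\<close>
lemma invariant_form_mod_4:
  assumes f: "invariant_form 0 f" and "Im \<tau> > 0"
    and det: "a * d - b * c = 1" "a' * d' - b' * c' = 1"
    and cong: "a' mod 4 = a mod 4" "b' mod 4 = b mod 4" "c' mod 4 = c mod 4" "d' mod 4 = d mod 4"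
  shows "f (mob a' b' c' d' \<tau>) = f (mob a b c d \<tau>)"
proof -
  obtain i j k l where e: "a' = a + 4 * i" "b' = b + 4 * j" "c' = c + 4 * k" "d' = d + 4 * l"
    using cong mod_4_eqE by metis
  define A where "A = a' * d - b' * c"
  define B where "B = b' * a - a' * b"
  define C where "C = c' * d - d' * c"
  define D where "D = d' * a - c' * b"
  have A: "A = 1 + 4 * (i * d - j * c)" unfolding A_def e using det(1) by (simp add: algebra_simps)
  have B: "B = 4 * (j * a - i * b)" unfolding B_def e by (simp add: algebra_simps)
  have C: "C = 4 * (k * d - l * c)" unfolding C_def e by (simp add: algebra_simps)
  have D: "D = 1 + 4 * (l * a - k * b)" unfolding D_def e using det(1) by (simp add: algebra_simps)
  have "A * D - B * C = (a' * d' - b' * c') * (a * d - b * c)"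
    unfolding A_def B_def C_def D_def by (simp add: algebra_simps)
  then have detA: "A * D - B * C = 1" using det by simp
  have "(1 + 4 * z) mod 4 = 1" for z :: int by simp
  then have "A mod 4 = 1" "4 dvd B" "4 dvd C" "D mod 4 = 1" unfolding A B C D by (simp_all only: dvd_triv_left)
  with f detA Im_mob_pos[OF assms(2) det(1)]
  have "f (mob A B C D (mob a b c d \<tau>)) = theta_factor C D (mob a b c d \<tau>) ^ 0 * f (mob a b c d \<tau>)"
    unfolding invariant_form_def by blast
  moreover have "mob A B C D (mob a b c d \<tau>) = mob a' b' c' d' \<tau>"
  proof -
    have "A * a + B * c = a' * (a * d - b * c)" "A * b + B * d = b' * (a * d - b * c)"
      "C * a + D * c = c' * (a * d - b * c)" "C * b + D * d = d' * (a * d - b * c)"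
      unfolding A_def B_def C_def D_def by (simp_all add: algebra_simps)
    then show ?thesis unfolding mob_mult[OF assms(2) det(1)] det(1) by simp
  qed
  ultimately show ?thesis by simp
qed

lemma holomorphic_mob:
  assumes "f holomorphic_on upper_half_plane" "a * d - b * c = 1"
  shows "(\<lambda>\<tau>. f (mob a b c d \<tau>)) holomorphic_on upper_half_plane"
proof (rule holomorphic_on_compose_gen[unfolded o_def, OF _ assms(1)])
  show "mob a b c d holomorphic_on upper_half_plane"
    unfolding mob_def[abs_def] using cocycle_nonzero[OF _ det_nonzero[OF assms(2)]]
    by (intro holomorphic_intros) (auto simp: upper_half_plane_def)
  show "mob a b c d ` upper_half_plane \<subseteq> upper_half_plane"
    using Im_mob_pos[OF _ assms(2)] by (auto simp: upper_half_plane_def)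
qed

text \<open>Replacing \<open>\<tau>\<close> by \<open>\<tau> + 4\<close> does not change the matrix modulo \<open>4\<close>.\<close>
lemma cusp_expansion:
  assumes f: "invariant_form 0 f" and det: "a * d - b * c = 1"
    and bdd: "\<forall>\<^sub>F \<tau> in at_i_infinity. cmod (f (mob a b c d \<tau>)) \<le> K"
  obtains g where "g holomorphic_on ball 0 1" "\<And>\<tau>. Im \<tau> > 0 \<Longrightarrow> f (mob a b c d \<tau>) = g (local_param \<tau>)"
proof (rule local_expansion[of "\<lambda>\<tau>. f (mob a b c d \<tau>)" K])
  show "(\<lambda>\<tau>. f (mob a b c d \<tau>)) holomorphic_on upper_half_plane"
    using f unfolding invariant_form_def by (intro holomorphic_mob det) simp
  show "f (mob a b c d (\<tau> + 4)) = f (mob a b c d \<tau>)" if "Im \<tau> > 0" for \<tau>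
  proof -
    have "mob a b c d (\<tau> + 4) = mob a (a * 4 + b) c (c * 4 + d) \<tau>"
      using mob_shift[of a 4 b c d \<tau>] by simp
    moreover have "a * (c * 4 + d) - (a * 4 + b) * c = 1" using det by (simp add: algebra_simps)
    ultimately show ?thesis using invariant_form_mod_4[OF f that det, of a "c * 4 + d" "a * 4 + b" c] by simp
  qed
qed (use bdd that in auto)

text \<open>By Dirichlet's theorem there is a bottom row \<open>(k, -h)\<close> with \<open>0 < k \<le> N\<close> and \<open>\<bar>k Re \<tau> - h\<bar> < 1/N\<close>. If \<open>N\<close> is
  about \<open>1/sqrt y\<close> for \<open>y = Im \<tau> < 1\<close>, both parts of \<open>\<bar>k \<tau> - h\<bar>^2\<close> are of the order of \<open>y\<close>: they are at most \<open>y\<close> and \<open>4 y\<close>,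
  whence the constant.\<close>
lemma reduction_to_cusp:
  assumes "Im \<tau> > 0"
  obtains a b c d where "a * d - b * c = 1" "Im (mob a b c d \<tau>) \<ge> 1 / 5"
proof (cases "Im \<tau> \<ge> 1")
  case True
  then have "Im (mob 1 0 0 1 \<tau>) \<ge> 1 / 5" by (simp add: mob_def)
  then show ?thesis using that[of 1 1 0 0] by simp
next
  case False
  define y where "y = Im \<tau>"
  define s where "s = sqrt y"
  have y: "0 < y" "y < 1" using assms False by (simp_all add: y_def)
  have s: "0 < s" "s < 1" "s\<^sup>2 = y" using y by (simp_all add: s_def)
  define N where "N = nat \<lceil>1 / s\<rceil>"
  have N1: "1 / s \<le> real N" unfolding N_def by (rule real_nat_ceiling_ge)
  have N2: "real N \<le> 1 / s + 1"
  proof -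
    have "0 < 1 / s" using s by simp
    then have "- 1 < 1 / s" by linarith
    then have "0 \<le> \<lceil>1 / s\<rceil>" by (simp only: zero_le_ceiling)
    then have "real N = of_int \<lceil>1 / s\<rceil>" unfolding N_def by (rule of_nat_nat)
    then show ?thesis using of_int_ceiling_le_add_one[of "1 / s"] by (simp only:)
  qed
  have "1 / s > 0" using s by simp
  then have Npos: "real N > 0" using N1 by linarith
  obtain h k :: int where hk: "coprime h k" "0 < k" "k \<le> int N" "\<bar>of_int k * Re \<tau> - of_int h\<bar> < 1 / real N"
    using Dirichlet_approx_coprime[of N "Re \<tau>"] Npos by (metis of_nat_0_less_iff)
  obtain p q where "p * h + q * k = 1" using hk(1) by (metis bezout_int coprime_iff_gcd_eq_1)
  then have det: "(- p) * (- h) - (- q) * k = 1" by simp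
  have "(cmod (of_int k * \<tau> + of_int (- h)))\<^sup>2 = (of_int k * Re \<tau> - of_int h)\<^sup>2 + (of_int k * y)\<^sup>2"
    by (simp add: cmod_power2 y_def)
  also have "(of_int k * Re \<tau> - of_int h)\<^sup>2 \<le> y"
  proof -
    have "\<bar>of_int k * Re \<tau> - of_int h\<bar> \<le> s"
    proof -
      have "1 / real N \<le> s" using N1 s Npos by (simp add: field_simps)
      then show ?thesis using hk(4) by linarith
    qed
    then have "(of_int k * Re \<tau> - of_int h)\<^sup>2 \<le> s\<^sup>2" using s(1) by (simp add: abs_le_square_iff[symmetric])
    then show ?thesis using s(3) by simp
  qed
  also have "(of_int k * y)\<^sup>2 \<le> 4 * y"
  proof -
    have "of_int k \<le> real N" using hk(3) by (metis of_int_le_iff of_int_of_nat_eq)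
    then have "of_int k * y \<le> (1 / s + 1) * y" using N2 y by (intro mult_right_mono) auto
    also have "\<dots> = s + y" using s by (simp add: field_simps power2_eq_square flip: s(3))
    also have "\<dots> \<le> 2 * s"
    proof -
      have "y = s * s" using s(3) by (simp add: power2_eq_square)
      also have "\<dots> \<le> s * 1" using s by (intro mult_left_mono) auto
      finally show ?thesis by simp
    qed
    finally have "(of_int k * y)\<^sup>2 \<le> (2 * s)\<^sup>2" using hk(2) y by (intro power_mono) auto
    then show ?thesis using s(3) by (simp add: power_mult_distrib)
  qed
  finally have le: "(cmod (of_int k * \<tau> + of_int (- h)))\<^sup>2 \<le> 5 * y" by simp
  have "cmod (of_int k * \<tau> + of_int (- h)) > 0"
    using cocycle_nonzero[OF assms, of k "- h"] hk(2) by simp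
  then have "y / (cmod (of_int k * \<tau> + of_int (- h)))\<^sup>2 \<ge> y / (5 * y)"
    using le y by (intro divide_left_mono mult_pos_pos) auto
  then have "Im (mob (- p) (- q) k (- h) \<tau>) \<ge> 1 / 5"
    using y unfolding Im_mob[OF assms det] by (simp add: y_def)
  then show ?thesis using that[OF det] by blast
qed

text \<open>There are finitely many functions \<open>f \<circ> \<alpha>\<close>, each one a holomorphic function of the local parameter on
  the unit disc. Since every point can be moved to \<open>Im \<tau> \<ge> 1/5\<close>, the values of all of them are bounded by their
  maximum over a compact disc of radius less than one. So one of them attains its maximum
  in the open unit disc, possibly at the cusp, and is constant.\<close>
theorem form_0_constant:
  assumes f: "form 0 f"
  obtains C where "\<And>\<tau>. Im \<tau> > 0 \<Longrightarrow> f \<tau> = C"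
proof -
  define S where "S = {(a, b, c, d :: int) | a b c d. a * d - b * c = 1}"
  define key :: "int \<times> int \<times> int \<times> int \<Rightarrow> int \<times> int \<times> int \<times> int" where
    "key = (\<lambda>(a, b, c, d). (a mod 4, b mod 4, c mod 4, d mod 4))"
  define fa where "fa = (\<lambda>(a, b, c, d) \<tau>. f (mob a b c d \<tau>))"
  have inv: "invariant_form 0 f" using f by (simp add: form_def)
  have "\<exists>g. g holomorphic_on ball 0 1 \<and> (\<forall>\<tau>. Im \<tau> > 0 \<longrightarrow> fa \<alpha> \<tau> = g (local_param \<tau>))" if "\<alpha> \<in> S" for \<alpha>
  proof -
    obtain a b c d where \<alpha>: "\<alpha> = (a, b, c, d)" "a * d - b * c = 1" using \<open>\<alpha> \<in> S\<close> unfolding S_def by blast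
    have "bounded_at_cusp 0 f a b c d" using f \<alpha>(2) unfolding form_def by blast
    then obtain K where "\<forall>\<^sub>F \<tau> in at_i_infinity. cmod (f (mob a b c d \<tau>)) \<le> K"
      unfolding bounded_at_cusp_def by auto
    from cusp_expansion[OF inv \<alpha>(2) this] show ?thesis unfolding fa_def \<alpha> by auto
  qed
  then obtain g where g: "\<And>\<alpha>. \<alpha> \<in> S \<Longrightarrow> g \<alpha> holomorphic_on ball 0 1"
    "\<And>\<alpha> \<tau>. \<alpha> \<in> S \<Longrightarrow> Im \<tau> > 0 \<Longrightarrow> fa \<alpha> \<tau> = g \<alpha> (local_param \<tau>)" by metis
  \<comment> \<open>one matrix for each residue class modulo \<open>4\<close>\<close>
  define rep where "rep \<kappa> = (SOME \<alpha>. \<alpha> \<in> S \<and> key \<alpha> = \<kappa>)" for \<kappa>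
  have rep: "rep \<kappa> \<in> S \<and> key (rep \<kappa>) = \<kappa>" if "\<kappa> \<in> key ` S" for \<kappa>
    unfolding rep_def by (rule someI_ex) (use that in auto)
  have fa_rep: "fa \<alpha> \<tau> = fa (rep (key \<alpha>)) \<tau>" if "\<alpha> \<in> S" "Im \<tau> > 0" for \<alpha> \<tau>
  proof -
    have r: "rep (key \<alpha>) \<in> S" "key (rep (key \<alpha>)) = key \<alpha>" using rep[of "key \<alpha>"] that(1) by auto
    obtain a b c d where 1: "\<alpha> = (a, b, c, d)" "a * d - b * c = 1" using \<open>\<alpha> \<in> S\<close> unfolding S_def by blast
    obtain a' b' c' d' where 2: "rep (key \<alpha>) = (a', b', c', d')" "a' * d' - b' * c' = 1"
      using r(1) unfolding S_def by blast
    show ?thesis using invariant_form_mod_4[OF inv that(2) 2(2) 1(2)] r(2)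
      unfolding 2(1) unfolding 1(1) by (simp add: fa_def key_def)
  qed
  define R where "R = rep ` key ` S"
  have "finite (key ` S)"
  proof (rule finite_subset)
    show "key ` S \<subseteq> {0..3} \<times> {0..3} \<times> {0..3} \<times> {0..3}"
    proof
      fix \<kappa> assume "\<kappa> \<in> key ` S"
      then obtain a b c d where "\<kappa> = (a mod 4, b mod 4, c mod 4, d mod 4)" by (auto simp: key_def)
      moreover have "n mod 4 \<in> {0..3}" for n :: int
        using pos_mod_sign[of 4 n] pos_mod_bound[of 4 n] by simp
      ultimately show "\<kappa> \<in> {0..3} \<times> {0..3} \<times> {0..3} \<times> {0..3}" by (simp only: mem_Sigma_iff simp_thms)
    qed
  qed simp
  then have finR: "finite R" by (simp add: R_def)
  have RS: "R \<subseteq> S" unfolding R_def using rep by blast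
  have "(1, 0, 0, 1) \<in> S" unfolding S_def by simp
  then have "R \<noteq> {}" by (auto simp: R_def)
  \<comment> \<open>\<open>\<bar>x\<bar> = exp (- \<pi> Im \<tau> / 2)\<close> is at most \<open>exp (- \<pi> / 10)\<close> if \<open>Im \<tau> \<ge> 1/5\<close>.\<close>
  define E where "E = cball (0::complex) (exp (- (pi / 10)))"
  have E: "compact E" "E \<noteq> {}" "E \<subseteq> ball 0 1" "0 \<in> E"
    by (auto simp: E_def order.strict_trans1)
  have "\<exists>x\<in>E. \<forall>y\<in>E. norm (g \<alpha> y) \<le> norm (g \<alpha> x)" if "\<alpha> \<in> R" for \<alpha>
  proof -
    have "\<alpha> \<in> S" using that RS by blast
    then have "continuous_on E (g \<alpha>)"
      using continuous_on_subset[OF holomorphic_on_imp_continuous_on[OF g(1)] E(3)] by blast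
    then have "continuous_on E (\<lambda>y. norm (g \<alpha> y))" by (rule continuous_on_norm)
    then show ?thesis by (rule continuous_attains_sup[OF E(1,2)])
  qed
  then obtain x where x: "\<And>\<alpha>. \<alpha> \<in> R \<Longrightarrow> x \<alpha> \<in> E" "\<And>\<alpha> y. \<alpha> \<in> R \<Longrightarrow> y \<in> E \<Longrightarrow> norm (g \<alpha> y) \<le> norm (g \<alpha> (x \<alpha>))"
    by metis
  define M where "M = Max ((\<lambda>\<alpha>. norm (g \<alpha> (x \<alpha>))) ` R)"
  have "M \<in> (\<lambda>\<alpha>. norm (g \<alpha> (x \<alpha>))) ` R" unfolding M_def using finR \<open>R \<noteq> {}\<close> by (intro Max_in) auto
  then obtain \<beta> where \<beta>: "\<beta> \<in> R" "norm (g \<beta> (x \<beta>)) = M" by auto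
  have le_M: "norm (g \<alpha> y) \<le> M" if "\<alpha> \<in> R" "y \<in> E" for \<alpha> y
  proof -
    have "norm (g \<alpha> (x \<alpha>)) \<le> M" unfolding M_def using finR that by (intro Max_ge) auto
    with x(2)[OF that] show ?thesis by (rule order_trans)
  qed
  have bound: "cmod (f \<tau>) \<le> M" if \<tau>: "Im \<tau> > 0" for \<tau>
  proof -
    obtain a b c d where det: "a * d - b * c = 1" and ge: "Im (mob a b c d \<tau>) \<ge> 1 / 5"
      by (rule reduction_to_cusp[OF \<tau>])
    define \<sigma> where "\<sigma> = mob a b c d \<tau>"
    have \<sigma>: "Im \<sigma> > 0" unfolding \<sigma>_def by (rule Im_mob_pos[OF \<tau> det])
    have det': "d * a - (- b) * (- c) = 1" using det by (simp add: algebra_simps)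
    have \<alpha>: "(d, - b, - c, a) \<in> S" unfolding S_def using det' by blast
    have "mob d (- b) (- c) a \<sigma> = \<tau>"
      using mob_inverse[OF \<tau> det'] by (simp add: \<sigma>_def)
    then have "f \<tau> = fa (d, - b, - c, a) \<sigma>" by (simp add: fa_def)
    also have "\<dots> = fa (rep (key (d, - b, - c, a))) \<sigma>" by (rule fa_rep[OF \<alpha> \<sigma>])
    also have "\<dots> = g (rep (key (d, - b, - c, a))) (local_param \<sigma>)"
      using \<alpha> rep by (intro g(2) \<sigma>) auto
    finally have "f \<tau> = g (rep (key (d, - b, - c, a))) (local_param \<sigma>)" .
    moreover have "local_param \<sigma> \<in> E"
    proof -
      have "pi * (1 / 5) \<le> pi * Im \<sigma>" using ge by (intro mult_left_mono) (simp_all add: \<sigma>_def)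
      then show ?thesis by (simp add: E_def norm_q_pow)
    qed
    moreover have "rep (key (d, - b, - c, a)) \<in> R" using \<alpha> by (auto simp: R_def)
    ultimately show ?thesis using le_M by simp
  qed
  have \<beta>S: "\<beta> \<in> S" using \<beta> RS by auto
  obtain a b c d where ab: "\<beta> = (a, b, c, d)" "a * d - b * c = 1" using \<beta>S unfolding S_def by blast
  have "g \<beta> constant_on ball 0 1"
  proof (rule maximum_modulus_principle[of _ _ "ball 0 1" "x \<beta>"])
    show "x \<beta> \<in> ball 0 1" using x(1)[OF \<beta>(1)] E by auto
    fix z :: complex assume z: "z \<in> ball 0 1"
    show "cmod (g \<beta> z) \<le> cmod (g \<beta> (x \<beta>))"
    proof (cases "z = 0")
      case True
      then show ?thesis using x(2)[OF \<beta>(1)] E by simp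
    next
      case False
      define \<tau> where "\<tau> = 2 / (of_real pi * \<i>) * Ln z"
      have lp: "local_param \<tau> = z" unfolding \<tau>_def using False z by (intro local_param_surj) auto
      then have \<tau>: "Im \<tau> > 0" using Im_of_local_param[of \<tau> 0] z by simp
      have "g \<beta> z = f (mob a b c d \<tau>)" using g(2)[OF \<beta>S \<tau>] by (simp add: lp ab fa_def)
      then show ?thesis using bound[OF Im_mob_pos[OF \<tau> ab(2)]] \<beta>(2) by simp
    qed
  qed (use g(1)[OF \<beta>S] in auto)
  then obtain C where C: "\<And>z. z \<in> ball 0 1 \<Longrightarrow> g \<beta> z = C" by (auto simp: constant_on_def)
  show ?thesis
  proof (rule that)
    fix \<tau> :: complex assume \<tau>: "Im \<tau> > 0"
    have det': "d * a - (- b) * (- c) = 1" using ab(2) by (simp add: algebra_simps)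
    define \<sigma> where "\<sigma> = mob d (- b) (- c) a \<tau>"
    have \<sigma>: "Im \<sigma> > 0" unfolding \<sigma>_def by (rule Im_mob_pos[OF \<tau> det'])
    have "f \<tau> = fa \<beta> \<sigma>" using mob_inverse[OF \<tau> ab(2)] by (simp add: fa_def ab \<sigma>_def)
    also have "\<dots> = C" using g(2)[OF \<beta>S \<sigma>] C local_param_less[OF \<sigma>] by simp
    finally show "f \<tau> = C" .
  qed
qed

section \<open>Closure properties of forms and cusp forms\<close>

lemma form_cong:
  assumes "\<And>\<tau>. Im \<tau> > 0 \<Longrightarrow> f \<tau> = g \<tau>" "form k f"
  shows "form k g"
proof -
  have inv: "invariant_form k f" and bd: "\<And>a b c d. a * d - b * c = 1 \<Longrightarrow> bounded_at_cusp k f a b c d"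
    using assms(2) unfolding form_def by blast+
  have "invariant_form k g"
    unfolding invariant_form_def
  proof (intro conjI allI impI)
    show "g holomorphic_on upper_half_plane"
      using inv assms(1) unfolding invariant_form_def
      by (metis (no_types, lifting) holomorphic_transform mem_Collect_eq upper_half_plane_def)
    fix a b c d \<tau>
    assume *: "a * d - b * c = (1::int)" "a mod 4 = 1" "4 dvd b" "4 dvd c" "d mod 4 = 1" "Im \<tau> > 0"
    have "g (mob a b c d \<tau>) = f (mob a b c d \<tau>)" using assms(1) Im_mob_pos[OF *(6,1)] by simp
    also have "\<dots> = theta_factor c d \<tau> ^ k * f \<tau>" using inv * unfolding invariant_form_def by blast
    finally show "g (mob a b c d \<tau>) = theta_factor c d \<tau> ^ k * g \<tau>" using assms(1) *(6) by simp
  qed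
  moreover have "bounded_at_cusp k g a b c d" if det: "a * d - b * c = 1" for a b c d
  proof -
    obtain K where "\<forall>\<^sub>F \<tau> in at_i_infinity. cmod (f (mob a b c d \<tau>)) \<le> K * abs_factor c d \<tau> ^ k"
      using bd[OF det] unfolding bounded_at_cusp_def by blast
    then have "\<forall>\<^sub>F \<tau> in at_i_infinity. cmod (g (mob a b c d \<tau>)) \<le> K * abs_factor c d \<tau> ^ k"
      using eventually_Im_greater[of 0]
    proof eventually_elim
      case (elim \<tau>)
      then show ?case using assms(1)[OF Im_mob_pos[OF elim(2) det]] by simp
    qed
    then show ?thesis unfolding bounded_at_cusp_def by blast
  qed
  ultimately show ?thesis unfolding form_def by blast
qed

lemma vanishing_at_cusp_cong:
  assumes "\<And>\<tau>. Im \<tau> > 0 \<Longrightarrow> f \<tau> = g \<tau>" "a * d - b * c = 1" "vanishing_at_cusp k f a b c d"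
  shows "vanishing_at_cusp k g a b c d"
  unfolding vanishing_at_cusp_def
proof (rule Lim_transform_eventually)
  show "((\<lambda>\<tau>. cmod (f (mob a b c d \<tau>)) / abs_factor c d \<tau> ^ k) \<longlongrightarrow> 0) at_i_infinity"
    using assms(3) unfolding vanishing_at_cusp_def .
  show "\<forall>\<^sub>F \<tau> in at_i_infinity. cmod (f (mob a b c d \<tau>)) / abs_factor c d \<tau> ^ k = cmod (g (mob a b c d \<tau>)) / abs_factor c d \<tau> ^ k"
    using eventually_Im_greater[of 0]
  proof eventually_elim
    case (elim \<tau>)
    then show ?case using assms(1)[OF Im_mob_pos[OF elim assms(2)]] by simp
  qed
qed

lemma cuspidal_cong:
  assumes "\<And>\<tau>. Im \<tau> > 0 \<Longrightarrow> f \<tau> = g \<tau>" "cuspidal k f"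
  shows "cuspidal k g"
  using assms form_cong[of f g k] vanishing_at_cusp_cong[of f g _ _ _ _ k] unfolding cuspidal_def by blast

lemma invariant_form_cmult_add:
  assumes "invariant_form k f" "invariant_form k g"
  shows "invariant_form k (\<lambda>\<tau>. f \<tau> + C * g \<tau>)"
  using assms unfolding invariant_form_def
  by (auto intro!: holomorphic_intros simp: algebra_simps)

lemma invariant_form_mult:
  assumes "invariant_form j f" "invariant_form k g"
  shows "invariant_form (j + k) (\<lambda>\<tau>. f \<tau> * g \<tau>)"
  using assms unfolding invariant_form_def
  by (auto intro!: holomorphic_intros simp: power_add)

lemma invariant_form_divide:
  assumes f: "invariant_form (j + k) f" and g: "invariant_form k g" and nz: "\<And>\<tau>. Im \<tau> > 0 \<Longrightarrow> g \<tau> \<noteq> 0"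
  shows "invariant_form j (\<lambda>\<tau>. f \<tau> / g \<tau>)"
  unfolding invariant_form_def
proof (intro conjI allI impI)
  show "(\<lambda>\<tau>. f \<tau> / g \<tau>) holomorphic_on upper_half_plane"
    using f g nz unfolding invariant_form_def by (intro holomorphic_intros) (auto simp: upper_half_plane_def)
  fix a b c d \<tau>
  assume *: "a * d - b * c = (1::int)" "a mod 4 = 1" "4 dvd b" "4 dvd c" "d mod 4 = 1" "Im \<tau> > 0"
  have "f (mob a b c d \<tau>) = theta_factor c d \<tau> ^ (j + k) * f \<tau>" "g (mob a b c d \<tau>) = theta_factor c d \<tau> ^ k * g \<tau>"
    using f g * unfolding invariant_form_def by blast+
  then show "f (mob a b c d \<tau>) / g (mob a b c d \<tau>) = theta_factor c d \<tau> ^ j * (f \<tau> / g \<tau>)"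
    using theta_factor_nonzero[OF *(6,1)] by (simp add: power_add)
qed

lemma bounded_at_cusp_cmult_add:
  assumes "bounded_at_cusp k f a b c d" "bounded_at_cusp k g a b c d"
  shows "bounded_at_cusp k (\<lambda>\<tau>. f \<tau> + C * g \<tau>) a b c d"
proof -
  obtain K L where "\<forall>\<^sub>F \<tau> in at_i_infinity. cmod (f (mob a b c d \<tau>)) \<le> K * abs_factor c d \<tau> ^ k"
    "\<forall>\<^sub>F \<tau> in at_i_infinity. cmod (g (mob a b c d \<tau>)) \<le> L * abs_factor c d \<tau> ^ k"
    using assms unfolding bounded_at_cusp_def by blast
  then have "\<forall>\<^sub>F \<tau> in at_i_infinity. cmod (f (mob a b c d \<tau>) + C * g (mob a b c d \<tau>)) \<le> (K + cmod C * L) * abs_factor c d \<tau> ^ k"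
  proof eventually_elim
    case (elim \<tau>)
    have "cmod (f (mob a b c d \<tau>) + C * g (mob a b c d \<tau>)) \<le> cmod (f (mob a b c d \<tau>)) + cmod C * cmod (g (mob a b c d \<tau>))"
      by (metis norm_mult norm_triangle_ineq)
    also have "\<dots> \<le> K * abs_factor c d \<tau> ^ k + cmod C * (L * abs_factor c d \<tau> ^ k)"
      using elim by (intro add_mono mult_left_mono) auto
    finally show ?case by (simp add: algebra_simps)
  qed
  then show ?thesis unfolding bounded_at_cusp_def by blast
qed

lemma bounded_at_cusp_mult:
  assumes "bounded_at_cusp j f a b c d" "bounded_at_cusp k g a b c d"
  shows "bounded_at_cusp (j + k) (\<lambda>\<tau>. f \<tau> * g \<tau>) a b c d"
proof -
  obtain K L where "\<forall>\<^sub>F \<tau> in at_i_infinity. cmod (f (mob a b c d \<tau>)) \<le> K * abs_factor c d \<tau> ^ j"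
    "\<forall>\<^sub>F \<tau> in at_i_infinity. cmod (g (mob a b c d \<tau>)) \<le> L * abs_factor c d \<tau> ^ k"
    using assms unfolding bounded_at_cusp_def by blast
  then have "\<forall>\<^sub>F \<tau> in at_i_infinity. cmod (f (mob a b c d \<tau>) * g (mob a b c d \<tau>)) \<le> (K * L) * abs_factor c d \<tau> ^ (j + k)"
  proof eventually_elim
    case (elim \<tau>)
    have "cmod (f (mob a b c d \<tau>)) * cmod (g (mob a b c d \<tau>)) \<le> (K * abs_factor c d \<tau> ^ j) * (L * abs_factor c d \<tau> ^ k)"
      using elim by (intro mult_mono) (auto intro: order_trans[OF norm_ge_zero])
    then show ?case by (simp add: norm_mult power_add mult_ac)
  qed
  then show ?thesis unfolding bounded_at_cusp_def by blast
qed

lemma form_cmult_add: "form k f \<Longrightarrow> form k g \<Longrightarrow> form k (\<lambda>\<tau>. f \<tau> + C * g \<tau>)"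
  unfolding form_def by (simp add: invariant_form_cmult_add bounded_at_cusp_cmult_add)

lemma form_add: "form k f \<Longrightarrow> form k g \<Longrightarrow> form k (\<lambda>\<tau>. f \<tau> + g \<tau>)"
  using form_cmult_add[of k f g 1] by simp

lemma form_mult: "form j f \<Longrightarrow> form k g \<Longrightarrow> form (j + k) (\<lambda>\<tau>. f \<tau> * g \<tau>)"
  unfolding form_def by (simp add: invariant_form_mult bounded_at_cusp_mult)

lemma form_const: "form 0 (\<lambda>_. C)"
  unfolding form_def invariant_form_def bounded_at_cusp_def by auto

lemma form_zero: "form k (\<lambda>_. 0)"
proof -
  have "invariant_form k (\<lambda>_. 0)" unfolding invariant_form_def by simp
  moreover have "bounded_at_cusp k (\<lambda>_. 0) a b c d" for a b c d
    unfolding bounded_at_cusp_def by (intro exI[of _ 0]) simp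
  ultimately show ?thesis unfolding form_def by blast
qed

lemma form_power: "form j f \<Longrightarrow> form (n * j) (\<lambda>\<tau>. f \<tau> ^ n)"
  by (induction n) (simp_all add: form_const form_mult)

lemma cuspidal_add: 
  assumes "cuspidal k f" "cuspidal k g"
  shows "cuspidal k (\<lambda>\<tau>. f \<tau> + g \<tau>)"
proof -
  have "vanishing_at_cusp k (\<lambda>\<tau>. f \<tau> + g \<tau>) a b c d" if det: "a * d - b * c = 1" for a b c d
    unfolding vanishing_at_cusp_def
  proof (rule Lim_null_comparison)
    have "((\<lambda>\<tau>. cmod (f (mob a b c d \<tau>)) / abs_factor c d \<tau> ^ k + cmod (g (mob a b c d \<tau>)) / abs_factor c d \<tau> ^ k) \<longlongrightarrow> 0 + 0) at_i_infinity"
      using assms det unfolding cuspidal_def vanishing_at_cusp_def by (intro tendsto_add) blast+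
    then show "((\<lambda>\<tau>. (cmod (f (mob a b c d \<tau>)) + cmod (g (mob a b c d \<tau>))) / abs_factor c d \<tau> ^ k) \<longlongrightarrow> 0) at_i_infinity"
      by (simp add: add_divide_distrib)
    have J: "0 \<le> abs_factor c d \<tau> ^ k" for \<tau> by (simp add: abs_factor_def)
    show "\<forall>\<^sub>F \<tau> in at_i_infinity. norm (cmod (f (mob a b c d \<tau>) + g (mob a b c d \<tau>)) / abs_factor c d \<tau> ^ k) \<le>
       (cmod (f (mob a b c d \<tau>)) + cmod (g (mob a b c d \<tau>))) / abs_factor c d \<tau> ^ k"
      using J by (intro always_eventually) (auto simp: abs_of_nonneg intro!: divide_right_mono norm_triangle_ineq)
  qed
  then show ?thesis using assms form_add unfolding cuspidal_def by blast
qed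

lemma cuspidal_mult:
  assumes f: "cuspidal j f" and g: "form k g"
  shows "cuspidal (j + k) (\<lambda>\<tau>. f \<tau> * g \<tau>)"
proof -
  have "vanishing_at_cusp (j + k) (\<lambda>\<tau>. f \<tau> * g \<tau>) a b c d" if det: "a * d - b * c = 1" for a b c d
  proof -
    obtain K where K: "\<forall>\<^sub>F \<tau> in at_i_infinity. cmod (g (mob a b c d \<tau>)) \<le> K * abs_factor c d \<tau> ^ k"
      using g det unfolding form_def bounded_at_cusp_def by blast
    have "((\<lambda>\<tau>. cmod (f (mob a b c d \<tau>)) / abs_factor c d \<tau> ^ j * K) \<longlongrightarrow> 0 * K) at_i_infinity"
      using f det unfolding cuspidal_def vanishing_at_cusp_def by (intro tendsto_mult tendsto_const) blast
    then have lim: "((\<lambda>\<tau>. cmod (f (mob a b c d \<tau>)) / abs_factor c d \<tau> ^ j * K) \<longlongrightarrow> 0) at_i_infinity" by simp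
    have "\<forall>\<^sub>F \<tau> in at_i_infinity. norm (cmod (f (mob a b c d \<tau>) * g (mob a b c d \<tau>)) / abs_factor c d \<tau> ^ (j + k)) \<le>
       cmod (f (mob a b c d \<tau>)) / abs_factor c d \<tau> ^ j * K"
      using K eventually_Im_greater[of 0]
    proof eventually_elim
      case (elim \<tau>)
      have J: "abs_factor c d \<tau> > 0" by (rule abs_factor_pos[OF elim(2) det])
      have "cmod (g (mob a b c d \<tau>)) / abs_factor c d \<tau> ^ k \<le> K" using elim(1) J by (simp add: field_simps)
      then have "cmod (f (mob a b c d \<tau>)) / abs_factor c d \<tau> ^ j * (cmod (g (mob a b c d \<tau>)) / abs_factor c d \<tau> ^ k) \<le>
         cmod (f (mob a b c d \<tau>)) / abs_factor c d \<tau> ^ j * K"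
        using J by (intro mult_left_mono) auto
      then show ?case using J by (simp add: norm_mult power_add)
    qed
    then show ?thesis unfolding vanishing_at_cusp_def by (rule Lim_null_comparison[OF _ lim])
  qed
  then show ?thesis using assms form_mult unfolding cuspidal_def by blast
qed

section \<open>The theta functions and the sixth power of eta as forms\<close>

lemma eventually_norm_le:
  assumes "(f \<longlongrightarrow> l) F"
  shows "\<forall>\<^sub>F x in F. norm (f x) \<le> norm (l :: complex) + 1"
proof -
  have "\<forall>\<^sub>F x in F. norm (f x) < norm l + 1"
    by (rule order_tendstoD(2)[OF tendsto_norm[OF assms]]) simp
  then show ?thesis by eventually_elim simp
qed

lemma tendsto_theta_combination: "((\<lambda>\<tau>. p * theta_even \<tau> + q * theta_odd \<tau>) \<longlongrightarrow> p) at_i_infinity"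
proof -
  have "((\<lambda>\<tau>. p * theta_even \<tau> + q * theta_odd \<tau>) \<longlongrightarrow> p * 1 + q * 0) at_i_infinity"
    by (intro tendsto_intros tendsto_theta_even tendsto_theta_odd)
  then show ?thesis by simp
qed

lemma norm_eq_abs_factor:
  assumes "(cmod w)\<^sup>2 = cmod (of_int c * \<tau> + of_int d)"
  shows "cmod w = abs_factor c d \<tau>"
  unfolding abs_factor_def assms[symmetric] by simp

lemma form_theta: "form 1 theta_even" "form 1 theta_odd"
proof -
  have "bounded_at_cusp 1 theta_even a b c d \<and> bounded_at_cusp 1 theta_odd a b c d" if det: "a * d - b * c = 1" for a b c d
  proof -
    obtain p q r s where W: "\<And>\<tau>. Im \<tau> > 0 \<Longrightarrow> \<exists>w. (cmod w)\<^sup>2 = cmod (of_int c * \<tau> + of_int d) \<and>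
      theta_even (mob a b c d \<tau>) = w * (p * theta_even \<tau> + q * theta_odd \<tau>) \<and>
      theta_odd (mob a b c d \<tau>) = w * (r * theta_even \<tau> + s * theta_odd \<tau>)"
      using theta_pair_SL2Z[OF det] by blast
    have "\<forall>\<^sub>F \<tau> in at_i_infinity. cmod (theta_even (mob a b c d \<tau>)) \<le> (cmod p + 1) * abs_factor c d \<tau> ^ 1"
      using eventually_norm_le[OF tendsto_theta_combination[of p q]] eventually_Im_greater[of 0]
    proof eventually_elim
      case (elim \<tau>)
      obtain w where w: "(cmod w)\<^sup>2 = cmod (of_int c * \<tau> + of_int d)"
        "theta_even (mob a b c d \<tau>) = w * (p * theta_even \<tau> + q * theta_odd \<tau>)" using W[OF elim(2)] by blast
      show ?case unfolding w(2) norm_mult norm_eq_abs_factor[OF w(1)] power_one_right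
        using mult_left_mono[OF elim(1), of "abs_factor c d \<tau>"] abs_factor_pos[OF elim(2) det]
        by (simp add: mult.commute)
    qed
    moreover have "\<forall>\<^sub>F \<tau> in at_i_infinity. cmod (theta_odd (mob a b c d \<tau>)) \<le> (cmod r + 1) * abs_factor c d \<tau> ^ 1"
      using eventually_norm_le[OF tendsto_theta_combination[of r s]] eventually_Im_greater[of 0]
    proof eventually_elim
      case (elim \<tau>)
      obtain w where w: "(cmod w)\<^sup>2 = cmod (of_int c * \<tau> + of_int d)"
        "theta_odd (mob a b c d \<tau>) = w * (r * theta_even \<tau> + s * theta_odd \<tau>)" using W[OF elim(2)] by blast
      show ?case unfolding w(2) norm_mult norm_eq_abs_factor[OF w(1)] power_one_right
        using mult_left_mono[OF elim(1), of "abs_factor c d \<tau>"] abs_factor_pos[OF elim(2) det]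
        by (simp add: mult.commute)
    qed
    ultimately show ?thesis unfolding bounded_at_cusp_def by blast
  qed
  moreover have "invariant_form 1 theta_even"
    unfolding invariant_form_def using theta_even_holomorphic theta_Gamma1_4
    by (simp add: theta_even_def theta_factor_def)
  moreover have "invariant_form 1 theta_odd"
    unfolding invariant_form_def using theta_odd_holomorphic theta_Gamma1_4 theta_quarter_Gamma_4
    by (simp add: theta_odd_def theta_factor_def right_diff_distrib)
  ultimately show "form 1 theta_even" "form 1 theta_odd" unfolding form_def by blast+
qed

text \<open>By its expression as a polynomial in \<open>A\<close> and \<open>B\<close>.\<close>
lemma form_eta: "form 6 (\<lambda>\<tau>. dedekind_eta \<tau> ^ 6)"
proof -
  have "form (4 * 1) (\<lambda>\<tau>. theta_even \<tau> ^ 4 + (- 1) * theta_odd \<tau> ^ 4)"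
    by (intro form_cmult_add form_power form_theta)
  from form_mult[OF form_mult[OF form_mult[OF form_theta(1) form_theta(2)] this] form_const[of "1/2"]]
  have "form 6 (\<lambda>\<tau>. theta_even \<tau> * theta_odd \<tau> * (theta_even \<tau> ^ 4 - theta_odd \<tau> ^ 4) * (1/2))" by simp
  then show ?thesis
  proof (rule form_cong[rotated])
    fix \<tau> :: complex assume "Im \<tau> > 0"
    from dedekind_eta_power_6[OF this, symmetric]
    show "theta_even \<tau> * theta_odd \<tau> * (theta_even \<tau> ^ 4 - theta_odd \<tau> ^ 4) * (1/2) = dedekind_eta \<tau> ^ 6" by simp
  qed
qed

lemma cuspidal_eta: "cuspidal 6 (\<lambda>\<tau>. dedekind_eta \<tau> ^ 6)"
proof -
  have "vanishing_at_cusp 6 (\<lambda>\<tau>. dedekind_eta \<tau> ^ 6) a b c d" if det: "a * d - b * c = 1" for a b c d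
    unfolding vanishing_at_cusp_def
  proof (rule Lim_transform_eventually)
    have "((\<lambda>\<tau>. dedekind_eta \<tau> ^ 6 / local_param \<tau> * local_param \<tau>) \<longlongrightarrow> 1 * 0) at_i_infinity"
      using filterlim_local_param by (intro tendsto_mult tendsto_eta_quotient) (simp add: filterlim_at)
    then show "((\<lambda>\<tau>. cmod (dedekind_eta \<tau> ^ 6)) \<longlongrightarrow> 0) at_i_infinity"
      using tendsto_norm_zero by fastforce
    show "\<forall>\<^sub>F \<tau> in at_i_infinity. cmod (dedekind_eta \<tau> ^ 6) = cmod (dedekind_eta (mob a b c d \<tau>) ^ 6) / abs_factor c d \<tau> ^ 6"
      using eventually_Im_greater[of 0]
    proof eventually_elim
      case (elim \<tau>)
      have "abs_factor c d \<tau> ^ 6 = (abs_factor c d \<tau> ^ 2) ^ 3" by (simp flip: power_mult)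
      also have "abs_factor c d \<tau> ^ 2 = cmod (of_int c * \<tau> + of_int d)" by (simp add: abs_factor_def)
      finally show ?case
        using norm_eta_SL2Z[OF det elim] abs_factor_pos[OF elim det] by (simp add: abs_factor_def)
    qed
  qed
  then show ?thesis using form_eta unfolding cuspidal_def by blast
qed

section \<open>Division at the cusps\<close>

text \<open>If \<open>4\<close> divides \<open>c\<close>, the matrix is, up to sign, an element of \<open>\<Gamma>(4)\<close> times a translation: the cusp is equivalent to infinity.\<close>
lemma invariant_form_Gamma0:
  fixes a b c d :: int
  assumes det: "a * d - b * c = 1" and "4 dvd c"
  obtains n :: int where "\<And>k f \<tau>. invariant_form k f \<Longrightarrow> Im \<tau> > 0 \<Longrightarrow>
    cmod (f (mob a b c d \<tau>)) = abs_factor c d \<tau> ^ k * cmod (f (\<tau> + of_int n))"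
proof -
  have main: "cmod (f (mob a b c d \<tau>)) = abs_factor c d \<tau> ^ k * cmod (f (\<tau> + of_int b))"
    if det: "a * d - b * c = 1" and c: "4 dvd c" and ad: "a mod 4 = 1" "d mod 4 = 1"
      and f: "invariant_form k f" and \<tau>: "Im \<tau> > 0" for a b c d :: int and k f \<tau>
  proof -
    have \<tau>': "Im (\<tau> + of_int b) > 0" using \<tau> by simp
    have det': "a * (d - c * b) - (b - a * b) * c = 1" using det by (simp add: algebra_simps)
    have "4 dvd a - 1" using ad(1) by presburger
    then have "4 dvd (a - 1) * (- b)" by (rule dvd_mult2)
    then have b': "4 dvd b - a * b" by (simp add: algebra_simps)
    have "4 dvd c * b" using c by (rule dvd_mult2)
    then have d': "(d - c * b) mod 4 = 1" using ad(2) by presburger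
    have "mob a b c d \<tau> = mob a (b - a * b) c (d - c * b) (\<tau> + of_int b)"
      using mob_shift[of a b "b - a * b" c "d - c * b" \<tau>] by simp
    then have "f (mob a b c d \<tau>) = theta_factor c (d - c * b) (\<tau> + of_int b) ^ k * f (\<tau> + of_int b)"
      using f det' ad b' c d' \<tau>' unfolding invariant_form_def by (simp only:)
    moreover have "cmod (theta_factor c (d - c * b) (\<tau> + of_int b)) = abs_factor c d \<tau>"
      unfolding norm_theta_factor[OF det_coprime[OF det']] abs_factor_def
      by (rule arg_cong[of _ _ "\<lambda>z. sqrt (cmod z)"]) (simp add: algebra_simps)
    ultimately show ?thesis by (simp only: norm_mult norm_power)
  qed
  have "a * d mod 4 = 1"
  proof -
    have "a * d = 1 + b * c" using det by simp
    moreover have "4 dvd b * c" using assms(2) by (rule dvd_mult)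
    ultimately show ?thesis by presburger
  qed
  then have "(a mod 4) * (d mod 4) mod 4 = 1" by (simp only: mod_mult_eq)
  then have "a mod 4 = 1 \<and> d mod 4 = 1 \<or> a mod 4 = 3 \<and> d mod 4 = 3"
    using mod_4_cases[of a] mod_4_cases[of d] by (elim disjE) simp_all
  then show ?thesis
  proof
    assume "a mod 4 = 1 \<and> d mod 4 = 1"
    then show ?thesis using main[OF det assms(2)] that by blast
  next
    assume "a mod 4 = 3 \<and> d mod 4 = 3"
    then have neg: "(- a) mod 4 = 1" "(- d) mod 4 = 1" by (simp_all add: zmod_zminus1_eq_if)
    have det': "(- a) * (- d) - (- b) * (- c) = 1" "4 dvd - c" using det assms(2) by simp_all
    have "mob (- a) (- b) (- c) (- d) \<tau> = mob a b c d \<tau>" for \<tau>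
    proof -
      have "mob (- a) (- b) (- c) (- d) \<tau> = (- (of_int a * \<tau> + of_int b)) / (- (of_int c * \<tau> + of_int d))"
        by (simp add: mob_def)
      moreover have "(- x) / (- y) = x / y" for x y :: complex by simp
      ultimately show ?thesis by (simp only: mob_def)
    qed
    moreover have "abs_factor (- c) (- d) \<tau> = abs_factor c d \<tau>" for \<tau>
    proof -
      have "of_int (- c) * \<tau> + of_int (- d) = - (of_int c * \<tau> + of_int d)" by simp
      then show ?thesis unfolding abs_factor_def by (simp only: norm_minus_cancel)
    qed
    ultimately show ?thesis using main[OF det' neg] that[of "- b"] by simp
  qed
qed

text \<open>At the other cusps, \<open>theta_odd\<close> becomes \<open>r A + s B\<close> with \<open>r \<noteq> 0\<close>.\<close>
lemma theta_odd_lower_bound: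
  assumes det: "a * d - b * c = 1" and "\<not> 4 dvd c"
  obtains \<delta> where "\<delta> > 0" "\<forall>\<^sub>F \<tau> in at_i_infinity. \<delta> * abs_factor c d \<tau> \<le> cmod (theta_odd (mob a b c d \<tau>))"
proof -
  obtain p q r s where l: "odd_line c d r s" and W: "\<And>\<tau>. Im \<tau> > 0 \<Longrightarrow> \<exists>w. (cmod w)\<^sup>2 = cmod (of_int c * \<tau> + of_int d) \<and>
      theta_even (mob a b c d \<tau>) = w * (p * theta_even \<tau> + q * theta_odd \<tau>) \<and>
      theta_odd (mob a b c d \<tau>) = w * (r * theta_even \<tau> + s * theta_odd \<tau>)"
    using theta_pair_SL2Z[OF det] by blast
  have "c mod 4 \<noteq> 0" using assms(2) by presburger
  then have "r \<noteq> 0" using l by (auto simp: odd_line_def split: if_splits)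
  have "\<forall>\<^sub>F \<tau> in at_i_infinity. cmod r / 2 < cmod (r * theta_even \<tau> + s * theta_odd \<tau>)"
    by (rule order_tendstoD(1)[OF tendsto_norm[OF tendsto_theta_combination]]) (use \<open>r \<noteq> 0\<close> in simp)
  then have "\<forall>\<^sub>F \<tau> in at_i_infinity. cmod r / 2 * abs_factor c d \<tau> \<le> cmod (theta_odd (mob a b c d \<tau>))"
    using eventually_Im_greater[of 0]
  proof eventually_elim
    case (elim \<tau>)
    obtain w where w: "(cmod w)\<^sup>2 = cmod (of_int c * \<tau> + of_int d)"
      "theta_odd (mob a b c d \<tau>) = w * (r * theta_even \<tau> + s * theta_odd \<tau>)" using W[OF elim(2)] by blast
    show ?case unfolding w(2) norm_mult norm_eq_abs_factor[OF w(1)]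
      using mult_left_mono[OF less_imp_le[OF elim(1)], of "abs_factor c d \<tau>"] abs_factor_pos[OF elim(2) det]
      by (simp add: mult.commute)
  qed
  then show ?thesis using that[of "cmod r / 2"] \<open>r \<noteq> 0\<close> by simp
qed

lemma form_expansion:
  assumes "form k f"
  obtains g where "g holomorphic_on ball 0 1" "\<And>\<tau>. Im \<tau> > 0 \<Longrightarrow> f \<tau> = g (local_param \<tau>)"
proof -
  have f: "invariant_form k f" "bounded_at_cusp k f 1 0 0 1" using assms unfolding form_def by simp_all
  obtain K where K: "\<forall>\<^sub>F \<tau> in at_i_infinity. cmod (f \<tau>) \<le> K"
    using f(2) by (auto simp: bounded_at_cusp_def mob_def abs_factor_def)
  show ?thesis
  proof (rule local_expansion[of f K])
    show "f holomorphic_on upper_half_plane" using f(1) unfolding invariant_form_def by blast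
    fix \<tau> :: complex assume "Im \<tau> > 0"
    then have "f (mob 1 4 0 1 \<tau>) = theta_factor 0 1 \<tau> ^ k * f \<tau>"
      using f(1) unfolding invariant_form_def by simp
    then show "f (\<tau> + 4) = f \<tau>" by (simp add: mob_def theta_factor_def kronecker_1)
  qed (use K that in auto)
qed

lemma eventually_norm_le_local_param:
  assumes "g holomorphic_on ball 0 1" "g 0 = 0"
  obtains K where "K > 0" "\<forall>\<^sub>F \<tau> in at_i_infinity. cmod (g (local_param \<tau>)) \<le> K * cmod (local_param \<tau>)"
proof -
  obtain D where "(g has_field_derivative D) (at 0)"
    using assms(1) by (meson centre_in_ball holomorphic_on_imp_differentiable_at open_ball field_differentiable_def zero_less_one)
  then have "((\<lambda>x. g x / x) \<longlongrightarrow> D) (at 0)" by (simp add: has_field_derivative_iff assms(2))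
  from eventually_norm_le[OF filterlim_compose[OF this filterlim_local_param]]
  have "\<forall>\<^sub>F \<tau> in at_i_infinity. cmod (g (local_param \<tau>)) \<le> (cmod D + 1) * cmod (local_param \<tau>)"
    by eventually_elim (simp add: norm_divide divide_le_eq)
  then show ?thesis using that[of "cmod D + 1"] norm_ge_zero[of D] by linarith
qed

lemma norm_local_param_shift: "cmod (local_param (\<tau> + of_int n)) = cmod (local_param \<tau>)"
  by (simp add: norm_q_pow)

lemma eventually_shift:
  "eventually P at_i_infinity \<Longrightarrow> \<forall>\<^sub>F \<tau> in at_i_infinity. P (\<tau> + of_int n)"
  using filterlim_shift[of n] unfolding filterlim_iff by blast

lemma eventually_local_param_le:
  assumes "((\<lambda>\<tau>. h \<tau> / local_param \<tau>) \<longlongrightarrow> l) at_i_infinity" "l \<noteq> 0"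
  obtains \<delta> where "\<delta> > 0" "\<forall>\<^sub>F \<tau> in at_i_infinity. \<delta> * cmod (local_param \<tau>) \<le> cmod (h \<tau>)"
proof -
  have "\<forall>\<^sub>F \<tau> in at_i_infinity. cmod l / 2 < cmod (h \<tau> / local_param \<tau>)"
    by (rule order_tendstoD(1)[OF tendsto_norm[OF assms(1)]]) (use assms(2) in simp)
  then have "\<forall>\<^sub>F \<tau> in at_i_infinity. cmod l / 2 * cmod (local_param \<tau>) \<le> cmod (h \<tau>)"
  proof eventually_elim
    case (elim \<tau>)
    have "cmod (local_param \<tau>) > 0" by simp
    then show ?case using elim by (simp add: norm_divide field_simps)
  qed
  then show ?thesis using that[of "cmod l / 2"] assms(2) by simp
qed

text \<open>At the cusps equivalent to infinity, \<open>f\<close> is \<open>O(x)\<close> while \<open>theta_odd\<close> is bounded below by a multiple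
  of \<open>x\<close>; at the other ones \<open>theta_odd\<close> is bounded away from zero, relative to the automorphy factor.\<close>
lemma form_divide_theta_odd:
  assumes f: "form (Suc k) f" and g: "g holomorphic_on ball 0 1" "\<And>\<tau>. Im \<tau> > 0 \<Longrightarrow> f \<tau> = g (local_param \<tau>)" "g 0 = 0"
  shows "form k (\<lambda>\<tau>. f \<tau> / theta_odd \<tau>)"
proof -
  have inv_f: "invariant_form (Suc k) f" and inv_B: "invariant_form 1 theta_odd"
    using f form_theta unfolding form_def by blast+
  have "invariant_form k (\<lambda>\<tau>. f \<tau> / theta_odd \<tau>)"
    using inv_f inv_B theta_odd_nonzero by (intro invariant_form_divide[of k 1]) simp_all
  moreover have "bounded_at_cusp k (\<lambda>\<tau>. f \<tau> / theta_odd \<tau>) a b c d" if det: "a * d - b * c = 1" for a b c d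
  proof (cases "4 dvd c")
    case True
    obtain n :: int where n: "\<And>k f \<tau>. invariant_form k f \<Longrightarrow> Im \<tau> > 0 \<Longrightarrow>
        cmod (f (mob a b c d \<tau>)) = abs_factor c d \<tau> ^ k * cmod (f (\<tau> + of_int n))"
      using invariant_form_Gamma0[OF det True] by blast
    obtain K where K: "K > 0" "\<forall>\<^sub>F \<tau> in at_i_infinity. cmod (g (local_param \<tau>)) \<le> K * cmod (local_param \<tau>)"
      using eventually_norm_le_local_param[OF g(1,3)] by blast
    obtain \<delta> where \<delta>: "\<delta> > 0" "\<forall>\<^sub>F \<tau> in at_i_infinity. \<delta> * cmod (local_param \<tau>) \<le> cmod (theta_odd \<tau>)"
      using eventually_local_param_le[OF tendsto_theta_odd_quotient] by auto
    have "\<forall>\<^sub>F \<tau> in at_i_infinity. cmod (f (mob a b c d \<tau>) / theta_odd (mob a b c d \<tau>)) \<le> (K / \<delta>) * abs_factor c d \<tau> ^ k"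
      using eventually_shift[OF K(2), of n] eventually_shift[OF \<delta>(2), of n] eventually_Im_greater[of 0]
    proof eventually_elim
      case (elim \<tau>)
      have im: "Im (\<tau> + of_int n) > 0" using elim(3) by simp
      have J: "abs_factor c d \<tau> > 0" by (rule abs_factor_pos[OF elim(3) det])
      have x: "cmod (local_param (\<tau> + of_int n)) > 0" by simp
      have "cmod (f (\<tau> + of_int n)) / cmod (theta_odd (\<tau> + of_int n)) \<le>
          (K * cmod (local_param (\<tau> + of_int n))) / (\<delta> * cmod (local_param (\<tau> + of_int n)))"
        using elim(1,2) g(2)[OF im] \<delta>(1) x K(1) by (intro frac_le) simp_all
      also have "\<dots> = K / \<delta>" using x by simp
      finally have "abs_factor c d \<tau> ^ k * (cmod (f (\<tau> + of_int n)) / cmod (theta_odd (\<tau> + of_int n))) \<le> abs_factor c d \<tau> ^ k * (K / \<delta>)"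
        using J by (intro mult_left_mono) simp_all
      then show ?case
        unfolding norm_divide n[OF inv_f elim(3)] n[OF inv_B elim(3)] using J by (simp add: mult.commute)
    qed
    then show ?thesis unfolding bounded_at_cusp_def by blast
  next
    case False
    obtain \<delta> where \<delta>: "\<delta> > 0" "\<forall>\<^sub>F \<tau> in at_i_infinity. \<delta> * abs_factor c d \<tau> \<le> cmod (theta_odd (mob a b c d \<tau>))"
      using theta_odd_lower_bound[OF det False] by blast
    obtain K where K: "\<forall>\<^sub>F \<tau> in at_i_infinity. cmod (f (mob a b c d \<tau>)) \<le> K * abs_factor c d \<tau> ^ Suc k"
      using f det unfolding form_def bounded_at_cusp_def by blast
    have "\<forall>\<^sub>F \<tau> in at_i_infinity. cmod (f (mob a b c d \<tau>) / theta_odd (mob a b c d \<tau>)) \<le> (K / \<delta>) * abs_factor c d \<tau> ^ k"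
      using K \<delta>(2) eventually_Im_greater[of 0]
    proof eventually_elim
      case (elim \<tau>)
      have J: "abs_factor c d \<tau> > 0" by (rule abs_factor_pos[OF elim(3) det])
      have "cmod (f (mob a b c d \<tau>)) / cmod (theta_odd (mob a b c d \<tau>)) \<le> (K * abs_factor c d \<tau> ^ Suc k) / (\<delta> * abs_factor c d \<tau>)"
        using elim J \<delta>(1) by (intro frac_le) (auto intro: order_trans[OF norm_ge_zero])
      also have "\<dots> = (K / \<delta>) * abs_factor c d \<tau> ^ k" using J by simp
      finally show ?case unfolding norm_divide .
    qed
    then show ?thesis unfolding bounded_at_cusp_def by blast
  qed
  ultimately show ?thesis unfolding form_def by blast
qed

text \<open>A function of the local parameter that tends to zero is \<open>O(x)\<close>. At the cusps not equivalent to infinity this is applied to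
  the quotient \<open>f / theta_odd^k\<close>, which is truly periodic because its weight is zero.\<close>
lemma cuspidal_order:
  assumes f: "cuspidal k f" and det: "a * d - b * c = 1"
  obtains K where "K > 0"
    "\<forall>\<^sub>F \<tau> in at_i_infinity. cmod (f (mob a b c d \<tau>)) \<le> K * abs_factor c d \<tau> ^ k * cmod (local_param \<tau>)"
proof (cases "4 dvd c")
  case True
  have form: "form k f" and inv: "invariant_form k f" using f unfolding cuspidal_def form_def by blast+
  have van: "((\<lambda>\<tau>. cmod (f (mob a b c d \<tau>)) / abs_factor c d \<tau> ^ k) \<longlongrightarrow> 0) at_i_infinity"
    using f det unfolding cuspidal_def vanishing_at_cusp_def by blast
  obtain n :: int where n: "\<And>k f \<tau>. invariant_form k f \<Longrightarrow> Im \<tau> > 0 \<Longrightarrow>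
      cmod (f (mob a b c d \<tau>)) = abs_factor c d \<tau> ^ k * cmod (f (\<tau> + of_int n))"
    using invariant_form_Gamma0[OF det True] by blast
  obtain g where g: "g holomorphic_on ball 0 1" "\<And>\<tau>. Im \<tau> > 0 \<Longrightarrow> f \<tau> = g (local_param \<tau>)"
    using form_expansion[OF form] by blast
  have "((\<lambda>\<tau>. cmod (f (\<tau> + of_int n))) \<longlongrightarrow> 0) at_i_infinity"
  proof (rule Lim_transform_eventually[OF van])
    show "\<forall>\<^sub>F \<tau> in at_i_infinity. cmod (f (mob a b c d \<tau>)) / abs_factor c d \<tau> ^ k = cmod (f (\<tau> + of_int n))"
      using eventually_Im_greater[of 0]
    proof eventually_elim
      case (elim \<tau>)
      then show ?case using n[OF inv elim] abs_factor_pos[OF elim det] by simp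
    qed
  qed
  from filterlim_compose[OF this filterlim_shift[of "- n"]]
  have "(f \<longlongrightarrow> 0) at_i_infinity" by (simp add: tendsto_norm_zero_iff)
  moreover have "(f \<longlongrightarrow> g 0) at_i_infinity"
  proof (rule Lim_transform_eventually[OF tendsto_local_param[OF g(1)]])
    show "\<forall>\<^sub>F \<tau> in at_i_infinity. g (local_param \<tau>) = f \<tau>"
      using eventually_Im_greater[of 0] by eventually_elim (simp add: g(2))
  qed
  ultimately have "g 0 = 0" using tendsto_unique[OF at_i_infinity_neq_bot] by blast
  from eventually_norm_le_local_param[OF g(1) this]
  obtain K where K: "K > 0" "\<forall>\<^sub>F \<tau> in at_i_infinity. cmod (g (local_param \<tau>)) \<le> K * cmod (local_param \<tau>)" by blast
  have "\<forall>\<^sub>F \<tau> in at_i_infinity. cmod (f (mob a b c d \<tau>)) \<le> K * abs_factor c d \<tau> ^ k * cmod (local_param \<tau>)"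
    using eventually_shift[OF K(2), of n] eventually_Im_greater[of 0]
  proof eventually_elim
    case (elim \<tau>)
    have im: "Im (\<tau> + of_int n) > 0" using elim(2) by simp
    have "cmod (f (\<tau> + of_int n)) \<le> K * cmod (local_param \<tau>)"
      using elim(1) unfolding g(2)[OF im] norm_local_param_shift .
    then show ?case unfolding n[OF inv elim(2)]
      using mult_left_mono[of _ _ "abs_factor c d \<tau> ^ k"] abs_factor_pos[OF elim(2) det] by (simp add: mult_ac)
  qed
  then show ?thesis using that K(1) by blast
next
  case False
  have form: "form k f" and inv: "invariant_form k f" using f unfolding cuspidal_def form_def by blast+
  have van: "((\<lambda>\<tau>. cmod (f (mob a b c d \<tau>)) / abs_factor c d \<tau> ^ k) \<longlongrightarrow> 0) at_i_infinity"
    using f det unfolding cuspidal_def vanishing_at_cusp_def by blast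
  obtain \<delta> where \<delta>: "\<delta> > 0" "\<forall>\<^sub>F \<tau> in at_i_infinity. \<delta> * abs_factor c d \<tau> \<le> cmod (theta_odd (mob a b c d \<tau>))"
    using theta_odd_lower_bound[OF det False] by blast
  define u where "u \<tau> = f \<tau> / theta_odd \<tau> ^ k" for \<tau>
  have "form (k * 1) (\<lambda>\<tau>. theta_odd \<tau> ^ k)" by (intro form_power form_theta)
  then have "invariant_form k (\<lambda>\<tau>. theta_odd \<tau> ^ k)" unfolding form_def by simp
  then have inv_u: "invariant_form 0 u"
    unfolding u_def using inv theta_odd_nonzero by (intro invariant_form_divide[of 0 k]) simp_all
  have u_le: "\<forall>\<^sub>F \<tau> in at_i_infinity. cmod (u (mob a b c d \<tau>)) \<le> cmod (f (mob a b c d \<tau>)) / abs_factor c d \<tau> ^ k / \<delta> ^ k"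
    using \<delta>(2) eventually_Im_greater[of 0]
  proof eventually_elim
    case (elim \<tau>)
    have J: "abs_factor c d \<tau> > 0" by (rule abs_factor_pos[OF elim(2) det])
    have "(\<delta> * abs_factor c d \<tau>) ^ k \<le> cmod (theta_odd (mob a b c d \<tau>)) ^ k"
      using elim(1) \<delta>(1) J by (intro power_mono) simp_all
    then have "cmod (f (mob a b c d \<tau>)) / cmod (theta_odd (mob a b c d \<tau>)) ^ k \<le> cmod (f (mob a b c d \<tau>)) / (\<delta> * abs_factor c d \<tau>) ^ k"
      using \<delta>(1) J by (intro frac_le) simp_all
    then show ?case by (simp add: u_def norm_divide norm_power power_mult_distrib mult.commute)
  qed
  have lim_bound: "((\<lambda>\<tau>. cmod (f (mob a b c d \<tau>)) / abs_factor c d \<tau> ^ k / \<delta> ^ k) \<longlongrightarrow> 0 / \<delta> ^ k) at_i_infinity"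
    using \<delta>(1) by (intro tendsto_divide van tendsto_const) simp
  have u0: "((\<lambda>\<tau>. u (mob a b c d \<tau>)) \<longlongrightarrow> 0) at_i_infinity"
    by (rule Lim_null_comparison[OF u_le]) (use lim_bound in simp)
  obtain g where g: "g holomorphic_on ball 0 1" "\<And>\<tau>. Im \<tau> > 0 \<Longrightarrow> u (mob a b c d \<tau>) = g (local_param \<tau>)"
    using cusp_expansion[OF inv_u det eventually_norm_le[OF u0]] by blast
  have "((\<lambda>\<tau>. u (mob a b c d \<tau>)) \<longlongrightarrow> g 0) at_i_infinity"
  proof (rule Lim_transform_eventually[OF tendsto_local_param[OF g(1)]])
    show "\<forall>\<^sub>F \<tau> in at_i_infinity. g (local_param \<tau>) = u (mob a b c d \<tau>)"
      using eventually_Im_greater[of 0] by eventually_elim (simp add: g(2))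
  qed
  with u0 have "g 0 = 0" using tendsto_unique[OF at_i_infinity_neq_bot] by blast
  from eventually_norm_le_local_param[OF g(1) this]
  obtain K where K: "K > 0" "\<forall>\<^sub>F \<tau> in at_i_infinity. cmod (g (local_param \<tau>)) \<le> K * cmod (local_param \<tau>)" by blast
  obtain L where L: "\<forall>\<^sub>F \<tau> in at_i_infinity. cmod (theta_odd (mob a b c d \<tau>)) \<le> L * abs_factor c d \<tau> ^ 1"
    using form_theta(2) det unfolding form_def bounded_at_cusp_def by blast
  define L' where "L' = \<bar>L\<bar> + 1"
  have "\<forall>\<^sub>F \<tau> in at_i_infinity. cmod (f (mob a b c d \<tau>)) \<le> (K * L' ^ k) * abs_factor c d \<tau> ^ k * cmod (local_param \<tau>)"
    using K(2) L eventually_Im_greater[of 0]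
  proof eventually_elim
    case (elim \<tau>)
    have J: "abs_factor c d \<tau> > 0" by (rule abs_factor_pos[OF elim(3) det])
    have "L * abs_factor c d \<tau> \<le> L' * abs_factor c d \<tau>" using J by (intro mult_right_mono) (auto simp: L'_def)
    then have "cmod (theta_odd (mob a b c d \<tau>)) \<le> L' * abs_factor c d \<tau>" using elim(2) by simp
    then have B: "cmod (theta_odd (mob a b c d \<tau>)) ^ k \<le> (L' * abs_factor c d \<tau>) ^ k" by (intro power_mono) simp_all
    have "f (mob a b c d \<tau>) = g (local_param \<tau>) * theta_odd (mob a b c d \<tau>) ^ k"
      using g(2)[OF elim(3)] theta_odd_nonzero[OF Im_mob_pos[OF elim(3) det]] by (simp add: u_def field_simps)
    then have "cmod (f (mob a b c d \<tau>)) = cmod (g (local_param \<tau>)) * cmod (theta_odd (mob a b c d \<tau>)) ^ k"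
      by (simp only: norm_mult norm_power)
    also have "\<dots> \<le> (K * cmod (local_param \<tau>)) * (L' * abs_factor c d \<tau>) ^ k"
      using elim(1) B K(1) by (intro mult_mono) simp_all
    finally show ?case by (simp add: power_mult_distrib mult_ac)
  qed
  moreover have "K * L' ^ k > 0" using K(1) by (simp add: L'_def)
  ultimately show ?thesis using that by blast
qed

lemma form_divide_eta:
  assumes f: "cuspidal (k + 6) f"
  shows "form k (\<lambda>\<tau>. f \<tau> / dedekind_eta \<tau> ^ 6)"
proof -
  have "invariant_form k (\<lambda>\<tau>. f \<tau> / dedekind_eta \<tau> ^ 6)"
    using f form_eta dedekind_eta_nonzero unfolding cuspidal_def form_def by (intro invariant_form_divide[of k 6]) simp_all
  moreover have "bounded_at_cusp k (\<lambda>\<tau>. f \<tau> / dedekind_eta \<tau> ^ 6) a b c d" if det: "a * d - b * c = 1" for a b c d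
  proof -
    obtain K where K: "K > 0"
      "\<forall>\<^sub>F \<tau> in at_i_infinity. cmod (f (mob a b c d \<tau>)) \<le> K * abs_factor c d \<tau> ^ (k + 6) * cmod (local_param \<tau>)"
      using cuspidal_order[OF f det] by blast
    obtain \<delta> where \<delta>: "\<delta> > 0" "\<forall>\<^sub>F \<tau> in at_i_infinity. \<delta> * cmod (local_param \<tau>) \<le> cmod (dedekind_eta \<tau> ^ 6)"
      using eventually_local_param_le[OF tendsto_eta_quotient] by auto
    have "\<forall>\<^sub>F \<tau> in at_i_infinity. cmod (f (mob a b c d \<tau>) / dedekind_eta (mob a b c d \<tau>) ^ 6) \<le> (K / \<delta>) * abs_factor c d \<tau> ^ k"
      using K(2) \<delta>(2) eventually_Im_greater[of 0]
    proof eventually_elim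
      case (elim \<tau>)
      have J: "abs_factor c d \<tau> > 0" by (rule abs_factor_pos[OF elim(3) det])
      have "abs_factor c d \<tau> ^ 6 = (abs_factor c d \<tau> ^ 2) ^ 3" by (simp flip: power_mult)
      also have "abs_factor c d \<tau> ^ 2 = cmod (of_int c * \<tau> + of_int d)" by (simp add: abs_factor_def)
      finally have eta: "cmod (dedekind_eta (mob a b c d \<tau>) ^ 6) = abs_factor c d \<tau> ^ 6 * cmod (dedekind_eta \<tau> ^ 6)"
        using norm_eta_SL2Z[OF det elim(3)] by (simp only:)
      have x: "cmod (local_param \<tau>) > 0" by simp
      have "cmod (f (mob a b c d \<tau>)) / cmod (dedekind_eta (mob a b c d \<tau>) ^ 6) \<le>
        (K * abs_factor c d \<tau> ^ (k + 6) * cmod (local_param \<tau>)) / (abs_factor c d \<tau> ^ 6 * (\<delta> * cmod (local_param \<tau>)))"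
        unfolding eta using elim(1,2) J x \<delta>(1) K(1)
        by (intro frac_le mult_left_mono mult_pos_pos mult_nonneg_nonneg) simp_all
      also have "\<dots> = (K / \<delta>) * abs_factor c d \<tau> ^ k" using J x by (simp add: power_add)
      finally show ?case unfolding norm_divide .
    qed
    then show ?thesis unfolding bounded_at_cusp_def by blast
  qed
  ultimately show ?thesis unfolding form_def by blast
qed

text \<open>Multiplied by \<open>A^m\<close> and by \<open>B^m\<close>, where \<open>m = 6 - k\<close>, the function becomes \<open>C \<eta>^6\<close> and \<open>D \<eta>^6\<close>. Then
  \<open>C B^m = D A^m\<close>, and the limit at infinity gives \<open>D = 0\<close>.\<close>
lemma cuspidal_small_weight:
  assumes f: "cuspidal k f" and "k < 6" and \<tau>: "Im \<tau> > 0"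
  shows "f \<tau> = 0"
proof -
  define m where "m = 6 - k"
  have m: "k + m * 1 = 0 + 6" "m > 0" using assms(2) by (simp_all add: m_def)
  have cusp: "cuspidal (0 + 6) (\<lambda>\<tau>. f \<tau> * theta_even \<tau> ^ m)" "cuspidal (0 + 6) (\<lambda>\<tau>. f \<tau> * theta_odd \<tau> ^ m)"
    unfolding m(1)[symmetric] by (intro cuspidal_mult f form_power form_theta)+
  obtain C D where CD: "\<And>\<tau>. Im \<tau> > 0 \<Longrightarrow> f \<tau> * theta_even \<tau> ^ m / dedekind_eta \<tau> ^ 6 = C"
    "\<And>\<tau>. Im \<tau> > 0 \<Longrightarrow> f \<tau> * theta_odd \<tau> ^ m / dedekind_eta \<tau> ^ 6 = D"
    using form_0_constant[OF form_divide_eta[OF cusp(1)]] form_0_constant[OF form_divide_eta[OF cusp(2)]] by metis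
  have eq: "C * theta_odd \<tau> ^ m = D * theta_even \<tau> ^ m" if "Im \<tau> > 0" for \<tau>
    using CD(1)[OF that] CD(2)[OF that] by (auto simp: mult_ac)
  have "((\<lambda>\<tau>. C * theta_odd \<tau> ^ m) \<longlongrightarrow> C * 0 ^ m) at_i_infinity"
    by (intro tendsto_intros tendsto_theta_odd)
  moreover have "((\<lambda>\<tau>. D * theta_even \<tau> ^ m) \<longlongrightarrow> D * 1 ^ m) at_i_infinity"
    by (intro tendsto_intros tendsto_theta_even)
  then have "((\<lambda>\<tau>. C * theta_odd \<tau> ^ m) \<longlongrightarrow> D * 1 ^ m) at_i_infinity"
  proof (rule Lim_transform_eventually)
    show "\<forall>\<^sub>F \<tau> in at_i_infinity. D * theta_even \<tau> ^ m = C * theta_odd \<tau> ^ m"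
      using eventually_Im_greater[of 0] by eventually_elim (simp add: eq)
  qed
  ultimately have "D * 1 ^ m = C * 0 ^ m" using tendsto_unique[OF at_i_infinity_neq_bot] by blast
  then have "D = 0" using m(2) by simp
  then show ?thesis using CD(2)[OF \<tau>] theta_odd_nonzero[OF \<tau>] dedekind_eta_nonzero[OF \<tau>] by simp
qed

section \<open>The spaces of modular forms and cusp forms\<close>

text \<open>The notation for entries of matrices is shared with coefficients of power series.\<close>
abbreviation entry :: "int^2^2 \<Rightarrow> 2 \<Rightarrow> 2 \<Rightarrow> int" where
  "entry \<gamma> i j \<equiv> vec_nth (vec_nth \<gamma> i) j"

lemma SL2Z_iff: "\<gamma> \<in> SL2Z \<longleftrightarrow> entry \<gamma> 1 1 * entry \<gamma> 2 2 - entry \<gamma> 1 2 * entry \<gamma> 2 1 = 1"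
  by (simp add: SL2Z_def det_2)

lemma Gamma_4_iff:
  "\<gamma> \<in> principal_congruence_subgroup 4 \<longleftrightarrow> \<gamma> \<in> SL2Z \<and>
     entry \<gamma> 1 1 mod 4 = 1 \<and> 4 dvd entry \<gamma> 1 2 \<and> 4 dvd entry \<gamma> 2 1 \<and> entry \<gamma> 2 2 mod 4 = 1"
  by (auto simp: principal_congruence_subgroup_def forall_2 mat_def cong_def mod_eq_0_iff_dvd)

definition matrix_2 :: "int \<Rightarrow> int \<Rightarrow> int \<Rightarrow> int \<Rightarrow> int^2^2" where
  "matrix_2 a b c d = vector [vector [a, b], vector [c, d]]"

lemma matrix_2_entries [simp]:
  "entry (matrix_2 a b c d) 1 1 = a" "entry (matrix_2 a b c d) 1 2 = b"
  "entry (matrix_2 a b c d) 2 1 = c" "entry (matrix_2 a b c d) 2 2 = d"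
  by (simp_all add: matrix_2_def)

lemma act_mob: "act \<gamma> \<tau> = mob (entry \<gamma> 1 1) (entry \<gamma> 1 2) (entry \<gamma> 2 1) (entry \<gamma> 2 2) \<tau>"
  by (simp add: act_def moebius_def mob_def)

lemma automorphy_factor_eq: "automorphy_factor k \<gamma> \<tau> = theta_factor (entry \<gamma> 2 1) (entry \<gamma> 2 2) \<tau> ^ k"
  by (simp add: automorphy_factor_def theta_factor_def power_mult_distrib)

lemma norm_slash:
  assumes "entry \<gamma> 1 1 * entry \<gamma> 2 2 - entry \<gamma> 1 2 * entry \<gamma> 2 1 = 1"
  shows "cmod (slash k f \<gamma> \<tau>) = cmod (f (mob (entry \<gamma> 1 1) (entry \<gamma> 1 2) (entry \<gamma> 2 1) (entry \<gamma> 2 2) \<tau>)) / abs_factor (entry \<gamma> 2 1) (entry \<gamma> 2 2) \<tau> ^ k"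
  using norm_theta_factor[OF det_coprime[OF assms]]
  by (simp add: slash_def act_mob automorphy_factor_eq norm_divide norm_power)

lemma slash_invariant_iff:
  assumes "\<gamma> \<in> SL2Z" "Im \<tau> > 0"
  shows "slash k f \<gamma> \<tau> = f \<tau> \<longleftrightarrow>
    f (mob (entry \<gamma> 1 1) (entry \<gamma> 1 2) (entry \<gamma> 2 1) (entry \<gamma> 2 2) \<tau>) = theta_factor (entry \<gamma> 2 1) (entry \<gamma> 2 2) \<tau> ^ k * f \<tau>"
  using theta_factor_nonzero[OF assms(2) assms(1)[unfolded SL2Z_iff]]
  by (simp add: slash_def act_mob automorphy_factor_eq divide_eq_eq mult.commute)

lemma Bfun_slash_iff:
  assumes "entry \<gamma> 1 1 * entry \<gamma> 2 2 - entry \<gamma> 1 2 * entry \<gamma> 2 1 = 1"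
  shows "Bfun (slash k f \<gamma>) at_i_infinity \<longleftrightarrow> bounded_at_cusp k f (entry \<gamma> 1 1) (entry \<gamma> 1 2) (entry \<gamma> 2 1) (entry \<gamma> 2 2)"
proof -
  have J: "cmod (slash k f \<gamma> \<tau>) \<le> K \<longleftrightarrow>
     cmod (f (mob (entry \<gamma> 1 1) (entry \<gamma> 1 2) (entry \<gamma> 2 1) (entry \<gamma> 2 2) \<tau>)) \<le> K * abs_factor (entry \<gamma> 2 1) (entry \<gamma> 2 2) \<tau> ^ k"
    if "Im \<tau> > 0" for K \<tau>
    unfolding norm_slash[OF assms] using abs_factor_pos[OF that assms] by (simp add: divide_le_eq)
  show ?thesis
  proof
    assume "Bfun (slash k f \<gamma>) at_i_infinity"
    then obtain K where "\<forall>\<^sub>F \<tau> in at_i_infinity. cmod (slash k f \<gamma> \<tau>) \<le> K" by (auto simp: Bfun_def)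
    then have "\<forall>\<^sub>F \<tau> in at_i_infinity. cmod (f (mob (entry \<gamma> 1 1) (entry \<gamma> 1 2) (entry \<gamma> 2 1) (entry \<gamma> 2 2) \<tau>)) \<le> K * abs_factor (entry \<gamma> 2 1) (entry \<gamma> 2 2) \<tau> ^ k"
      using eventually_Im_greater[of 0] by eventually_elim (simp add: J)
    then show "bounded_at_cusp k f (entry \<gamma> 1 1) (entry \<gamma> 1 2) (entry \<gamma> 2 1) (entry \<gamma> 2 2)" unfolding bounded_at_cusp_def by blast
  next
    assume "bounded_at_cusp k f (entry \<gamma> 1 1) (entry \<gamma> 1 2) (entry \<gamma> 2 1) (entry \<gamma> 2 2)"
    then obtain K where "\<forall>\<^sub>F \<tau> in at_i_infinity. cmod (f (mob (entry \<gamma> 1 1) (entry \<gamma> 1 2) (entry \<gamma> 2 1) (entry \<gamma> 2 2) \<tau>)) \<le> K * abs_factor (entry \<gamma> 2 1) (entry \<gamma> 2 2) \<tau> ^ k"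
      unfolding bounded_at_cusp_def by blast
    then have "\<forall>\<^sub>F \<tau> in at_i_infinity. cmod (slash k f \<gamma> \<tau>) \<le> K"
      using eventually_Im_greater[of 0] by eventually_elim (simp add: J)
    then show "Bfun (slash k f \<gamma>) at_i_infinity" by (rule BfunI)
  qed
qed

lemma modular_forms_iff:
  "f \<in> modular_forms (principal_congruence_subgroup 4) k \<longleftrightarrow> f \<in> extensional upper_half_plane \<and> form k f"
proof -
  have "(\<forall>\<gamma>\<in>principal_congruence_subgroup 4. \<forall>\<tau>\<in>upper_half_plane. slash k f \<gamma> \<tau> = f \<tau>) \<longleftrightarrow>
    (\<forall>a b c d \<tau>. a * d - b * c = 1 \<longrightarrow> a mod 4 = 1 \<longrightarrow> 4 dvd b \<longrightarrow> 4 dvd c \<longrightarrow> d mod 4 = 1 \<longrightarrow> Im \<tau> > 0 \<longrightarrow>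
        f (mob a b c d \<tau>) = theta_factor c d \<tau> ^ k * f \<tau>)" (is "?L \<longleftrightarrow> ?R")
  proof
    assume ?L
    show ?R
    proof (intro allI impI)
      fix a b c d :: int and \<tau> :: complex
      assume *: "a * d - b * c = 1" "a mod 4 = 1" "4 dvd b" "4 dvd c" "d mod 4 = 1" "Im \<tau> > 0"
      have S: "matrix_2 a b c d \<in> SL2Z" using *(1) by (simp add: SL2Z_iff)
      then have "matrix_2 a b c d \<in> principal_congruence_subgroup 4" using * by (simp add: Gamma_4_iff)
      then have "slash k f (matrix_2 a b c d) \<tau> = f \<tau>" using \<open>?L\<close> *(6) by (simp add: upper_half_plane_def)
      then show "f (mob a b c d \<tau>) = theta_factor c d \<tau> ^ k * f \<tau>"
        using slash_invariant_iff[OF S *(6)] by simp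
    qed
  next
    assume R: ?R
    show ?L
    proof (intro ballI)
      fix \<gamma> :: "int^2^2" and \<tau> assume "\<gamma> \<in> principal_congruence_subgroup 4" "\<tau> \<in> upper_half_plane"
      then have *: "\<gamma> \<in> SL2Z" "entry \<gamma> 1 1 mod 4 = 1" "4 dvd entry \<gamma> 1 2" "4 dvd entry \<gamma> 2 1" "entry \<gamma> 2 2 mod 4 = 1" "Im \<tau> > 0"
        by (simp_all add: Gamma_4_iff upper_half_plane_def)
      then show "slash k f \<gamma> \<tau> = f \<tau>"
        unfolding slash_invariant_iff[OF *(1,6)] using R *(1)[unfolded SL2Z_iff] by blast
    qed
  qed
  moreover have "(\<forall>\<alpha>\<in>SL2Z. Bfun (slash k f \<alpha>) at_i_infinity) \<longleftrightarrow>
      (\<forall>a b c d. a * d - b * c = 1 \<longrightarrow> bounded_at_cusp k f a b c d)" (is "?L \<longleftrightarrow> ?R")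
  proof
    assume ?L
    show ?R
    proof (intro allI impI)
      fix a b c d :: int assume det: "a * d - b * c = 1"
      then have "matrix_2 a b c d \<in> SL2Z" by (simp add: SL2Z_iff)
      then have "Bfun (slash k f (matrix_2 a b c d)) at_i_infinity" using \<open>?L\<close> by blast
      then show "bounded_at_cusp k f a b c d" using Bfun_slash_iff[of "matrix_2 a b c d" k f] det by simp
    qed
  next
    assume ?R
    then show ?L using Bfun_slash_iff by (simp add: SL2Z_iff)
  qed
  ultimately show ?thesis unfolding modular_forms_def form_def invariant_form_def by auto
qed

lemma cusp_forms_iff:
  "f \<in> cusp_forms (principal_congruence_subgroup 4) k \<longleftrightarrow> f \<in> extensional upper_half_plane \<and> cuspidal k f"
proof -
  have slash_iff: "(slash k f \<gamma> \<longlongrightarrow> 0) at_i_infinity \<longleftrightarrow> vanishing_at_cusp k f (entry \<gamma> 1 1) (entry \<gamma> 1 2) (entry \<gamma> 2 1) (entry \<gamma> 2 2)"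
    if "\<gamma> \<in> SL2Z" for \<gamma>
    unfolding vanishing_at_cusp_def norm_slash[OF that[unfolded SL2Z_iff], symmetric]
    by (rule tendsto_norm_zero_iff[symmetric])
  have "(\<forall>\<alpha>\<in>SL2Z. (slash k f \<alpha> \<longlongrightarrow> 0) at_i_infinity) \<longleftrightarrow>
      (\<forall>a b c d. a * d - b * c = 1 \<longrightarrow> vanishing_at_cusp k f a b c d)" (is "?L \<longleftrightarrow> ?R")
  proof
    assume ?L
    show ?R
    proof (intro allI impI)
      fix a b c d :: int assume "a * d - b * c = 1"
      then have S: "matrix_2 a b c d \<in> SL2Z" by (simp add: SL2Z_iff)
      then have "(slash k f (matrix_2 a b c d) \<longlongrightarrow> 0) at_i_infinity" using \<open>?L\<close> by blast
      then show "vanishing_at_cusp k f a b c d" using slash_iff[OF S] by simp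
    qed
  next
    assume ?R
    then show ?L using slash_iff by (simp add: SL2Z_iff)
  qed
  then show ?thesis unfolding cusp_forms_def cuspidal_def by (auto simp: modular_forms_iff)
qed

lemma restrict_form: "form k f \<Longrightarrow> restrict f upper_half_plane \<in> modular_forms (principal_congruence_subgroup 4) k"
  unfolding modular_forms_iff
  using form_cong[of f "restrict f upper_half_plane" k] by (auto simp: upper_half_plane_def)

lemma restrict_cuspidal: "cuspidal k f \<Longrightarrow> restrict f upper_half_plane \<in> cusp_forms (principal_congruence_subgroup 4) k"
  unfolding cusp_forms_iff
  using cuspidal_cong[of f "restrict f upper_half_plane" k] by (auto simp: upper_half_plane_def)

section \<open>Sums over all weights\<close>

lemma sum_of_weights_incl:
  assumes "f \<in> V k" "f \<in> extensional upper_half_plane"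
  shows "f \<in> sum_of_weights V"
  unfolding sum_of_weights_def
  by (rule CollectI, rule exI[of _ "{k}"], rule exI[of _ "\<lambda>_. f"])
     (simp add: assms(1) extensional_restrict[OF assms(2)] del: restrict_apply)

lemma sum_of_weights_induct [consumes 1, case_names zero add]:
  assumes "f \<in> sum_of_weights V" and "P (\<lambda>\<tau>\<in>upper_half_plane. 0)"
    and step: "\<And>k g f. g \<in> V k \<Longrightarrow> P f \<Longrightarrow> P (\<lambda>\<tau>\<in>upper_half_plane. g \<tau> + f \<tau>)"
  shows "P f"
proof -
  obtain K F where f: "f = (\<lambda>\<tau>\<in>upper_half_plane. \<Sum>k\<in>K. F k \<tau>)" "finite K" "\<forall>k\<in>K. F k \<in> V k"
    using assms(1) unfolding sum_of_weights_def by blast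
  show ?thesis unfolding f(1) using f(2,3)
  proof (induction K rule: finite_induct)
    case empty
    show ?case using assms(2) by (simp only: sum.empty)
  next
    case (insert k K)
    then have "P (\<lambda>\<tau>\<in>upper_half_plane. F k \<tau> + (\<lambda>\<tau>\<in>upper_half_plane. \<Sum>k\<in>K. F k \<tau>) \<tau>)"
      by (intro step[of _ k]) simp_all
    moreover have "(\<lambda>\<tau>\<in>upper_half_plane. F k \<tau> + (\<lambda>\<tau>\<in>upper_half_plane. \<Sum>k\<in>K. F k \<tau>) \<tau>) =
        (\<lambda>\<tau>\<in>upper_half_plane. \<Sum>k\<in>insert k K. F k \<tau>)"
      using insert.hyps by (intro restrict_ext) simp
    ultimately show ?case by (simp only:)
  qed
qed

lemma sum_of_weights_zero: "(\<lambda>\<tau>\<in>upper_half_plane. 0) \<in> sum_of_weights V"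
  unfolding sum_of_weights_def by (rule CollectI, rule exI[of _ "{}"]) simp

lemma sum_of_weights_add:
  assumes add: "\<And>k f g. f \<in> V k \<Longrightarrow> g \<in> V k \<Longrightarrow> (\<lambda>\<tau>\<in>upper_half_plane. f \<tau> + g \<tau>) \<in> V k"
    and zero: "\<And>k. (\<lambda>\<tau>\<in>upper_half_plane. 0) \<in> V k"
    and "f \<in> sum_of_weights V" "g \<in> sum_of_weights V"
  shows "(\<lambda>\<tau>\<in>upper_half_plane. f \<tau> + g \<tau>) \<in> sum_of_weights V"
proof -
  obtain K F where f: "f = (\<lambda>\<tau>\<in>upper_half_plane. \<Sum>k\<in>K. F k \<tau>)" "finite K" "\<forall>k\<in>K. F k \<in> V k"
    using assms(3) unfolding sum_of_weights_def by blast
  obtain L G where g: "g = (\<lambda>\<tau>\<in>upper_half_plane. \<Sum>k\<in>L. G k \<tau>)" "finite L" "\<forall>k\<in>L. G k \<in> V k"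
    using assms(4) unfolding sum_of_weights_def by blast
  define z :: "complex \<Rightarrow> complex" where "z = (\<lambda>\<tau>\<in>upper_half_plane. 0)"
  define F' where "F' k = (if k \<in> K then F k else z)" for k
  define G' where "G' k = (if k \<in> L then G k else z)" for k
  define H where "H k = (\<lambda>\<tau>\<in>upper_half_plane. F' k \<tau> + G' k \<tau>)" for k
  have "H k \<in> V k" for k unfolding H_def
    using f(3) g(3) zero by (intro add) (simp_all add: F'_def G'_def z_def)
  moreover have "(\<lambda>\<tau>\<in>upper_half_plane. f \<tau> + g \<tau>) = (\<lambda>\<tau>\<in>upper_half_plane. \<Sum>k\<in>K \<union> L. H k \<tau>)"
  proof (rule restrict_ext)
    fix \<tau> assume \<tau>: "\<tau> \<in> upper_half_plane"
    have "(\<Sum>k\<in>K \<union> L. F' k \<tau>) = (\<Sum>k\<in>K. F k \<tau>)"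
      using f(2) g(2) \<tau> by (intro sum.mono_neutral_cong_right) (auto simp: F'_def z_def)
    moreover have "(\<Sum>k\<in>K \<union> L. G' k \<tau>) = (\<Sum>k\<in>L. G k \<tau>)"
      using f(2) g(2) \<tau> by (intro sum.mono_neutral_cong_right) (auto simp: G'_def z_def)
    ultimately show "f \<tau> + g \<tau> = (\<Sum>k\<in>K \<union> L. H k \<tau>)"
      using \<tau> by (simp add: f(1) g(1) H_def sum.distrib)
  qed
  moreover have "finite (K \<union> L)" using f(2) g(2) by simp
  ultimately show ?thesis unfolding sum_of_weights_def by blast
qed

abbreviation "all_modular_forms \<equiv> sum_of_weights (modular_forms (principal_congruence_subgroup 4))"
abbreviation "all_cusp_forms \<equiv> sum_of_weights (cusp_forms (principal_congruence_subgroup 4))"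

lemma all_modular_forms_incl: "form k f \<Longrightarrow> restrict f upper_half_plane \<in> all_modular_forms"
  using sum_of_weights_incl[of "restrict f upper_half_plane" "modular_forms (principal_congruence_subgroup 4)" k]
    restrict_form restrict_extensional by blast

lemma all_cusp_forms_incl: "cuspidal k f \<Longrightarrow> restrict f upper_half_plane \<in> all_cusp_forms"
  using sum_of_weights_incl[of "restrict f upper_half_plane" "cusp_forms (principal_congruence_subgroup 4)" k]
    restrict_cuspidal restrict_extensional by blast

lemma all_modular_forms_add:
  assumes "f \<in> all_modular_forms" "g \<in> all_modular_forms"
  shows "(\<lambda>\<tau>\<in>upper_half_plane. f \<tau> + g \<tau>) \<in> all_modular_forms"
proof (rule sum_of_weights_add[OF _ _ assms])
  show "(\<lambda>\<tau>\<in>upper_half_plane. f \<tau> + g \<tau>) \<in> modular_forms (principal_congruence_subgroup 4) k"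
    if "f \<in> modular_forms (principal_congruence_subgroup 4) k" "g \<in> modular_forms (principal_congruence_subgroup 4) k" for k f g
    using that by (intro restrict_form form_add) (simp_all add: modular_forms_iff)
qed (intro restrict_form form_zero)

lemma all_cusp_forms_add:
  assumes "f \<in> all_cusp_forms" "g \<in> all_cusp_forms"
  shows "(\<lambda>\<tau>\<in>upper_half_plane. f \<tau> + g \<tau>) \<in> all_cusp_forms"
proof (rule sum_of_weights_add[OF _ _ assms])
  show "(\<lambda>\<tau>\<in>upper_half_plane. f \<tau> + g \<tau>) \<in> cusp_forms (principal_congruence_subgroup 4) k"
    if "f \<in> cusp_forms (principal_congruence_subgroup 4) k" "g \<in> cusp_forms (principal_congruence_subgroup 4) k" for k f g
    using that by (intro restrict_cuspidal cuspidal_add) (simp_all add: cusp_forms_iff)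
  have "cuspidal k (\<lambda>_. 0)" for k
    unfolding cuspidal_def vanishing_at_cusp_def using form_zero by simp
  then show "(\<lambda>\<tau>\<in>upper_half_plane. 0) \<in> cusp_forms (principal_congruence_subgroup 4) k" for k
    by (rule restrict_cuspidal)
qed

lemma all_modular_forms_mult:
  assumes "f \<in> all_modular_forms" "g \<in> all_modular_forms"
  shows "(\<lambda>\<tau>\<in>upper_half_plane. f \<tau> * g \<tau>) \<in> all_modular_forms"
  using assms(1)
proof (induction f rule: sum_of_weights_induct)
  case zero
  have "(\<lambda>\<tau>\<in>upper_half_plane. (\<lambda>\<tau>\<in>upper_half_plane. 0) \<tau> * g \<tau>) = (\<lambda>\<tau>\<in>upper_half_plane. 0)"
    by (rule restrict_ext) simp
  then show ?case using sum_of_weights_zero by (simp only:)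
next
  case (add k h f)
  have "(\<lambda>\<tau>\<in>upper_half_plane. h \<tau> * g \<tau>) \<in> all_modular_forms"
    using assms(2)
  proof (induction g rule: sum_of_weights_induct)
    case zero
    have "(\<lambda>\<tau>\<in>upper_half_plane. h \<tau> * (\<lambda>\<tau>\<in>upper_half_plane. 0) \<tau>) = (\<lambda>\<tau>\<in>upper_half_plane. 0)"
      by (rule restrict_ext) simp
    then show ?case using sum_of_weights_zero by (simp only:)
  next
    case (add j u g)
    have "form (k + j) (\<lambda>\<tau>. h \<tau> * u \<tau>)"
      using \<open>h \<in> modular_forms (principal_congruence_subgroup 4) k\<close> \<open>u \<in> modular_forms (principal_congruence_subgroup 4) j\<close>
      by (intro form_mult) (simp_all add: modular_forms_iff)
    from all_modular_forms_add[OF all_modular_forms_incl[OF this] add.IH]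
    show ?case by (rule back_subst[where P = "\<lambda>x. x \<in> all_modular_forms"])
       (rule restrict_ext, simp add: algebra_simps)
  qed
  from all_modular_forms_add[OF this add.IH]
  show ?case by (rule back_subst[where P = "\<lambda>x. x \<in> all_modular_forms"])
     (rule restrict_ext, simp add: algebra_simps)
qed

section \<open>Generation of the ring of modular forms\<close>

definition in_algebra :: "(complex \<Rightarrow> complex) set \<Rightarrow> (complex \<Rightarrow> complex) \<Rightarrow> bool" where
  "in_algebra G f \<longleftrightarrow> restrict f upper_half_plane \<in> generated_algebra G"

lemma in_algebra_const: "in_algebra G (\<lambda>_. C)"
  unfolding in_algebra_def by (rule generated_algebra.const)

lemma in_algebra_add:
  assumes "in_algebra G f" "in_algebra G g"
  shows "in_algebra G (\<lambda>\<tau>. f \<tau> + g \<tau>)"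
  using generated_algebra.add[OF assms[unfolded in_algebra_def]] unfolding in_algebra_def
  by (rule back_subst[where P = "\<lambda>x. x \<in> generated_algebra G"]) (rule restrict_ext, simp)

lemma in_algebra_mult:
  assumes "in_algebra G f" "in_algebra G g"
  shows "in_algebra G (\<lambda>\<tau>. f \<tau> * g \<tau>)"
  using generated_algebra.mult[OF assms[unfolded in_algebra_def]] unfolding in_algebra_def
  by (rule back_subst[where P = "\<lambda>x. x \<in> generated_algebra G"]) (rule restrict_ext, simp)

lemma in_algebra_power: "in_algebra G f \<Longrightarrow> in_algebra G (\<lambda>\<tau>. f \<tau> ^ n)"
  by (induction n) (simp_all add: in_algebra_const in_algebra_mult)

lemma in_algebra_cong:
  assumes "\<And>\<tau>. Im \<tau> > 0 \<Longrightarrow> f \<tau> = g \<tau>" "in_algebra G f"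
  shows "in_algebra G g"
  using assms(2) unfolding in_algebra_def
  by (rule back_subst[where P = "\<lambda>x. x \<in> generated_algebra G"])
     (rule restrict_ext, simp add: assms(1) upper_half_plane_def)

lemma in_algebra_linear:
  assumes "in_algebra G f" "in_algebra G g" "\<And>\<tau>. Im \<tau> > 0 \<Longrightarrow> C * f \<tau> + D * g \<tau> = h \<tau>"
  shows "in_algebra G h"
proof (rule in_algebra_cong)
  show "in_algebra G (\<lambda>\<tau>. C * f \<tau> + D * g \<tau>)"
    by (intro in_algebra_add in_algebra_mult in_algebra_const assms(1,2))
qed (rule assms(3))

lemma generated_algebra_subset:
  assumes "\<And>f. f \<in> G \<Longrightarrow> f \<in> generated_algebra H"
  shows "generated_algebra G \<subseteq> generated_algebra H"
proof
  fix f assume "f \<in> generated_algebra G"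
  then show "f \<in> generated_algebra H"
  proof (induction rule: generated_algebra.induct)
    case (const c)
    show ?case by (rule generated_algebra.const)
  next
    case (gen f)
    then show ?case by (rule assms)
  next
    case (add f g)
    show ?case by (rule generated_algebra.add[OF add.IH])
  next
    case (mult f g)
    show ?case by (rule generated_algebra.mult[OF mult.IH])
  qed
qed

text \<open>The descent: subtract a multiple of \<open>A^(k+1)\<close> to remove the constant term, and divide by \<open>B\<close>.\<close>
lemma form_in_algebra:
  assumes even: "in_algebra G theta_even" and odd: "in_algebra G theta_odd"
  shows "form k f \<Longrightarrow> in_algebra G f"
proof (induction k arbitrary: f)
  case 0
  obtain C where "\<And>\<tau>. Im \<tau> > 0 \<Longrightarrow> f \<tau> = C" using form_0_constant[OF 0] by blast
  then show ?case by (intro in_algebra_cong[OF _ in_algebra_const[of G C]]) simp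
next
  case (Suc k)
  obtain g where g: "g holomorphic_on ball 0 1" "\<And>\<tau>. Im \<tau> > 0 \<Longrightarrow> f \<tau> = g (local_param \<tau>)"
    using form_expansion[OF Suc.prems] by blast
  define h where "h \<tau> = f \<tau> + (- g 0) * theta_even \<tau> ^ Suc k" for \<tau>
  have "form (Suc k * 1) (\<lambda>\<tau>. theta_even \<tau> ^ Suc k)" by (intro form_power form_theta)
  then have h: "form (Suc k) h" unfolding h_def[abs_def] by (intro form_cmult_add Suc.prems) simp
  have "(\<lambda>x. theta_series (x ^ 4)) holomorphic_on ball 0 1"
    by (rule holomorphic_on_compose_gen[unfolded o_def, OF _ theta_series_holomorphic])
       (auto simp: norm_power power_less_one_iff intro!: holomorphic_intros)
  then have "(\<lambda>x. g x + (- g 0) * theta_series (x ^ 4) ^ Suc k) holomorphic_on ball 0 1"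
    by (intro holomorphic_intros g(1))
  moreover have "h \<tau> = g (local_param \<tau>) + (- g 0) * theta_series (local_param \<tau> ^ 4) ^ Suc k" if "Im \<tau> > 0" for \<tau>
    using g(2)[OF that] theta_even_series[OF that] by (simp add: h_def)
  moreover have "g 0 + (- g 0) * theta_series (0 ^ 4) ^ Suc k = 0"
    by (simp add: theta_series_def zero_power)
  ultimately have "form k (\<lambda>\<tau>. h \<tau> / theta_odd \<tau>)" by (rule form_divide_theta_odd[OF h])
  from Suc.IH[OF this] have "in_algebra G (\<lambda>\<tau>. h \<tau> / theta_odd \<tau> * theta_odd \<tau> + g 0 * theta_even \<tau> ^ Suc k)"
    by (intro in_algebra_add in_algebra_mult in_algebra_const in_algebra_power even odd)
  then show ?case
  proof (rule in_algebra_cong[rotated])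
    fix \<tau> :: complex assume "Im \<tau> > 0"
    from theta_odd_nonzero[OF this]
    show "h \<tau> / theta_odd \<tau> * theta_odd \<tau> + g 0 * theta_even \<tau> ^ Suc k = f \<tau>" by (simp add: h_def)
  qed
qed

lemma in_algebra_all_modular_forms:
  assumes "in_algebra G theta_even" "in_algebra G theta_odd" "f \<in> all_modular_forms"
  shows "f \<in> generated_algebra G"
  using assms(3)
proof (induction f rule: sum_of_weights_induct)
  case zero
  show ?case by (rule generated_algebra.const)
next
  case (add k g f)
  then have "g \<in> extensional upper_half_plane" "in_algebra G g"
    using form_in_algebra[OF assms(1,2)] by (auto simp: modular_forms_iff)
  then have "g \<in> generated_algebra G" by (simp add: in_algebra_def extensional_restrict)
  then show ?case using add.IH by (rule generated_algebra.add)
qed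

lemma generated_algebra_subset_all_modular_forms:
  assumes "\<And>f. f \<in> G \<Longrightarrow> f \<in> all_modular_forms"
  shows "generated_algebra G \<subseteq> all_modular_forms"
proof
  fix f assume "f \<in> generated_algebra G"
  then show "f \<in> all_modular_forms"
  proof (induction rule: generated_algebra.induct)
    case (const C)
    show ?case by (rule all_modular_forms_incl[OF form_const])
  next
    case (gen f)
    then show ?case by (rule assms)
  next
    case (add f g)
    show ?case by (rule all_modular_forms_add[OF add.IH])
  next
    case (mult f g)
    show ?case by (rule all_modular_forms_mult[OF mult.IH])
  qed
qed

theorem theorem24:
  shows "sum_of_weights (modular_forms (principal_congruence_subgroup 4)) =
           generated_algebra {\<lambda>\<tau>\<in>upper_half_plane. theta (\<tau> / 4), \<lambda>\<tau>\<in>upper_half_plane. theta \<tau>}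
       \<and> generated_algebra {\<lambda>\<tau>\<in>upper_half_plane. theta (\<tau> / 4), \<lambda>\<tau>\<in>upper_half_plane. theta \<tau>} =
           generated_algebra {\<lambda>\<tau>\<in>upper_half_plane. eta_flat (\<tau> / 2), \<lambda>\<tau>\<in>upper_half_plane. eta_sharp (2 * \<tau>)}
       \<and> sum_of_weights (cusp_forms (principal_congruence_subgroup 4)) =
           (\<lambda>f. \<lambda>\<tau>\<in>upper_half_plane. f \<tau> * dedekind_eta \<tau> ^ 6) `
             sum_of_weights (modular_forms (principal_congruence_subgroup 4))"
proof (intro conjI)
  let ?G = "{\<lambda>\<tau>\<in>upper_half_plane. theta (\<tau> / 4), \<lambda>\<tau>\<in>upper_half_plane. theta \<tau>}"
  let ?E = "{\<lambda>\<tau>\<in>upper_half_plane. eta_flat (\<tau> / 2), \<lambda>\<tau>\<in>upper_half_plane. eta_sharp (2 * \<tau>)}"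
  have G: "in_algebra ?G (\<lambda>\<tau>. theta (\<tau> / 4))" "in_algebra ?G theta"
    unfolding in_algebra_def by (rule generated_algebra.gen, simp)+
  have E: "in_algebra ?E (\<lambda>\<tau>. eta_flat (\<tau> / 2))" "in_algebra ?E (\<lambda>\<tau>. eta_sharp (2 * \<tau>))"
    unfolding in_algebra_def by (rule generated_algebra.gen, simp)+
  have G_even: "in_algebra ?G theta_even" using G(2) unfolding theta_even_def[abs_def] .
  have G_odd: "in_algebra ?G theta_odd"
    by (rule in_algebra_linear[OF G, of 1 "- 1"]) (simp add: theta_odd_def)
  have E_even: "in_algebra ?E theta_even"
    by (rule in_algebra_linear[OF E, of 1 2]) (simp add: eta_flat_half eta_sharp_double)
  have E_odd: "in_algebra ?E theta_odd"
    by (rule in_algebra_linear[OF E, of 0 2]) (simp add: eta_sharp_double)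
  show "all_modular_forms = generated_algebra ?G"
  proof (rule antisym)
    show "all_modular_forms \<subseteq> generated_algebra ?G"
      using in_algebra_all_modular_forms[OF G_even G_odd] by blast
    have "form 1 theta" using form_theta(1) unfolding theta_even_def[abs_def] .
    moreover have "form 1 (\<lambda>\<tau>. theta (\<tau> / 4))"
      using form_add[OF form_theta] by (simp add: theta_even_def theta_odd_def)
    ultimately show "generated_algebra ?G \<subseteq> all_modular_forms"
      using all_modular_forms_incl by (intro generated_algebra_subset_all_modular_forms) blast
  qed
  show "generated_algebra ?G = generated_algebra ?E"
  proof (rule antisym)
    have "in_algebra ?E theta" using E_even unfolding theta_even_def[abs_def] .
    moreover have "in_algebra ?E (\<lambda>\<tau>. theta (\<tau> / 4))"
      by (rule in_algebra_linear[OF E_even E_odd, of 1 1]) (simp add: theta_even_def theta_odd_def)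
    ultimately show "generated_algebra ?G \<subseteq> generated_algebra ?E"
      unfolding in_algebra_def by (intro generated_algebra_subset) blast
    have "in_algebra ?G (\<lambda>\<tau>. eta_flat (\<tau> / 2))"
      by (rule in_algebra_linear[OF G_even G_odd, of 1 "- 1"]) (simp add: eta_flat_half)
    moreover have "in_algebra ?G (\<lambda>\<tau>. eta_sharp (2 * \<tau>))"
      by (rule in_algebra_linear[OF G_even G_odd, of 0 "1/2"]) (simp add: eta_sharp_double)
    ultimately show "generated_algebra ?E \<subseteq> generated_algebra ?G"
      unfolding in_algebra_def by (intro generated_algebra_subset) blast
  qed
  show "all_cusp_forms = (\<lambda>f. \<lambda>\<tau>\<in>upper_half_plane. f \<tau> * dedekind_eta \<tau> ^ 6) ` all_modular_forms"
    (is "_ = ?mult ` _")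
  proof (rule antisym; rule subsetI)
    fix f assume "f \<in> all_cusp_forms"
    then show "f \<in> ?mult ` all_modular_forms"
    proof (induction f rule: sum_of_weights_induct)
      case zero
      have "(\<lambda>\<tau>\<in>upper_half_plane. 0) = ?mult (\<lambda>\<tau>\<in>upper_half_plane. 0)" by (rule restrict_ext) simp
      then show ?case using sum_of_weights_zero by (rule image_eqI)
    next
      case (add k g f)
      obtain u where u: "u \<in> all_modular_forms" "f = ?mult u" using add.IH by blast
      have g: "cuspidal k g" using add.hyps by (simp add: cusp_forms_iff)
      obtain v where v: "v \<in> all_modular_forms" "\<And>\<tau>. \<tau> \<in> upper_half_plane \<Longrightarrow> g \<tau> = v \<tau> * dedekind_eta \<tau> ^ 6"
      proof (cases "k < 6")
        case True
        show ?thesis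
          by (rule that[OF sum_of_weights_zero])
             (use cuspidal_small_weight[OF g True] in \<open>simp add: upper_half_plane_def\<close>)
      next
        case False
        then obtain j where "k = j + 6" using le_Suc_ex[of 6 k] by (auto simp: add.commute)
        with g have "form j (\<lambda>\<tau>. g \<tau> / dedekind_eta \<tau> ^ 6)" by (intro form_divide_eta) simp
        then show ?thesis
          by (rule that[OF all_modular_forms_incl]) (simp add: upper_half_plane_def dedekind_eta_nonzero)
      qed
      have "(\<lambda>\<tau>\<in>upper_half_plane. g \<tau> + f \<tau>) = ?mult (\<lambda>\<tau>\<in>upper_half_plane. v \<tau> + u \<tau>)"
        by (rule restrict_ext) (simp add: v(2) u(2) distrib_right)
      then show ?case using all_modular_forms_add[OF v(1) u(1)] by (rule image_eqI)
    qed
  next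
    fix f assume "f \<in> ?mult ` all_modular_forms"
    then obtain u where u: "u \<in> all_modular_forms" "f = ?mult u" by blast
    show "f \<in> all_cusp_forms"
      unfolding u(2) using u(1)
    proof (induction u rule: sum_of_weights_induct)
      case zero
      have "?mult (\<lambda>\<tau>\<in>upper_half_plane. 0) = (\<lambda>\<tau>\<in>upper_half_plane. 0)" by (rule restrict_ext) simp
      then show ?case using sum_of_weights_zero by (simp only:)
    next
      case (add k g u)
      have "form k g" using add.hyps by (simp add: modular_forms_iff)
      from all_cusp_forms_add[OF all_cusp_forms_incl[OF cuspidal_mult[OF cuspidal_eta this]] add.IH]
      show ?case by (rule back_subst[where P = "\<lambda>x. x \<in> all_cusp_forms"])
         (rule restrict_ext, simp add: algebra_simps)
    qed
  qed
qed

end
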